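(* Let $t$ be a positive integer. Every graph $G$ of twin-width at most $2$ that does not contain the half-graph $H_t$ as a semi-induced subgraph has rank-width at most $22t+170$. In particular, every monadically stable graph class all of whose members have twin-width at most $2$ has bounded rank-width.
   Context: All graphs are finite and simple. Twin-width: for a partition $\mathcal P$ of $V(G)$, the quotient trigraph $G/\mathcal P$ has parts as vertices, with a red edge between two parts that are neither fully adjacent nor fully non-adjacent (black edge if fully adjacent, none if non-adjacent); a partition sequence starts from singletons and merges two parts per step until one part remains; width is the maximum red degree over all quotients; twin-width is the minimum width. The half-graph $H_t$ has vertices $v_1,\dots,v_t,w_1,\dots,w_t$, with $v_iw_j$ an edge iff $i\le j$; $H_t$ is a semi-induced subgraph of $G$ if there is an injection $\iota:V(H_t)\to V(G)$ with $\iota(v_i)\iota(w_j)\in E(G)$ iff $i\le j$. Rank-width: a rank-decomposition is a subcubic (binary) tree whose leaves are in bijection with $V(G)$; each tree edge induces a bipartition $(A,B)$ of $V(G)$, of width the $\mathbb F_2$-rank of the $A\times B$ biadjacency matrix; rank-width is the minimum over decompositions of the maximum width of a tree edge. A graph class is monadically stable if it does not first-order transduce the class of all half-graphs $\{H_t:t\in\mathbb N\}$. *)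

theory Defs
  imports
    "Graph_Theory.Graph_Theory"
    "HOL-Library.Disjoint_Sets"
    "HOL-Library.Function_Algebras"
    "HOL-Library.Z2"
begin

text \<open>
  A finite simple graph is a \<^term>\<open>pair_graph\<close>: a finite loop-free digraph without parallel
  arcs whose arc relation is symmetric, so that an undirected edge \<open>uv\<close> is the pair of arcs
  \<open>(u,v)\<close>, \<open>(v,u)\<close>.  The vertex set may be empty.
\<close>

section \<open>Twin-width\<close>

definition red_edge :: "'a pair_pre_digraph \<Rightarrow> 'a set \<Rightarrow> 'a set \<Rightarrow> bool" where
  "red_edge G X Y \<longleftrightarrow> X \<noteq> Y
     \<and> \<not> (\<forall>x\<in>X. \<forall>y\<in>Y. (x, y) \<in> parcs G)
     \<and> \<not> (\<forall>x\<in>X. \<forall>y\<in>Y. (x, y) \<notin> parcs G)"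

definition red_degree :: "'a pair_pre_digraph \<Rightarrow> 'a set set \<Rightarrow> 'a set \<Rightarrow> nat" where
  "red_degree G P X = card {Y \<in> P. red_edge G X Y}"

definition max_red_degree :: "'a pair_pre_digraph \<Rightarrow> 'a set set \<Rightarrow> nat" where
  "max_red_degree G P = Max (insert 0 (red_degree G P ` P))"

definition merges_to :: "'a set set \<Rightarrow> 'a set set \<Rightarrow> bool" where
  "merges_to P Q \<longleftrightarrow> (\<exists>X\<in>P. \<exists>Y\<in>P. X \<noteq> Y \<and> Q = insert (X \<union> Y) (P - {X, Y}))"

text \<open>
  The bound \<open>card (last Ps) \<le> 1\<close> means that exactly one part remains, except that it also admits
  the sequence consisting of the empty partition when \<open>G\<close> has no vertices; the empty
  graph thereby gets twin-width 0.
\<close>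

definition partition_sequence :: "'a pair_pre_digraph \<Rightarrow> 'a set set list \<Rightarrow> bool" where
  "partition_sequence G Ps \<longleftrightarrow> Ps \<noteq> []
     \<and> hd Ps = (\<lambda>v. {v}) ` pverts G
     \<and> (\<forall>i. Suc i < length Ps \<longrightarrow> merges_to (Ps ! i) (Ps ! Suc i))
     \<and> card (last Ps) \<le> 1"

definition sequence_width :: "'a pair_pre_digraph \<Rightarrow> 'a set set list \<Rightarrow> nat" where
  "sequence_width G Ps = Max (max_red_degree G ` set Ps)"

definition twin_width :: "'a pair_pre_digraph \<Rightarrow> nat" where
  "twin_width G = (LEAST k. \<exists>Ps. partition_sequence G Ps \<and> sequence_width G Ps = k)"

section \<open>Half-graphs\<close>

text \<open>\<open>Inl i\<close> is the vertex \<open>v\<^sub>i\<close> and \<open>Inr j\<close> the vertex \<open>w\<^sub>j\<close>.\<close>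

definition half_graph :: "nat \<Rightarrow> (nat + nat) pair_pre_digraph" where
  "half_graph t =
     (let E = {(Inl i, Inr j) | i j. i \<in> {1..t} \<and> j \<in> {1..t} \<and> i \<le> j}
      in \<lparr> pverts = Inl ` {1..t} \<union> Inr ` {1..t}, parcs = E \<union> E\<inverse> \<rparr>)"

definition semi_induced_half_graph :: "nat \<Rightarrow> 'a pair_pre_digraph \<Rightarrow> bool" where
  "semi_induced_half_graph t G \<longleftrightarrow>
     (\<exists>\<iota>. inj_on \<iota> (pverts (half_graph t)) \<and> \<iota> ` pverts (half_graph t) \<subseteq> pverts G
        \<and> (\<forall>i\<in>{1..t}. \<forall>j\<in>{1..t}. (\<iota> (Inl i), \<iota> (Inr j)) \<in> parcs G \<longleftrightarrow> i \<le> j))"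

section \<open>Rank-width\<close>

global_interpretation bit_fun: vector_space "\<lambda>(c::bit) (f::'a \<Rightarrow> bit) x. c * f x"
  by unfold_locales (auto simp: fun_eq_iff algebra_simps simp del: add_bit_eq_xor mult_bit_eq_and)

text \<open>
  The \<open>A \<times> B\<close> biadjacency matrix is given by its rows, extended by 0 outside \<open>B\<close>; its rank is the
  dimension of the row space.
\<close>

definition biadjacency_row :: "'a pair_pre_digraph \<Rightarrow> 'a set \<Rightarrow> 'a \<Rightarrow> ('a \<Rightarrow> bit)" where
  "biadjacency_row G B u = (\<lambda>v. if v \<in> B \<and> (u, v) \<in> parcs G then 1 else 0)"

definition cut_rank :: "'a pair_pre_digraph \<Rightarrow> 'a set \<Rightarrow> 'a set \<Rightarrow> nat" where
  "cut_rank G A B = bit_fun.dim (biadjacency_row G B ` A)"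

text \<open>
  The predicate \<^const>\<open>tree\<close> of the library concerns oriented trees: in a symmetric digraph every edge
  is a directed cycle of length 2.  Undirected cycles are the directed ones of length at least 3.
\<close>

definition undirected_tree :: "'b pair_pre_digraph \<Rightarrow> bool" where
  "undirected_tree T \<longleftrightarrow> pair_graph T \<and> connected (with_proj T)
     \<and> \<not> (\<exists>p. pre_digraph.cycle (with_proj T) p \<and> 3 \<le> length p)"

text \<open>Degree 0 is allowed so that the one-vertex tree decomposes the one-vertex graph.\<close>

definition leaves :: "'b pair_pre_digraph \<Rightarrow> 'b set" where
  "leaves T = {x \<in> pverts T. out_degree (with_proj T) x \<le> 1}"

definition rank_decomposition ::
    "'a pair_pre_digraph \<Rightarrow> nat pair_pre_digraph \<Rightarrow> ('a \<Rightarrow> nat) \<Rightarrow> bool" where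
  "rank_decomposition G T L \<longleftrightarrow> undirected_tree T
     \<and> (\<forall>x\<in>pverts T. out_degree (with_proj T) x \<le> 3)
     \<and> bij_betw L (pverts G) (leaves T)"

definition delete_edge :: "'b pair_pre_digraph \<Rightarrow> 'b \<Rightarrow> 'b \<Rightarrow> 'b pair_pre_digraph" where
  "delete_edge T x y = \<lparr> pverts = pverts T, parcs = parcs T - {(x, y), (y, x)} \<rparr>"

text \<open>
  The vertices of \<open>G\<close> whose leaf lies on the side of \<open>x\<close> after removal of the tree edge \<open>xy\<close>; the
  other side of the bipartition is obtained by exchanging \<open>x\<close> and \<open>y\<close>.
\<close>

definition edge_side ::
    "'a pair_pre_digraph \<Rightarrow> nat pair_pre_digraph \<Rightarrow> ('a \<Rightarrow> nat) \<Rightarrow> nat \<Rightarrow> nat \<Rightarrow> 'a set" where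
  "edge_side G T L x y =
     {v \<in> pverts G. x \<rightarrow>\<^sup>*\<^bsub>with_proj (delete_edge T x y)\<^esub> L v}"

definition decomposition_width ::
    "'a pair_pre_digraph \<Rightarrow> nat pair_pre_digraph \<Rightarrow> ('a \<Rightarrow> nat) \<Rightarrow> nat" where
  "decomposition_width G T L =
     Max (insert 0 ((\<lambda>(x, y). cut_rank G (edge_side G T L x y) (edge_side G T L y x)) ` parcs T))"

text \<open>The empty graph has no rank-decomposition (a tree has a leaf); its rank-width is 0.\<close>

definition rank_width :: "'a pair_pre_digraph \<Rightarrow> nat" where
  "rank_width G = (if pverts G = {} then 0
     else LEAST k. \<exists>T L. rank_decomposition G T L \<and> decomposition_width G T L = k)"

section \<open>First-order transductions and monadic stability\<close>

text \<open>
  First-order formulas over vertex-coloured graphs. Variables and colours are numbered; a formula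
  mentions only finitely many colours, so the set of all colours need not be bounded.
\<close>

datatype fo =
    FoEq nat nat
  | FoAdj nat nat
  | FoCol nat nat
  | FoNeg fo
  | FoConj fo fo
  | FoEx nat fo

primrec fo_sat :: "'a pair_pre_digraph \<Rightarrow> (nat \<Rightarrow> 'a set) \<Rightarrow> (nat \<Rightarrow> 'a) \<Rightarrow> fo \<Rightarrow> bool" where
  "fo_sat G C s (FoEq x y) \<longleftrightarrow> s x = s y"
| "fo_sat G C s (FoAdj x y) \<longleftrightarrow> (s x, s y) \<in> parcs G"
| "fo_sat G C s (FoCol c x) \<longleftrightarrow> s x \<in> C c"
| "fo_sat G C s (FoNeg \<phi>) \<longleftrightarrow> \<not> fo_sat G C s \<phi>"
| "fo_sat G C s (FoConj \<phi> \<psi>) \<longleftrightarrow> fo_sat G C s \<phi> \<and> fo_sat G C s \<psi>"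
| "fo_sat G C s (FoEx x \<phi>) \<longleftrightarrow> (\<exists>v\<in>pverts G. fo_sat G C (s(x := v)) \<phi>)"

primrec fo_fv :: "fo \<Rightarrow> nat set" where
  "fo_fv (FoEq x y) = {x, y}"
| "fo_fv (FoAdj x y) = {x, y}"
| "fo_fv (FoCol c x) = {x}"
| "fo_fv (FoNeg \<phi>) = fo_fv \<phi>"
| "fo_fv (FoConj \<phi> \<psi>) = fo_fv \<phi> \<union> fo_fv \<psi>"
| "fo_fv (FoEx x \<phi>) = fo_fv \<phi> - {x}"

text \<open>
  The graph interpreted in \<open>G\<close> with colouring \<open>C\<close>: its vertices are those satisfying \<open>\<nu>(x\<^sub>0)\<close>, and
  distinct \<open>u\<close>, \<open>v\<close> are adjacent if \<open>\<phi>(x\<^sub>0,x\<^sub>1)\<close> holds of \<open>(u,v)\<close> or of \<open>(v,u)\<close>. Only the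
  values of an assignment at the free variables matter.
\<close>

definition fo_interpret ::
    "fo \<Rightarrow> fo \<Rightarrow> 'a pair_pre_digraph \<Rightarrow> (nat \<Rightarrow> 'a set) \<Rightarrow> 'a pair_pre_digraph" where
  "fo_interpret \<nu> \<phi> G C =
     (let V = {v \<in> pverts G. fo_sat G C (\<lambda>_. v) \<nu>};
          E = {(u, v). u \<in> V \<and> v \<in> V \<and> u \<noteq> v \<and> fo_sat G C ((\<lambda>_. u)(1 := v)) \<phi>}
      in \<lparr> pverts = V, parcs = E \<union> E\<inverse> \<rparr>)"

text \<open>
  A class transduces another one if fixed formulas produce (up to isomorphism) every graph of the
  latter from some vertex-colouring of some graph of the former. Colours may overlap, and since
  \<open>\<nu>\<close> may mention a colour, passing to an arbitrary induced subgraph is included. Transductions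
  are non-copying; allowing copies of the vertex set as well could only shrink the family of
  monadically stable classes (it is known not to change it).
\<close>

definition fo_transduces :: "'a pair_pre_digraph set \<Rightarrow> 'b pair_pre_digraph set \<Rightarrow> bool" where
  "fo_transduces \<C> \<D> \<longleftrightarrow> (\<exists>\<nu> \<phi>. fo_fv \<nu> \<subseteq> {0} \<and> fo_fv \<phi> \<subseteq> {0, 1}
     \<and> (\<forall>H\<in>\<D>. \<exists>G\<in>\<C>. \<exists>C. digraph_iso (with_proj (fo_interpret \<nu> \<phi> G C)) (with_proj H)))"

definition monadically_stable :: "'a pair_pre_digraph set \<Rightarrow> bool" where
  "monadically_stable \<C> \<longleftrightarrow> \<not> fo_transduces \<C> (range half_graph)"

end

theory Submission
  imports Defs
begin

text \<open>
  Follow a partition sequence of width 2 backwards in time. The red graph always consists of paths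
  and cycles, and along an edge whose two ends both have red degree 2 the parts can only lose
  vertices to parts that are homogeneous to the other end of the edge. The order of these losses
  on the two sides determines the adjacency between the ends; without large half-graphs it
  alternates a bounded number of times, so that cutting the red graph at such an edge gives a cut
  of bounded rank. A set of vertices that consists of boundedly many parts and is bounded by two
  such cuts has bounded cut-rank; going one step back in time it gains boundedly many parts and can
  be split again into smaller such sets, since every red path or cycle on at least four parts can
  be cut. The hierarchy of these splittings is a rank-decomposition.
  Ranks are bounded by numbers of distinct rows throughout.
\<close>

section \<open>Numbers of distinct rows\<close>

text \<open>The obstacle is that a cut through a red edge must still be usable at every earlier
  time, when its ends have come apart. So \<open>cut\<close> is built from the past: on the parts
  one step back it induces either a cut of the one red edge left below, or a separation that no red
  edge below crosses. A vertex set \<open>W\<close> bounded by cuts is thus fixed for good, and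
  going back in time changes only the set \<open>N\<close> of parts that describes it. Red degree 2
  at both ends matters because two red edges below, together with the further red neighbour of an
  end, would make degree 3. The numbers: splitting works down to 3 parts. One step back these become
  at most 6, since the outer ends of 2 cuts may contribute and one merge is undone. The argument
  gives \<open>16 * t + 42\<close>, which is below the stated bound; 16 comes from 2 cuts, times 4
  possible traces on vertices of the same parts that belong to other sets, times the 2 in the bound
  \<open>2 * t + 2\<close> for a layered pair.\<close>

definition row :: "'a pair_pre_digraph \<Rightarrow> 'a set \<Rightarrow> 'a \<Rightarrow> 'a set" where
  "row G B u = {v \<in> B. (u, v) \<in> parcs G}"

definition row_count :: "'a pair_pre_digraph \<Rightarrow> 'a set \<Rightarrow> 'a set \<Rightarrow> nat" where
  "row_count G A B = card (row G B ` A)"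

lemma row_count_UN_le:
  assumes "finite I"
  shows "row_count G (\<Union>i\<in>I. A i) B \<le> (\<Sum>i\<in>I. row_count G (A i) B)"
  using card_UN_le[OF assms, of "\<lambda>i. row G B ` A i"] by (simp add: row_count_def image_UN)

lemma row_count_Un_le: "row_count G (A \<union> A') B \<le> row_count G A B + row_count G A' B"
  by (simp add: row_count_def image_Un card_Un_le)

lemma row_count_le_card: "finite A \<Longrightarrow> row_count G A B \<le> card A"
  by (simp add: row_count_def card_image_le)

lemma row_count_mono:
  assumes "finite A'" "A \<subseteq> A'" "B \<subseteq> B'"
  shows "row_count G A B \<le> row_count G A' B'"
proof -
  have "row G B ` A \<subseteq> (\<lambda>R. R \<inter> B) ` (row G B' ` A')"
    using assms by (fastforce simp: row_def image_iff)
  then show ?thesis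
    unfolding row_count_def using assms
    by (meson card_image_le card_mono finite_imageI order_trans)
qed

lemma row_count_columns_Un_le:
  assumes "finite A"
  shows "row_count G A (B \<union> C) \<le> row_count G A B * row_count G A C"
proof -
  have "row G (B \<union> C) ` A \<subseteq> (\<lambda>(x, y). x \<union> y) ` (row G B ` A \<times> row G C ` A)"
    by (fastforce simp: row_def image_iff)
  then have "card (row G (B \<union> C) ` A) \<le> card (row G B ` A \<times> row G C ` A)"
    using assms by (meson card_image_le card_mono finite_SigmaI finite_imageI order_trans)
  then show ?thesis
    by (simp add: row_count_def card_cartesian_product)
qed

lemma row_count_le_1:
  assumes "\<And>u u' v. u \<in> A \<Longrightarrow> u' \<in> A \<Longrightarrow> v \<in> B \<Longrightarrow> (u, v) \<in> parcs G \<Longrightarrow> (u', v) \<in> parcs G"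
  shows "row_count G A B \<le> 1"
proof -
  have eq: "row G B u = row G B u'" if "u \<in> A" "u' \<in> A" for u u'
    using assms that unfolding row_def by blast
  show ?thesis
  proof (cases "A = {}")
    case False
    then obtain a where a: "a \<in> A" by blast
    have "row G B ` A \<subseteq> {row G B a}"
      using eq[OF _ a] by (intro image_subsetI) simp
    then show ?thesis
      unfolding row_count_def using card_mono[of "{row G B a}"] by simp
  qed (simp add: row_count_def)
qed

lemma cut_rank_le_row_count:
  assumes "finite A"
  shows "cut_rank G A B \<le> row_count G A B"
proof -
  have eq: "biadjacency_row G B ` A = (\<lambda>R v. if v \<in> R then 1 else 0) ` (row G B ` A)"
    unfolding image_image by (intro image_cong refl) (auto simp: biadjacency_row_def row_def)
  have "cut_rank G A B \<le> card (biadjacency_row G B ` A)"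
    unfolding cut_rank_def using assms by (intro bit_fun.dim_le_card') auto
  also have "\<dots> \<le> card (row G B ` A)"
    unfolding eq using assms by (intro card_image_le) auto
  finally show ?thesis by (simp add: row_count_def)
qed

lemma sum_apply: "sum f S x = (\<Sum>i\<in>S. f i x)"
  by (induction S rule: infinite_finite_induct) auto

text \<open>Each column is constant on the classes of equal rows, hence a sum of their indicators.\<close>

lemma cut_rank_le_transposed_row_count:
  assumes "finite A" and sym: "sym (parcs G)"
  shows "cut_rank G B A \<le> row_count G A B"
proof -
  define ind :: "'a set \<Rightarrow> 'a \<Rightarrow> bit"
    where "ind R = (\<lambda>u. if u \<in> A \<and> row G B u = R then 1 else 0)" for R
  let ?R = "row G B ` A"
  have "biadjacency_row G A v = sum ind {R \<in> ?R. v \<in> R}" if "v \<in> B" for v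
  proof
    fix u
    have "sum ind {R \<in> ?R. v \<in> R} u = (\<Sum>R\<in>{R \<in> ?R. v \<in> R}. ind R u)"
      by (rule sum_apply)
    also have "\<dots> = (\<Sum>R\<in>{R \<in> ?R. v \<in> R}. if R = row G B u then (if u \<in> A then 1 else 0) else 0)"
      by (intro sum.cong) (auto simp: ind_def)
    also have "\<dots> = biadjacency_row G A v u"
    proof -
      have "(v, u) \<in> parcs G \<longleftrightarrow> (u, v) \<in> parcs G"
        using sym by (blast dest: symD)
      then have iff: "row G B u \<in> {R \<in> ?R. v \<in> R} \<and> u \<in> A \<longleftrightarrow> u \<in> A \<and> (v, u) \<in> parcs G"
        using that by (auto simp: row_def)
      have "finite {R \<in> ?R. v \<in> R}" using assms(1) by simp
      from sum.delta[OF this, of "row G B u" "\<lambda>_. if u \<in> A then 1 else 0 :: bit"] show ?thesis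
        using iff by (cases "u \<in> A \<and> (v, u) \<in> parcs G") (auto simp: biadjacency_row_def)
    qed
    finally show "biadjacency_row G A v u = sum ind {R \<in> ?R. v \<in> R} u" by simp
  qed
  moreover have "sum ind {R \<in> ?R. v \<in> R} \<in> bit_fun.span (ind ` ?R)" for v
    by (rule bit_fun.span_sum, rule bit_fun.span_base) blast
  ultimately have "biadjacency_row G A v \<in> bit_fun.span (ind ` ?R)" if "v \<in> B" for v
    using that by (simp only:)
  then have "biadjacency_row G A ` B \<subseteq> bit_fun.span (ind ` ?R)"
    by blast
  then have "cut_rank G B A \<le> card (ind ` ?R)"
    unfolding cut_rank_def using assms(1) by (intro bit_fun.dim_le_card) auto
  also have "\<dots> \<le> card ?R"
    using assms(1) by (intro card_image_le) auto
  finally show ?thesis by (simp add: row_count_def)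
qed

section \<open>Layered pairs and half-graphs\<close>

definition homogeneous :: "'a pair_pre_digraph \<Rightarrow> 'a set \<Rightarrow> 'a set \<Rightarrow> bool" where
  "homogeneous G X Y \<longleftrightarrow> (\<forall>x\<in>X. \<forall>y\<in>Y. (x, y) \<in> parcs G) \<or> (\<forall>x\<in>X. \<forall>y\<in>Y. (x, y) \<notin> parcs G)"

lemma homogeneous_mono: "homogeneous G X Y \<Longrightarrow> X' \<subseteq> X \<Longrightarrow> Y' \<subseteq> Y \<Longrightarrow> homogeneous G X' Y'"
  unfolding homogeneous_def by (meson subsetD)

lemma homogeneous_sym:
  assumes "sym (parcs G)" "homogeneous G X Y"
  shows "homogeneous G Y X"
proof -
  have "(y, x) \<in> parcs G \<Longrightarrow> (x, y) \<in> parcs G" for x y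
    using assms(1) by (auto elim: symE)
  with assms(2) show ?thesis unfolding homogeneous_def by meson
qed

lemma homogeneousE:
  assumes "homogeneous G X Y"
  obtains c where "\<forall>x\<in>X. \<forall>y\<in>Y. (x, y) \<in> parcs G \<longleftrightarrow> c"
  using assms that[of True] that[of False] unfolding homogeneous_def by metis

text \<open>The adjacency of two vertices is determined by the later of the steps that added them,
  so only alternations between the steps can create many distinct rows. In
  \<open>cut_layered\<close> the steps are the merges, forwards in time.\<close>

inductive layered :: "'a pair_pre_digraph \<Rightarrow> 'a set \<Rightarrow> 'a set \<Rightarrow> bool" for G where
  empty: "layered G {} {}"
| left: "layered G A B \<Longrightarrow> homogeneous G X B \<Longrightarrow> layered G (A \<union> X) B"
| right: "layered G A B \<Longrightarrow> homogeneous G A Y \<Longrightarrow> layered G A (B \<union> Y)"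

lemma layered_sym:
  assumes "sym (parcs G)"
  shows "layered G A B \<Longrightarrow> layered G B A"
proof (induction rule: layered.induct)
  case (left A B X)
  then show ?case using layered.right homogeneous_sym[OF assms] by metis
next
  case (right A B Y)
  then show ?case using layered.left homogeneous_sym[OF assms] by metis
qed (rule layered.empty)

lemma layered_empty_left: "layered G {} B"
  using layered.right[OF layered.empty, of G B] by (simp add: homogeneous_def)

lemma layered_homogeneous: "homogeneous G A B \<Longrightarrow> layered G A B"
  using layered.left[OF layered_empty_left] by fastforce

text \<open>With \<open>c = False\<close> this is a half-graph in the bipartite complement. Both
  values are needed because the homogeneous sets of a layered pair may be joined completely or not
  at all.\<close>

definition ladder :: "'a pair_pre_digraph \<Rightarrow> bool \<Rightarrow> nat \<Rightarrow> 'a set \<Rightarrow> 'a set \<Rightarrow> (nat \<Rightarrow> 'a) \<Rightarrow> (nat \<Rightarrow> 'a) \<Rightarrow> bool" where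
  "ladder G c k A B a b \<longleftrightarrow> a ` {1..k} \<subseteq> A \<and> b ` {1..k} \<subseteq> B
     \<and> (\<forall>i\<in>{1..k}. \<forall>j\<in>{1..k}. ((a i, b j) \<in> parcs G \<longleftrightarrow> c) \<longleftrightarrow> i \<le> j)"

text \<open>The row of \<open>x\<close> is an unfinished rung: the next column that is constantly
  \<open>c\<close> completes it, see \<open>ladder_extend\<close>.\<close>

definition extensible :: "'a pair_pre_digraph \<Rightarrow> bool \<Rightarrow> 'a set \<Rightarrow> 'a set \<Rightarrow> bool" where
  "extensible G c A B \<longleftrightarrow> (\<exists>x\<in>A. \<forall>y\<in>B. (x, y) \<in> parcs G \<longleftrightarrow> \<not> c)"

lemma ladder_mono: "ladder G c k A B a b \<Longrightarrow> A \<subseteq> A' \<Longrightarrow> B \<subseteq> B' \<Longrightarrow> ladder G c k A' B' a b"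
  unfolding ladder_def by blast

text \<open>The new row has the value \<open>\<not> c\<close> at all old columns, whose indices are
  smaller than \<open>Suc k\<close>, and the new column has the value \<open>c\<close> at all rows,
  including the new one.\<close>

lemma ladder_extend:
  assumes "ladder G c k A B a b" "x \<in> A" "\<forall>y\<in>B. (x, y) \<in> parcs G \<longleftrightarrow> \<not> c"
    and "y \<in> Y" "\<forall>x\<in>A. (x, y) \<in> parcs G \<longleftrightarrow> c"
  shows "ladder G c (Suc k) A (B \<union> Y) (a(Suc k := x)) (b(Suc k := y))"
  using assms unfolding ladder_def atLeastAtMostSuc_conv[of 1 k, simplified] image_subset_iff
  by (auto simp: image_subset_iff)

text \<open>
  A new row value can only arise when no row is constantly \<open>\<not> c\<close>, and only a set of columns
  constantly \<open>c\<close> can destroy such a row again; each such alternation lengthens a ladder.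
\<close>

lemma layered_row_count_ladder:
  assumes "layered G A B"
  shows "finite (row G B ` A) \<and> (\<exists>m. row_count G A B \<le> m False + m True \<and>
    (\<forall>c. \<exists>k a b. ladder G c k A B a b \<and> m c \<le> k + of_bool (extensible G c A B)))"
  using assms
proof (induction rule: layered.induct)
  case empty
  show ?case
    by (auto simp: row_count_def ladder_def intro!: exI[of _ "\<lambda>_. 0"])
next
  case (left A B X)
  from left.IH obtain m where fin: "finite (row G B ` A)"
    and rc: "row_count G A B \<le> m False + m True"
    and lad: "\<And>c. \<exists>k a b. ladder G c k A B a b \<and> m c \<le> k + of_bool (extensible G c A B)"
    by blast
  obtain d where d: "\<forall>x\<in>X. \<forall>y\<in>B. (x, y) \<in> parcs G \<longleftrightarrow> d"
    using left.hyps(2) by (rule homogeneousE)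
  let ?r = "if d then B else {}"
  have X: "row G B ` X \<subseteq> {?r}"
    using d by (auto simp: row_def)
  then have fin': "finite (row G B ` (A \<union> X))"
    using fin by (auto simp: image_Un intro: finite_subset)
  have mono: "extensible G c A B \<Longrightarrow> extensible G c (A \<union> X) B" for c
    unfolding extensible_def by blast
  show ?case
  proof (cases "X = {} \<or> extensible G (\<not> d) A B")
    case True
    then have "row G B ` X \<subseteq> row G B ` A"
    proof
      assume "extensible G (\<not> d) A B"
      then obtain x where "x \<in> A" "row G B x = ?r"
        unfolding extensible_def row_def by (cases d) auto
      then show ?thesis using X by (auto simp: image_iff)
    qed auto
    then have "row G B ` (A \<union> X) = row G B ` A" by auto
    moreover have "\<exists>k a b. ladder G c k (A \<union> X) B a b \<and> m c \<le> k + of_bool (extensible G c (A \<union> X) B)" for c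
    proof -
      obtain k a b where k: "ladder G c k A B a b" "m c \<le> k + of_bool (extensible G c A B)"
        using lad by blast
      then have "m c \<le> k + of_bool (extensible G c (A \<union> X) B)"
        using mono[of c] by (auto split: if_splits simp: of_bool_def)
      then show ?thesis using ladder_mono[OF k(1), of "A \<union> X" B] by blast
    qed
    ultimately show ?thesis
      using fin' rc by (intro conjI exI[of _ m] allI) (simp_all add: row_count_def)
  next
    case False
    then obtain x where x: "x \<in> X" and nx: "\<not> extensible G (\<not> d) A B" by blast
    \<comment> \<open>A row constantly \<open>d\<close> is new only if there is no unfinished rung
      of colour \<open>\<not> d\<close>, and it then becomes one; this pays for raising the counter
      of that colour.\<close>
    define m' where "m' = m((\<not> d) := Suc (m (\<not> d)))"
    have ext: "extensible G (\<not> d) (A \<union> X) B"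
      unfolding extensible_def using x d by auto
    have "row_count G (A \<union> X) B \<le> row_count G A B + card (row G B ` X)"
      unfolding row_count_def image_Un by (rule card_Un_le)
    moreover have "card (row G B ` X) \<le> 1"
      using card_mono[OF _ X] by auto
    ultimately have "row_count G (A \<union> X) B \<le> m' False + m' True"
      using rc by (cases d) (auto simp: m'_def)
    moreover have "\<exists>k a b. ladder G c k (A \<union> X) B a b \<and> m' c \<le> k + of_bool (extensible G c (A \<union> X) B)" for c
    proof -
      obtain k a b where k: "ladder G c k A B a b" "m c \<le> k + of_bool (extensible G c A B)"
        using lad by blast
      have "m' c \<le> k + of_bool (extensible G c (A \<union> X) B)"
      proof (cases "c = (\<not> d)")
        case True
        then show ?thesis using k ext nx by (auto simp: m'_def)
      next
        case False
        then show ?thesis using k mono[of c] by (auto simp: m'_def of_bool_def split: if_splits)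
      qed
      then show ?thesis using ladder_mono[OF k(1), of "A \<union> X" B] by blast
    qed
    ultimately show ?thesis using fin' by blast
  qed
next
  case (right A B Y)
  from right.IH obtain m where fin: "finite (row G B ` A)"
    and rc: "row_count G A B \<le> m False + m True"
    and lad: "\<And>c. \<exists>k a b. ladder G c k A B a b \<and> m c \<le> k + of_bool (extensible G c A B)"
    by blast
  obtain d where d: "\<forall>x\<in>A. \<forall>y\<in>Y. (x, y) \<in> parcs G \<longleftrightarrow> d"
    using right.hyps(2) by (rule homogeneousE)
  have rows: "row G (B \<union> Y) ` A = (\<lambda>R. R \<union> (if d then Y else {})) ` (row G B ` A)"
    unfolding image_image using d by (intro image_cong refl) (auto simp: row_def)
  have "row_count G A (B \<union> Y) \<le> m False + m True"
    unfolding row_count_def rows using card_image_le[OF fin] rc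
    by (metis (no_types, lifting) order_trans row_count_def)
  moreover have "\<exists>k a b. ladder G c k A (B \<union> Y) a b \<and> m c \<le> k + of_bool (extensible G c A (B \<union> Y))" for c
  proof -
    obtain k a b where k: "ladder G c k A B a b" "m c \<le> k + of_bool (extensible G c A B)"
      using lad by blast
    note k' = ladder_mono[OF k(1) order_refl, of "B \<union> Y"]
    show ?thesis
    proof (cases "extensible G c A B")
      case False
      then show ?thesis using k k' by fastforce
    next
      case True
      then obtain x where x: "x \<in> A" "\<forall>y\<in>B. (x, y) \<in> parcs G \<longleftrightarrow> \<not> c"
        unfolding extensible_def by blast
      show ?thesis
      proof (cases "\<exists>y. y \<in> Y \<and> c = d")
        case True
        then obtain y where y: "y \<in> Y" "\<forall>x\<in>A. (x, y) \<in> parcs G \<longleftrightarrow> c" using d by blast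
        from ladder_extend[OF k(1) x y] show ?thesis
          using k(2) by (auto simp: of_bool_def split: if_splits intro!: exI[of _ "Suc k"])
      next
        case False
        then have "extensible G c A (B \<union> Y)"
          unfolding extensible_def using x d by (intro bexI[of _ x]) auto
        then show ?thesis using k k' by (auto simp: True)
      qed
    qed
  qed
  moreover have "finite (row G (B \<union> Y) ` A)"
    unfolding rows using fin by (rule finite_imageI)
  ultimately show ?case by blast
qed

text \<open>For \<open>c = False\<close> the edges are the pairs whose row index exceeds the column
  index. With the sides exchanged and the rows shifted by one the condition becomes
  \<open>i \<le> j\<close>; the shift uses up the extra rung. Different indices on one side are told
  apart by their adjacencies, which gives injectivity.\<close>

lemma ladder_semi_induced_half_graph:
  assumes lad: "ladder G c (Suc t) A B a b" and sym: "sym (parcs G)"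
    and sub: "A \<subseteq> pverts G" "B \<subseteq> pverts G" "A \<inter> B = {}"
  shows "semi_induced_half_graph t G"
proof -
  have pv: "pverts (half_graph t) = Inl ` {1..t} \<union> Inr ` {1..t}"
    by (simp add: half_graph_def Let_def)
  have aA: "a i \<in> A" "b i \<in> B" if "1 \<le> i" "i \<le> Suc t" for i
    using lad that unfolding ladder_def by auto
  have ab: "((a i, b j) \<in> parcs G \<longleftrightarrow> c) \<longleftrightarrow> i \<le> j"
    if "1 \<le> i" "i \<le> Suc t" "1 \<le> j" "j \<le> Suc t" for i j
    using lad that unfolding ladder_def by auto
  have ainj: "a i \<noteq> a j" if "1 \<le> i" "i < j" "j \<le> Suc t" for i j
    using ab[of i i] ab[of j i] that by auto
  have binj: "b i \<noteq> b j" if "1 \<le> i" "i < j" "j \<le> Suc t" for i j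
    using ab[of j j] ab[of j i] that by auto
  have ab_neq: "a i \<noteq> b j" if "1 \<le> i" "i \<le> Suc t" "1 \<le> j" "j \<le> Suc t" for i j
    using aA(1)[of i] aA(2)[of j] that sub(3) by auto
  have inj_on_sum: "inj_on (case_sum f g) (Inl ` {1..t} \<union> Inr ` {1..t})"
    if f: "\<And>i j. 1 \<le> i \<Longrightarrow> i < j \<Longrightarrow> j \<le> t \<Longrightarrow> f i \<noteq> f j"
      and g: "\<And>i j. 1 \<le> i \<Longrightarrow> i < j \<Longrightarrow> j \<le> t \<Longrightarrow> g i \<noteq> g j"
      and fg: "\<And>i j. 1 \<le> i \<Longrightarrow> i \<le> t \<Longrightarrow> 1 \<le> j \<Longrightarrow> j \<le> t \<Longrightarrow> f i \<noteq> g j"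
    for f g :: "nat \<Rightarrow> 'a"
  proof -
    have fi: "inj_on f {1..t}"
      using f by (intro linorder_inj_onI) auto
    have gi: "inj_on g {1..t}"
      using g by (intro linorder_inj_onI) auto
    show ?thesis
    proof (rule inj_onI)
      fix x y
      assume "x \<in> Inl ` {1..t} \<union> Inr ` {1..t}" "y \<in> Inl ` {1..t} \<union> Inr ` {1..t}"
        and "case_sum f g x = case_sum f g y"
      then show "x = y"
        by (elim UnE imageE) (auto dest: inj_onD[OF fi] inj_onD[OF gi] simp: fg fg[THEN not_sym])
    qed
  qed
  show ?thesis
  proof (cases c)
    case True
    define \<iota> where "\<iota> = case_sum a b"
    have "inj_on \<iota> (pverts (half_graph t))"
      unfolding pv \<iota>_def by (rule inj_on_sum) (use ainj binj ab_neq in auto)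
    moreover have "\<iota> ` pverts (half_graph t) \<subseteq> pverts G"
      unfolding pv \<iota>_def using aA sub by auto
    moreover have "\<forall>i\<in>{1..t}. \<forall>j\<in>{1..t}. (\<iota> (Inl i), \<iota> (Inr j)) \<in> parcs G \<longleftrightarrow> i \<le> j"
      unfolding \<iota>_def using ab True by auto
    ultimately show ?thesis unfolding semi_induced_half_graph_def by blast
  next
    case False
    define \<iota> where "\<iota> = case_sum b (\<lambda>j. a (Suc j))"
    have "inj_on \<iota> (pverts (half_graph t))"
      unfolding pv \<iota>_def by (rule inj_on_sum) (use ainj binj ab_neq[symmetric] in auto)
    moreover have "\<iota> ` pverts (half_graph t) \<subseteq> pverts G"
      unfolding pv \<iota>_def using aA sub by auto
    moreover have "(b i, a (Suc j)) \<in> parcs G \<longleftrightarrow> i \<le> j" if "i \<in> {1..t}" "j \<in> {1..t}" for i j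
      using ab[of "Suc j" i] that False sym by (auto dest: symD)
    then have "\<forall>i\<in>{1..t}. \<forall>j\<in>{1..t}. (\<iota> (Inl i), \<iota> (Inr j)) \<in> parcs G \<longleftrightarrow> i \<le> j"
      unfolding \<iota>_def by auto
    ultimately show ?thesis unfolding semi_induced_half_graph_def by blast
  qed
qed

text \<open>Each of the two counters in \<open>layered_row_count_ladder\<close> is at most
  \<open>t + 1\<close>: a ladder of length at most \<open>t\<close> and one unfinished rung.\<close>

lemma layered_row_count_le:
  assumes lay: "layered G A B" and sym: "sym (parcs G)"
    and sub: "A \<subseteq> pverts G" "B \<subseteq> pverts G" "A \<inter> B = {}"
    and free: "\<not> semi_induced_half_graph t G"
  shows "row_count G A B \<le> 2 * t + 2"
proof -
  obtain m where rc: "row_count G A B \<le> m False + m True"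
    and lad: "\<And>c. \<exists>k a b. ladder G c k A B a b \<and> m c \<le> k + of_bool (extensible G c A B)"
    using layered_row_count_ladder[OF lay] by blast
  have "m c \<le> t + 1" for c
  proof -
    obtain k a b where k: "ladder G c k A B a b" "m c \<le> k + of_bool (extensible G c A B)"
      using lad by blast
    have "k \<le> t"
    proof (rule ccontr)
      assume "\<not> k \<le> t"
      then have "ladder G c (Suc t) A B a b"
        using k(1) unfolding ladder_def by (auto simp: image_subset_iff)
      then show False using ladder_semi_induced_half_graph[OF _ sym sub] free by blast
    qed
    then show ?thesis using k(2) by (auto simp: of_bool_def split: if_splits)
  qed
  from this[of False] this[of True] rc show ?thesis by simp
qed

section \<open>Hierarchical splittings of the vertex set\<close>

text \<open>The hierarchy is built bottom-up without naming its nodes; trees enter only with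
  \<open>binary_family\<close>. Bounding the sets that occur suffices, because each edge of the
  final tree separates one of them from the rest.\<close>

inductive decomposable :: "'a pair_pre_digraph \<Rightarrow> nat \<Rightarrow> 'a set \<Rightarrow> bool" for G k where
  leaf: "v \<in> pverts G \<Longrightarrow> row_count G {v} (pverts G - {v}) \<le> k \<Longrightarrow> decomposable G k {v}"
| join: "decomposable G k A \<Longrightarrow> decomposable G k B \<Longrightarrow> A \<inter> B = {}
    \<Longrightarrow> row_count G (A \<union> B) (pverts G - (A \<union> B)) \<le> k \<Longrightarrow> decomposable G k (A \<union> B)"

text \<open>With at most \<open>k\<close> vertices any hierarchy will do; the vertices are added one
  by one.\<close>

lemma decomposable_if_small:
  assumes "W \<subseteq> pverts G" "finite W" "W \<noteq> {}" "card W \<le> k"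
  shows "decomposable G k W"
  using assms(2,3,1,4)
proof (induction W rule: finite_ne_induct)
  case (singleton v)
  have "row_count G {v} (pverts G - {v}) \<le> card {v}" by (rule row_count_le_card) simp
  then show ?case using singleton by (intro decomposable.leaf) auto
next
  case (insert v W)
  have "card {v} \<le> k" using insert by simp
  moreover have "row_count G {v} (pverts G - {v}) \<le> card {v}" by (rule row_count_le_card) simp
  ultimately have "decomposable G k {v}" using insert by (intro decomposable.leaf) auto
  moreover have "decomposable G k W" using insert by simp
  moreover have "row_count G ({v} \<union> W) (pverts G - ({v} \<union> W)) \<le> card ({v} \<union> W)"
    using insert.hyps(1) by (intro row_count_le_card) simp
  ultimately have "decomposable G k ({v} \<union> W)"
    using insert by (intro decomposable.join) auto
  then show ?case by simp
qed

section \<open>Red edges in a partition sequence of width 2\<close>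

lemma red_edge_sym:
  assumes "sym (parcs G)" "red_edge G X Y"
  shows "red_edge G Y X"
proof -
  have "(y, x) \<in> parcs G \<Longrightarrow> (x, y) \<in> parcs G" for x y
    using assms(1) by (auto elim: symE)
  then show ?thesis
    using assms(2) unfolding red_edge_def by meson
qed

lemma merges_to_partition_on:
  assumes "partition_on V P" "merges_to P Q"
  shows "partition_on V Q"
proof -
  obtain X Y where XY: "X \<in> P" "Y \<in> P" "X \<noteq> Y" and Q: "Q = insert (X \<union> Y) (P - {X, Y})"
    using assms(2) unfolding merges_to_def by blast
  have disj: "\<And>p q. p \<in> P \<Longrightarrow> q \<in> P \<Longrightarrow> p \<noteq> q \<Longrightarrow> p \<inter> q = {}"
    using assms(1) unfolding partition_on_def disjoint_def by blast
  show ?thesis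
  proof (rule partition_onI)
    show "\<Union> Q = V"
      using assms(1) XY unfolding Q partition_on_def by blast
    show "{} \<notin> Q"
      using assms(1) XY unfolding Q partition_on_def by blast
    show "disjnt p q" if "p \<in> Q" "q \<in> Q" "p \<noteq> q" for p q
      using that disj XY unfolding Q disjnt_def by blast
  qed
qed

text \<open>Time is unbounded: a finite sequence is continued by repeating its last partition, which
  \<open>step\<close> permits. That a single part is reached enters in
  \<open>decomposable_verts\<close>.\<close>

locale width_two_sequence =
  fixes G :: "'a pair_pre_digraph" and P :: "nat \<Rightarrow> 'a set set"
  assumes finite_verts: "finite (pverts G)"
    and sym_arcs: "sym (parcs G)"
    and singletons: "P 0 = (\<lambda>v. {v}) ` pverts G"
    and step: "P (Suc s) = P s \<or> merges_to (P s) (P (Suc s))"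
    and red_degree_le: "X \<in> P s \<Longrightarrow> red_degree G (P s) X \<le> 2"
begin

lemma partition: "partition_on (pverts G) (P s)"
proof (induction s)
  case 0
  show ?case
    unfolding singletons by (rule partition_onI) (auto simp: disjnt_def)
next
  case (Suc s)
  then show ?case using step[of s] merges_to_partition_on by metis
qed

lemma Union_parts: "\<Union> (P s) = pverts G"
  using partition by (simp add: partition_on_def)

lemma part_subset: "p \<in> P s \<Longrightarrow> p \<subseteq> pverts G"
  using Union_parts by blast

lemma part_nonempty: "p \<in> P s \<Longrightarrow> p \<noteq> {}"
  using partition[of s] by (auto simp: partition_on_def)

lemma finite_part: "p \<in> P s \<Longrightarrow> finite p"
  using part_subset finite_verts finite_subset by blast

lemma finite_parts: "finite (P s)"
  using Union_parts[of s] finite_verts by (metis finite_UnionD)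

lemma parts_eq: "p \<in> P s \<Longrightarrow> q \<in> P s \<Longrightarrow> v \<in> p \<Longrightarrow> v \<in> q \<Longrightarrow> p = q"
  using partition[of s] unfolding partition_on_def disjoint_def by blast

lemma parts_disjoint: "p \<in> P s \<Longrightarrow> q \<in> P s \<Longrightarrow> p \<noteq> q \<Longrightarrow> p \<inter> q = {}"
  using parts_eq by blast

lemma step_cases:
  obtains "P (Suc s) = P s"
  | X Y where "X \<in> P s" "Y \<in> P s" "X \<noteq> Y" "P (Suc s) = insert (X \<union> Y) (P s - {X, Y})"
  using step[of s] unfolding merges_to_def by blast

lemma ex_coarser_part: "p \<in> P s \<Longrightarrow> \<exists>q\<in>P (Suc s). p \<subseteq> q"
  by (rule step_cases[of s]) auto

lemma ex_finer_part:
  assumes "q \<in> P (Suc s)" "v \<in> q"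
  shows "\<exists>p\<in>P s. v \<in> p \<and> p \<subseteq> q"
  by (rule step_cases[of s]) (use assms in auto)

text \<open>A step creates one new part. Hence if one end of a red edge has just been merged, the
  other end is old, which keeps the analysis of a step one-sided.\<close>

lemma unchanged_or:
  assumes "p \<in> P (Suc s)" "q \<in> P (Suc s)" "p \<noteq> q"
  shows "p \<in> P s \<or> q \<in> P s"
  by (rule step_cases[of s]) (use assms in auto)

lemma unchanged_part: "q \<in> P s \<Longrightarrow> p \<in> P s \<Longrightarrow> p \<subseteq> q \<Longrightarrow> p = q"
  using parts_eq part_nonempty by blast

lemma two_finer_parts:
  assumes "q \<in> P (Suc s)" "p \<in> P s" "p \<subseteq> q"
  shows "q = p \<or> q - p \<in> P s"
proof (rule step_cases[of s])
  assume "P (Suc s) = P s"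
  then show ?thesis using assms unchanged_part by metis
next
  fix X Y assume XY: "X \<in> P s" "Y \<in> P s" "X \<noteq> Y" "P (Suc s) = insert (X \<union> Y) (P s - {X, Y})"
  show ?thesis
  proof (cases "q \<in> P s")
    case True
    then show ?thesis using assms unchanged_part by metis
  next
    case False
    then have q: "q = X \<union> Y" using XY assms by blast
    obtain v where "v \<in> p" using part_nonempty[OF assms(2)] by blast
    then have "p = X \<or> p = Y"
      using parts_eq[OF assms(2)] XY assms(3) unfolding q by blast
    moreover have "X \<inter> Y = {}" using parts_disjoint XY by blast
    ultimately show ?thesis using XY unfolding q by (metis Diff_cancel Diff_triv Un_Diff Un_empty_left Un_empty_right Int_commute)
  qed
qed

lemma card_finer_parts:
  assumes "N \<subseteq> P (Suc s)"
  shows "card {p \<in> P s. \<exists>q\<in>N. p \<subseteq> q} \<le> Suc (card N)"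
proof (rule step_cases[of s])
  have finN: "finite N" using assms finite_parts finite_subset by blast
  assume "P (Suc s) = P s"
  then have "{p \<in> P s. \<exists>q\<in>N. p \<subseteq> q} \<subseteq> N"
    using assms unchanged_part by blast
  then show ?thesis using card_mono[OF finN] by (meson le_SucI)
next
  have finN: "finite N" using assms finite_parts finite_subset by blast
  fix X Y assume XY: "X \<in> P s" "Y \<in> P s" "X \<noteq> Y" "P (Suc s) = insert (X \<union> Y) (P s - {X, Y})"
  let ?C = "{p \<in> P s. \<exists>q\<in>N. p \<subseteq> q}"
  show ?thesis
  proof (cases "X \<union> Y \<in> N")
    case False
    then have "N \<subseteq> P s" using assms unfolding XY(4) by auto
    then have "?C \<subseteq> N" using unchanged_part by blast
    then show ?thesis using card_mono[OF finN] by (meson le_SucI)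
  next
    case True
    have "?C \<subseteq> {X, Y} \<union> (N - {X \<union> Y})"
    proof
      fix p assume "p \<in> ?C"
      then obtain q where p: "p \<in> P s" "q \<in> N" "p \<subseteq> q" by blast
      show "p \<in> {X, Y} \<union> (N - {X \<union> Y})"
      proof (cases "q = X \<union> Y")
        case True
        obtain v where v: "v \<in> p" using part_nonempty[OF p(1)] by blast
        then have "v \<in> X \<or> v \<in> Y" using p(3) True by blast
        then show ?thesis using parts_eq[OF p(1) XY(1) v] parts_eq[OF p(1) XY(2) v] by blast
      next
        case False
        then have "q \<in> P s" using p assms unfolding XY(4) by auto
        then show ?thesis using p unchanged_part False by blast
      qed
    qed
    then have "card ?C \<le> card ({X, Y} \<union> (N - {X \<union> Y}))"
      using finN by (intro card_mono) auto
    also have "\<dots> \<le> card {X, Y} + card (N - {X \<union> Y})" by (rule card_Un_le)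
    also have "\<dots> = 2 + (card N - 1)" using XY(3) True finN by simp
    also have "\<dots> = Suc (card N)" using True finN card_gt_0_iff[of N] by (cases "card N") auto
    finally show ?thesis .
  qed
qed

definition red :: "nat \<Rightarrow> 'a set \<Rightarrow> 'a set \<Rightarrow> bool" where
  "red s X Y \<longleftrightarrow> X \<in> P s \<and> Y \<in> P s \<and> red_edge G X Y"

definition red_nbrs :: "nat \<Rightarrow> 'a set \<Rightarrow> 'a set set" where
  "red_nbrs s X = {Y. red s X Y}"

lemma red_parts: "red s X Y \<Longrightarrow> X \<in> P s \<and> Y \<in> P s \<and> X \<noteq> Y"
  unfolding red_def red_edge_def by blast

lemma red_sym: "red s X Y \<Longrightarrow> red s Y X"
  unfolding red_def using red_edge_sym[OF sym_arcs] by blast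

lemma finite_red_nbrs: "finite (red_nbrs s X)"
  unfolding red_nbrs_def red_def using finite_parts by auto

lemma card_red_nbrs_le: "card (red_nbrs s X) \<le> 2"
proof (cases "X \<in> P s")
  case True
  then have "red_nbrs s X = {Y \<in> P s. red_edge G X Y}"
    unfolding red_nbrs_def red_def by blast
  then show ?thesis using red_degree_le[OF True] unfolding red_degree_def by simp
next
  case False
  then show ?thesis unfolding red_nbrs_def red_def by simp
qed

lemma red_nbrs_subset_card:
  assumes "A \<subseteq> red_nbrs s X"
  shows "card A \<le> 2"
  using card_mono[OF finite_red_nbrs assms] card_red_nbrs_le le_trans by blast

lemma homogeneous_if_not_red:
  assumes "X \<in> P s" "Y \<in> P s" "X \<noteq> Y" "\<not> red s X Y"
  shows "homogeneous G X Y"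
  using assms unfolding red_def red_edge_def homogeneous_def by blast

lemma not_red_0: "\<not> red 0 X Y"
  unfolding red_def red_edge_def singletons by auto

lemma red_coarser:
  assumes "red s p' q'" "p' \<subseteq> p" "q' \<subseteq> q" "p \<in> P (Suc s)" "q \<in> P (Suc s)" "p \<noteq> q"
  shows "red (Suc s) p q"
  using assms unfolding red_def red_edge_def by blast

definition inner :: "nat \<Rightarrow> 'a set \<Rightarrow> 'a set \<Rightarrow> bool" where
  "inner s x y \<longleftrightarrow> red s x y \<and> card (red_nbrs s x) = 2 \<and> card (red_nbrs s y) = 2"

lemma inner_sym: "inner s x y \<Longrightarrow> inner s y x"
  unfolding inner_def using red_sym by blast

lemma inner_parts: "inner s x y \<Longrightarrow> x \<in> P s \<and> y \<in> P s \<and> x \<noteq> y"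
  unfolding inner_def using red_parts by blast

lemma inner_disjoint: "inner s x y \<Longrightarrow> x \<inter> y = {}"
  using inner_parts parts_disjoint by blast

lemma inner_red: "inner s x y \<Longrightarrow> red s x y"
  unfolding inner_def by blast

lemma inner_other_nbr:
  assumes "inner s x y"
  obtains z where "red_nbrs s y = {x, z}" "z \<noteq> x"
proof -
  have "x \<in> red_nbrs s y" using inner_red[OF assms] red_sym unfolding red_nbrs_def by blast
  moreover have "card (red_nbrs s y) = 2" using assms unfolding inner_def by simp
  then obtain a b where "red_nbrs s y = {a, b}" "a \<noteq> b"
    unfolding card_2_iff by auto
  ultimately show thesis using that[of a] that[of b] by auto
qed

text \<open>Two red edges below an inner edge \<open>xy\<close> would give an unchanged part red degree 3.\<close>

lemma red_below_inner_left:
  assumes "inner (Suc s) x y" "y \<in> P s" "x1 \<subseteq> x" "x2 \<subseteq> x" "red s x1 y" "red s x2 y"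
  shows "x1 = x2"
proof (rule ccontr)
  assume ne: "x1 \<noteq> x2"
  have parts: "x1 \<in> P s" "x2 \<in> P s" using assms red_parts by blast+
  have "x \<notin> P s" using ne parts assms unchanged_part by metis
  obtain z where z: "red_nbrs (Suc s) y = {x, z}" "z \<noteq> x"
    using inner_other_nbr[OF assms(1)] .
  then have redz: "red (Suc s) y z" unfolding red_nbrs_def by blast
  \<comment> \<open>The one part created by this step is \<open>x\<close>, so \<open>z\<close> and
    its red edge to \<open>y\<close> are old.\<close>
  then have "z \<in> P s"
    using unchanged_or[of z s x] \<open>x \<notin> P s\<close> z(2) inner_parts[OF assms(1)] red_parts by blast
  then have "red s y z" using redz assms(2) unfolding red_def by blast
  moreover have "z \<inter> x = {}"
    using parts_disjoint z(2) inner_parts[OF assms(1)] red_parts[OF redz] by blast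
  then have "z \<noteq> x1" "z \<noteq> x2" using assms(3,4) part_nonempty parts by blast+
  ultimately have "{x1, x2, z} \<subseteq> red_nbrs s y"
    using assms red_sym unfolding red_nbrs_def by blast
  then have "card {x1, x2, z} \<le> 2" by (rule red_nbrs_subset_card)
  then show False using ne \<open>z \<noteq> x1\<close> \<open>z \<noteq> x2\<close> by simp
qed

text \<open>One of \<open>x\<close> and \<open>y\<close> is old, so
  \<open>red_below_inner_left\<close> applies in one of the two orientations.\<close>

lemma red_below_inner:
  assumes "inner (Suc s) x y" "x1 \<subseteq> x" "x2 \<subseteq> x" "y1 \<subseteq> y" "y2 \<subseteq> y" "red s x1 y1" "red s x2 y2"
  shows "x1 = x2 \<and> y1 = y2"
proof (cases "y \<in> P s")
  case True
  then have "y1 = y" "y2 = y" using assms red_parts unchanged_part by metis+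
  then show ?thesis using red_below_inner_left[OF assms(1) True] assms by blast
next
  case False
  then have x: "x \<in> P s" using unchanged_or inner_parts[OF assms(1)] by blast
  then have "x1 = x" "x2 = x" using assms red_parts unchanged_part by metis+
  moreover have "red s y1 x" "red s y2 x"
    using red_sym[OF assms(6)] red_sym[OF assms(7)] unfolding \<open>x1 = x\<close> \<open>x2 = x\<close> by auto
  ultimately show ?thesis
    using red_below_inner_left[OF inner_sym[OF assms(1)] x assms(4,5)] by simp
qed

section \<open>Cuts through inner red edges\<close>

text \<open>
  The vertex set \<open>D\<close> is the side of \<open>y\<close> of a cut of \<open>x \<union> y\<close> through the inner edge \<open>xy\<close>. It is
  determined by the most recent time at which the red edge below \<open>xy\<close> was not inner: if it did not
  exist, the cut separates \<open>x\<close> and \<open>y\<close>; if its end \<open>x'\<close> below \<open>x\<close> had no other red neighbour,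
  the vertices of \<open>x'\<close> count to the side of \<open>y\<close> forever, and symmetrically for \<open>y'\<close>.
\<close>

inductive cut :: "nat \<Rightarrow> 'a set \<Rightarrow> 'a set \<Rightarrow> 'a set \<Rightarrow> bool" where
  fresh: "inner (Suc s) x y \<Longrightarrow> (\<And>x' y'. x' \<subseteq> x \<Longrightarrow> y' \<subseteq> y \<Longrightarrow> \<not> red s x' y') \<Longrightarrow> cut (Suc s) x y y"
| left_end: "inner (Suc s) x y \<Longrightarrow> x' \<subseteq> x \<Longrightarrow> y' \<subseteq> y \<Longrightarrow> red s x' y' \<Longrightarrow> red_nbrs s x' = {y'}
    \<Longrightarrow> cut (Suc s) x y (x' \<union> y)"
| right_end: "inner (Suc s) x y \<Longrightarrow> x' \<subseteq> x \<Longrightarrow> y' \<subseteq> y \<Longrightarrow> red s x' y' \<Longrightarrow> red_nbrs s y' = {x'}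
    \<Longrightarrow> cut (Suc s) x y (y - y')"
| continue: "inner (Suc s) x y \<Longrightarrow> x' \<subseteq> x \<Longrightarrow> y' \<subseteq> y \<Longrightarrow> cut s x' y' D
    \<Longrightarrow> cut (Suc s) x y (D \<union> (y - y'))"

lemma cut_inner: "cut s x y D \<Longrightarrow> inner s x y"
  by (auto elim: cut.cases)

lemma cut_subset: "cut s x y D \<Longrightarrow> D \<subseteq> x \<union> y"
  by (induction rule: cut.induct) auto

text \<open>Exchanging \<open>x\<close> and \<open>y\<close> swaps \<open>left_end\<close> with
  \<open>right_end\<close> and preserves \<open>fresh\<close> and \<open>continue\<close>. Facts
  about one side of a cut thereby yield those about the other.\<close>

lemma cut_sym: "cut s x y D \<Longrightarrow> cut s y x (x \<union> y - D)"
proof (induction rule: cut.induct)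
  case (fresh s x y)
  have "cut (Suc s) y x x"
  proof (rule cut.fresh[OF inner_sym[OF fresh(1)]])
    show "\<not> red s y' x'" if "y' \<subseteq> y" "x' \<subseteq> x" for y' x'
      using fresh(2)[OF that(2,1)] red_sym[of s y' x'] by (rule contrapos_nn)
  qed
  moreover have "x \<union> y - y = x" using inner_disjoint[OF fresh(1)] by blast
  ultimately show ?case by simp
next
  case (left_end s x y x' y')
  have "cut (Suc s) y x (x - x')"
    by (rule cut.right_end[OF inner_sym[OF left_end(1)] left_end(3,2) red_sym[OF left_end(4)] left_end(5)])
  moreover have "x \<union> y - (x' \<union> y) = x - x'" using inner_disjoint[OF left_end(1)] by blast
  ultimately show ?case by simp
next
  case (right_end s x y x' y')
  have "cut (Suc s) y x (y' \<union> x)"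
    by (rule cut.left_end[OF inner_sym[OF right_end(1)] right_end(3,2) red_sym[OF right_end(4)] right_end(5)])
  moreover have "x \<union> y - (y - y') = y' \<union> x"
    using inner_disjoint[OF right_end(1)] right_end(3) by blast
  ultimately show ?case by simp
next
  case (continue s x y x' y' D)
  have "cut (Suc s) y x ((x' \<union> y' - D) \<union> (x - x'))"
    by (rule cut.continue[OF inner_sym[OF continue(1)] continue(3,2) continue.IH, unfolded Un_commute[of y']])
  moreover have "x \<union> y - (D \<union> (y - y')) = (x' \<union> y' - D) \<union> (x - x')"
    using inner_disjoint[OF continue(1)] continue(2,3) cut_subset[OF continue(4)] by blast
  ultimately show ?case by simp
qed

text \<open>If a red edge below \<open>xy\<close> exists and is not inner, one of its ends has red
  degree 1, since 2 is the maximum; so one of the four rules applies. When both ends have degree 1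
  there are two cuts, and either may be taken.\<close>

lemma ex_cut: "inner s x y \<Longrightarrow> \<exists>D. cut s x y D"
proof (induction s arbitrary: x y)
  case 0
  then show ?case using not_red_0 unfolding inner_def by blast
next
  case (Suc s)
  show ?case
  proof (cases "\<exists>x' y'. x' \<subseteq> x \<and> y' \<subseteq> y \<and> red s x' y'")
    case False
    then show ?thesis using cut.fresh[OF Suc.prems] by blast
  next
    case True
    then obtain x' y' where xy: "x' \<subseteq> x" "y' \<subseteq> y" "red s x' y'" by blast
    have mem: "y' \<in> red_nbrs s x'" "x' \<in> red_nbrs s y'"
      using xy red_sym unfolding red_nbrs_def by blast+
    have single: "red_nbrs s p = {q}" if "q \<in> red_nbrs s p" "card (red_nbrs s p) \<noteq> 2" for p q
    proof -
      have "card (red_nbrs s p) \<noteq> 0" using that(1) finite_red_nbrs by auto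
      then have "card (red_nbrs s p) = 1" using card_red_nbrs_le[of s p] that(2) by linarith
      then show ?thesis using that(1) by (auto simp: card_1_singleton_iff)
    qed
    consider "inner s x' y'" | "red_nbrs s x' = {y'}" | "red_nbrs s y' = {x'}"
      using xy(3) single[OF mem(1)] single[OF mem(2)] unfolding inner_def by blast
    then show ?thesis
    proof cases
      case 1
      then show ?thesis using Suc.IH cut.continue[OF Suc.prems xy(1,2)] by blast
    next
      case 2
      then show ?thesis using cut.left_end[OF Suc.prems xy] by blast
    next
      case 3
      then show ?thesis using cut.right_end[OF Suc.prems xy] by blast
    qed
  qed
qed

text \<open>Vertices of \<open>x\<close> get into \<open>D\<close> only through
  \<open>left_end\<close>, as a whole part \<open>x'\<close> whose single red neighbour lies below
  \<open>y\<close>. At that time any vertex outside \<open>x'\<close> and \<open>y\<close> lies in a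
  part that is not red to \<open>x'\<close>, hence homogeneous to it. Later steps leave
  \<open>D \<inter> x\<close> as it is.\<close>

lemma cut_left_const:
  assumes "cut s x y D" "u \<in> pverts G" "u \<notin> y" "u \<notin> D" "v \<in> D \<inter> x" "v' \<in> D \<inter> x" "(u, v) \<in> parcs G"
  shows "(u, v') \<in> parcs G"
  using assms
proof (induction rule: cut.induct)
  case (fresh s x y)
  then show ?case using inner_disjoint[OF fresh.hyps(1)] by auto
next
  case (left_end s x y x' y')
  have v: "v \<in> x'" "v' \<in> x'"
    using left_end.prems(4,5) inner_disjoint[OF left_end.hyps(1)] by auto
  obtain q where q: "q \<in> P s" "u \<in> q" using left_end.prems(1) Union_parts by blast
  have x': "x' \<in> P s" using left_end red_parts by blast
  have "q \<noteq> x'" using q left_end.prems by blast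
  have "\<not> red s x' q"
    using left_end q unfolding red_nbrs_def by blast
  then have "homogeneous G x' q" using homogeneous_if_not_red x' q \<open>q \<noteq> x'\<close> by blast
  then have "homogeneous G q x'" by (rule homogeneous_sym[OF sym_arcs])
  then show ?case using v q left_end.prems unfolding homogeneous_def by blast
next
  case (right_end s x y x' y')
  then show ?case using inner_disjoint[OF right_end.hyps(1)] by auto
next
  case (continue s x y x' y' D)
  show ?case
  proof (rule continue.IH)
    show "u \<in> pverts G" "(u, v) \<in> parcs G" using continue.prems by simp_all
    show "u \<notin> y'" "u \<notin> D" using continue.prems(2,3) continue.hyps(3) by auto
    show "v \<in> D \<inter> x'" "v' \<in> D \<inter> x'"
      using continue.prems(4,5) inner_disjoint[OF continue.hyps(1)] continue.hyps(3)
        cut_subset[OF continue.hyps(4)] by auto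
  qed
qed

lemma cut_right_const:
  assumes cut: "cut s x y D" and u: "u \<in> pverts G" "u \<notin> x" "u \<notin> y - D"
    and v: "v \<in> y - D" "v' \<in> y - D" "(u, v) \<in> parcs G"
  shows "(u, v') \<in> parcs G"
proof (rule cut_left_const[OF cut_sym[OF cut] u(1,2)])
  show "u \<notin> x \<union> y - D" using u by blast
  show "v \<in> (x \<union> y - D) \<inter> y" "v' \<in> (x \<union> y - D) \<inter> y" using v by auto
qed (use v in simp)

text \<open>Here \<open>x\<close> is one old part or the union of two, each of them homogeneous to
  the old part \<open>y\<close>; this makes at most two layers.\<close>

lemma layered_fresh:
  assumes "inner (Suc s) x y" "y \<in> P s" "\<And>x' y'. x' \<subseteq> x \<Longrightarrow> y' \<subseteq> y \<Longrightarrow> \<not> red s x' y'"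
  shows "layered G x y"
proof -
  have xy: "x \<in> P (Suc s)" "x \<noteq> y" using inner_parts[OF assms(1)] by auto
  obtain p where p: "p \<in> P s" "p \<subseteq> x"
    using ex_finer_part[OF xy(1)] part_nonempty[OF xy(1)] by blast
  have hom: "homogeneous G q y" if "q \<in> P s" "q \<subseteq> x" for q
  proof (rule homogeneous_if_not_red[OF that(1) assms(2)])
    show "q \<noteq> y" using that inner_disjoint[OF assms(1)] part_nonempty by blast
  qed (use assms that in blast)
  show ?thesis
  proof (cases "x = p")
    case True
    then show ?thesis using hom p layered_homogeneous by blast
  next
    case False
    then have "x - p \<in> P s" using two_finer_parts[OF xy(1) p] by blast
    then have "layered G (p \<union> (x - p)) y"
      using hom p by (intro layered.left layered_homogeneous) auto
    moreover have "p \<union> (x - p) = x" using p by blast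
    ultimately show ?thesis by simp
  qed
qed

text \<open>If \<open>x\<close> has gained a part, then \<open>y\<close> is old. The gained part is
  not red to \<open>y\<close>, since \<open>red_below_inner\<close> leaves room for only one red
  edge below \<open>xy\<close>.\<close>

lemma homogeneous_remainder:
  assumes "inner (Suc s) x y" "x' \<subseteq> x" "y' \<subseteq> y" "red s x' y'"
  shows "homogeneous G (x - x') y"
proof (cases "x = x'")
  case True
  then show ?thesis unfolding homogeneous_def by blast
next
  case False
  have xy: "x \<in> P (Suc s)" "y \<in> P (Suc s)" "x \<noteq> y" using inner_parts[OF assms(1)] by auto
  have x': "x' \<in> P s" "y' \<in> P s" using red_parts[OF assms(4)] by auto
  have X: "x - x' \<in> P s" using two_finer_parts[OF xy(1) x'(1) assms(2)] False by blast
  have "x \<notin> P s" using unchanged_part[OF _ x'(1) assms(2)] False by blast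
  then have y: "y \<in> P s" using unchanged_or xy by blast
  then have "y' = y" using unchanged_part x' assms by blast
  have "x - x' \<noteq> y" using X part_nonempty inner_disjoint[OF assms(1)] by blast
  moreover have "\<not> red s (x - x') y"
    using red_below_inner[OF assms(1) Diff_subset assms(2) order_refl assms(3) _ assms(4)]
      part_nonempty[OF x'(1)] by blast
  ultimately show ?thesis using homogeneous_if_not_red X y by blast
qed

text \<open>Each step forwards in time adds \<open>x - x'\<close> and \<open>y - y'\<close> to the
  two sides, and \<open>homogeneous_remainder\<close> makes them homogeneous to the other end. Under
  an end rule the former part \<open>x'\<close> or \<open>y'\<close> changes sides as a whole and
  takes the red edge with it, so that the construction starts from a homogeneous pair.\<close>

lemma cut_layered: "cut s x y D \<Longrightarrow> layered G (x - D) (y \<inter> D)"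
proof (induction rule: cut.induct)
  case (fresh s x y)
  have eq: "x - y = x" "y \<inter> y = y" using inner_disjoint[OF fresh(1)] by auto
  have "y \<in> P s \<or> x \<in> P s" using unchanged_or inner_parts[OF fresh(1)] by blast
  then have "layered G x y"
  proof
    assume "y \<in> P s"
    then show ?thesis using layered_fresh[OF fresh(1)] fresh(2) by blast
  next
    assume "x \<in> P s"
    then have "layered G y x"
      using layered_fresh[OF inner_sym[OF fresh(1)]] fresh(2) red_sym by blast
    then show ?thesis by (rule layered_sym[OF sym_arcs])
  qed
  then show ?case unfolding eq .
next
  case (left_end s x y x' y')
  have "x - (x' \<union> y) = x - x'" "y \<inter> (x' \<union> y) = y"
    using inner_disjoint[OF left_end(1)] by auto
  then show ?case
    using homogeneous_remainder[OF left_end(1-4)] layered_homogeneous by metis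
next
  case (right_end s x y x' y')
  have "x - (y - y') = x" "y \<inter> (y - y') = y - y'"
    using inner_disjoint[OF right_end(1)] by auto
  moreover have "homogeneous G (y - y') x"
    by (rule homogeneous_remainder[OF inner_sym[OF right_end(1)] right_end(3,2) red_sym[OF right_end(4)]])
  ultimately show ?case
    using homogeneous_sym[OF sym_arcs] layered_homogeneous by metis
next
  case (continue s x y x' y' D)
  note red' = inner_red[OF cut_inner[OF continue(4)]]
  have x: "x - (D \<union> (y - y')) = (x' - D) \<union> (x - x')"
    and y: "y \<inter> (D \<union> (y - y')) = (y' \<inter> D) \<union> (y - y')"
    using inner_disjoint[OF continue(1)] continue(2,3) cut_subset[OF continue(4)] by auto
  have "homogeneous G (x - x') (y' \<inter> D)"
    by (rule homogeneous_mono[OF homogeneous_remainder[OF continue(1-3) red']]) (use continue in auto)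
  then have 1: "layered G ((x' - D) \<union> (x - x')) (y' \<inter> D)"
    using continue.IH by (rule layered.left[rotated])
  have "homogeneous G (y - y') x"
    by (rule homogeneous_remainder[OF inner_sym[OF continue(1)] continue(3,2) red_sym[OF red']])
  then have "homogeneous G ((x' - D) \<union> (x - x')) (y - y')"
    by (rule homogeneous_mono[OF homogeneous_sym[OF sym_arcs]]) (use continue(2) in auto)
  with 1 show ?case unfolding x y by (rule layered.right)
qed

text \<open>Only \<open>left_end\<close> puts vertices of \<open>x\<close> into \<open>D\<close>,
  and it puts all of \<open>y\<close> there; what \<open>y\<close> gains afterwards goes to
  \<open>D\<close> as well.\<close>

lemma cut_left_dichotomy: "cut s x y D \<Longrightarrow> D \<inter> x = {} \<or> y \<subseteq> D"
proof (induction rule: cut.induct)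
  case (fresh s x y)
  then show ?case by simp
next
  case (left_end s x y x' y')
  then show ?case by simp
next
  case (right_end s x y x' y')
  then show ?case using inner_disjoint[OF right_end(1)] by auto
next
  case (continue s x y x' y' D)
  have "(D \<union> (y - y')) \<inter> x = D \<inter> x'"
    using inner_disjoint[OF continue(1)] continue(2,3) cut_subset[OF continue(4)] by auto
  then show ?case using continue.IH by auto
qed

lemma ex_part: "v \<in> pverts G \<Longrightarrow> \<exists>p\<in>P s. v \<in> p"
  unfolding Union_parts[of s, symmetric] by blast

section \<open>Segments\<close>

text \<open>Pairs point into \<open>N\<close>: the second component is the end inside, so that the
  set \<open>D\<close> of a cut is on the side of \<open>W\<close>.\<close>

definition boundary :: "nat \<Rightarrow> 'a set set \<Rightarrow> ('a set \<times> 'a set) set" where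
  "boundary s N = {(x, y). x \<notin> N \<and> y \<in> N \<and> red s x y}"

text \<open>
  The vertex set \<open>W\<close> agrees with \<open>\<Union>N\<close> except on the ends of the red edges leaving \<open>N\<close>, where it is
  bounded by cuts.
\<close>

definition segment :: "nat \<Rightarrow> 'a set set \<Rightarrow> 'a set \<Rightarrow> bool" where
  "segment s N W \<longleftrightarrow> N \<subseteq> P s \<and> W \<subseteq> pverts G \<and> card (boundary s N) \<le> 2
     \<and> (\<forall>x y y'. (x, y) \<in> boundary s N \<longrightarrow> (x, y') \<in> boundary s N \<longrightarrow> y = y')
     \<and> (\<forall>x x' y. (x, y) \<in> boundary s N \<longrightarrow> (x', y) \<in> boundary s N \<longrightarrow> x = x')
     \<and> (\<forall>x y. (x, y) \<in> boundary s N \<longrightarrow> cut s x y (W \<inter> (x \<union> y)))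
     \<and> (\<forall>p\<in>N. p \<notin> Range (boundary s N) \<longrightarrow> p \<subseteq> W)
     \<and> (\<forall>p\<in>P s - N. p \<notin> Domain (boundary s N) \<longrightarrow> p \<inter> W = {})"

lemma segmentI:
  assumes "N \<subseteq> P s" "W \<subseteq> pverts G" "card (boundary s N) \<le> 2"
    and "\<And>x y y'. (x, y) \<in> boundary s N \<Longrightarrow> (x, y') \<in> boundary s N \<Longrightarrow> y = y'"
    and "\<And>x x' y. (x, y) \<in> boundary s N \<Longrightarrow> (x', y) \<in> boundary s N \<Longrightarrow> x = x'"
    and "\<And>x y. (x, y) \<in> boundary s N \<Longrightarrow> cut s x y (W \<inter> (x \<union> y))"
    and "\<And>p. p \<in> N \<Longrightarrow> p \<notin> Range (boundary s N) \<Longrightarrow> p \<subseteq> W"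
    and "\<And>p. p \<in> P s \<Longrightarrow> p \<notin> N \<Longrightarrow> p \<notin> Domain (boundary s N) \<Longrightarrow> p \<inter> W = {}"
  shows "segment s N W"
  unfolding segment_def using assms by (intro conjI allI impI ballI) auto

lemma
  assumes "segment s N W"
  shows segment_subset: "N \<subseteq> P s"
    and segment_verts: "W \<subseteq> pverts G"
    and segment_card: "card (boundary s N) \<le> 2"
    and segment_match_left: "\<And>x y y'. (x, y) \<in> boundary s N \<Longrightarrow> (x, y') \<in> boundary s N \<Longrightarrow> y = y'"
    and segment_match_right: "\<And>x x' y. (x, y) \<in> boundary s N \<Longrightarrow> (x', y) \<in> boundary s N \<Longrightarrow> x = x'"
    and segment_cut: "\<And>x y. (x, y) \<in> boundary s N \<Longrightarrow> cut s x y (W \<inter> (x \<union> y))"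
    and segment_in: "\<And>p. p \<in> N \<Longrightarrow> p \<notin> Range (boundary s N) \<Longrightarrow> p \<subseteq> W"
    and segment_out: "\<And>p. p \<in> P s \<Longrightarrow> p \<notin> N \<Longrightarrow> p \<notin> Domain (boundary s N) \<Longrightarrow> p \<inter> W = {}"
  using assms unfolding segment_def by (metis DiffI)+

lemma boundaryD:
  assumes "(x, y) \<in> boundary s N"
  shows "x \<notin> N" "y \<in> N" "red s x y" "x \<in> P s" "y \<in> P s"
  using assms red_parts unfolding boundary_def by auto

lemma boundaryI: "red s x y \<Longrightarrow> x \<notin> N \<Longrightarrow> y \<in> N \<Longrightarrow> (x, y) \<in> boundary s N"
  unfolding boundary_def by simp

lemma finite_boundary: "finite (boundary s N)"
proof (rule finite_subset)
  show "boundary s N \<subseteq> P s \<times> P s" using boundaryD(4,5) by auto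
qed (simp add: finite_parts)

text \<open>Vertices of \<open>\<Union>N\<close> outside \<open>W\<close> lie in sets
  \<open>y - W\<close> for boundary pairs \<open>(x, y)\<close>. By \<open>cut_right_const\<close> a
  vertex of \<open>W\<close> outside \<open>x\<close> is constant on each of them, so its row is
  given by a subset of the at most 2 boundary pairs; this leaves \<open>2 ^ 2\<close>
  possibilities.\<close>

lemma segment_rows_on_removed:
  assumes seg: "segment s N W" and p: "p \<in> N"
  shows "row_count G (W \<inter> p) ((pverts G - W) \<inter> \<Union>N) \<le> 4"
proof -
  let ?B = "boundary s N" and ?M = "(pverts G - W) \<inter> \<Union>N"
  have "row G ?M u \<in> (\<lambda>S. \<Union>(x, y)\<in>S. y - W) ` Pow ?B" if u: "u \<in> W \<inter> p" for u
  proof (rule image_eqI)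
    let ?S = "{(x, y) \<in> ?B. \<exists>v\<in>y - W. (u, v) \<in> parcs G}"
    show "?S \<in> Pow ?B" by auto
    show "row G ?M u = (\<Union>(x, y)\<in>?S. y - W)"
    proof (intro equalityI subsetI)
      fix v assume v: "v \<in> row G ?M u"
      then obtain q where q: "q \<in> N" "v \<in> q" "v \<notin> W" "(u, v) \<in> parcs G"
        unfolding row_def by auto
      then obtain x where "(x, q) \<in> ?B"
        using segment_in[OF seg q(1)] by auto
      then show "v \<in> (\<Union>(x, y)\<in>?S. y - W)" using q by auto
    next
      fix v assume "v \<in> (\<Union>(x, y)\<in>?S. y - W)"
      then obtain x y v0 where b: "(x, y) \<in> ?B" and v0: "v0 \<in> y - W" "(u, v0) \<in> parcs G"
        and v: "v \<in> y - W" by auto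
      have pP: "p \<in> P s" using segment_subset[OF seg] p by auto
      have "(u, v) \<in> parcs G"
      proof (rule cut_right_const[OF segment_cut[OF seg b] _ _ _ _ _ v0(2)])
        show "u \<in> pverts G" using u segment_verts[OF seg] by auto
        show "u \<notin> x" using u boundaryD(1,4)[OF b] p pP parts_eq by blast
      qed (use u v v0 in auto)
      moreover have "v \<in> ?M"
        using v boundaryD(2,5)[OF b] part_subset by auto
      ultimately show "v \<in> row G ?M u" unfolding row_def by simp
    qed
  qed
  then have "row G ?M ` (W \<inter> p) \<subseteq> (\<lambda>S. \<Union>(x, y)\<in>S. y - W) ` Pow ?B" by auto
  then have "row_count G (W \<inter> p) ?M \<le> card (Pow ?B)"
    unfolding row_count_def using finite_boundary
    by (meson card_image_le card_mono finite_Pow_iff finite_imageI order_trans)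
  also have "\<dots> \<le> 2 ^ 2"
    using power_increasing[OF segment_card[OF seg], of "2::nat"] finite_boundary
    by (simp add: card_Pow)
  finally show ?thesis by simp
qed

text \<open>The columns outside \<open>W\<close> form up to three groups, whose numbers of distinct
  rows multiply: those in \<open>\<Union>N\<close>, with at most 4; those of the outer part
  \<open>x\<close> of a boundary pair \<open>(x, p)\<close>, with at most \<open>2 * t + 2\<close>
  by \<open>cut_layered\<close>; and the rest, with one, because they lie in parts that are not red
  to \<open>p\<close>.\<close>

lemma segment_rows_of_part:
  assumes seg: "segment s N W" and p: "p \<in> N"
    and free: "\<not> semi_induced_half_graph t G"
  shows "row_count G (W \<inter> p) (pverts G - W) \<le> (if p \<in> Range (boundary s N) then 8 * t + 8 else 4)"
proof -
  let ?B = "boundary s N" and ?M = "(pverts G - W) \<inter> \<Union>N" and ?R = "(pverts G - W) - \<Union>N"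
  have pP: "p \<in> P s" using segment_subset[OF seg] p by auto
  have fin: "finite (W \<inter> p)" using finite_part[OF pP] by simp
  have const: "row_count G (W \<inter> p) R \<le> 1" if R: "R \<subseteq> ?R - (\<Union>x\<in>{x. (x, p) \<in> ?B}. x)" for R
  proof (rule row_count_le_1)
    fix u u' v
    assume u: "u \<in> W \<inter> p" "u' \<in> W \<inter> p" and v: "v \<in> R" and uv: "(u, v) \<in> parcs G"
    have v': "v \<in> pverts G" "v \<notin> \<Union>N" "\<And>x. (x, p) \<in> ?B \<Longrightarrow> v \<notin> x" using v R by auto
    then obtain q where q: "q \<in> P s" "v \<in> q" using ex_part by blast
    then have "q \<notin> N" "(q, p) \<notin> ?B" using v' by auto
    then have "\<not> red s p q" "p \<noteq> q" using red_sym boundaryI p by blast+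
    then have "homogeneous G p q" using homogeneous_if_not_red pP q(1) by simp
    then show "(u', v) \<in> parcs G" using u uv q(2) unfolding homogeneous_def by auto
  qed
  have M: "row_count G (W \<inter> p) (pverts G - W) \<le> 4 * row_count G (W \<inter> p) ?R"
  proof -
    have "row_count G (W \<inter> p) (?M \<union> ?R) \<le> row_count G (W \<inter> p) ?M * row_count G (W \<inter> p) ?R"
      by (rule row_count_columns_Un_le[OF fin])
    also have "\<dots> \<le> 4 * row_count G (W \<inter> p) ?R"
      by (intro mult_right_mono segment_rows_on_removed[OF seg p]) simp
    finally show ?thesis by (simp add: Int_Diff_Un)
  qed
  show ?thesis
  proof (cases "p \<in> Range ?B")
    case False
    then have "{x. (x, p) \<in> ?B} = {}" by auto
    then show ?thesis using M const[of ?R] False by auto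
  next
    case True
    then obtain x where b: "(x, p) \<in> ?B" by auto
    note cut = segment_cut[OF seg b]
    have D: "x - (W \<inter> (x \<union> p)) = x - W" "p \<inter> (W \<inter> (x \<union> p)) = W \<inter> p" by auto
    have "layered G (x - W) (W \<inter> p)" using cut_layered[OF cut] unfolding D .
    then have "layered G (W \<inter> p) (x - W)" by (rule layered_sym[OF sym_arcs])
    then have 1: "row_count G (W \<inter> p) (x - W) \<le> 2 * t + 2"
      by (rule layered_row_count_le[OF _ sym_arcs _ _ _ free])
        (use pP boundaryD(4)[OF b] part_subset in auto)
    have "{x'. (x', p) \<in> ?B} = {x}" using b segment_match_right[OF seg] by auto
    then have 2: "row_count G (W \<inter> p) (?R - x) \<le> 1" using const[of "?R - x"] by simp
    have "row_count G (W \<inter> p) ?R \<le> row_count G (W \<inter> p) ((x - W) \<union> (?R - x))"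
      by (rule row_count_mono[OF fin]) auto
    also have "\<dots> \<le> row_count G (W \<inter> p) (x - W) * row_count G (W \<inter> p) (?R - x)"
      by (rule row_count_columns_Un_le[OF fin])
    also have "\<dots> \<le> (2 * t + 2) * 1" by (rule mult_mono[OF 1 2]) auto
    finally show ?thesis using M True by simp
  qed
qed

text \<open>By \<open>cut_left_dichotomy\<close>, \<open>W\<close> contains \<open>y\<close> if it
  meets \<open>x\<close>. A vertex outside \<open>W\<close> is then outside \<open>y\<close>, and by
  \<open>cut_left_const\<close> it does not distinguish vertices of
  \<open>W \<inter> x\<close>.\<close>

lemma segment_rows_outside:
  assumes seg: "segment s N W" and b: "(x, y) \<in> boundary s N"
  shows "row_count G (W \<inter> x) (pverts G - W) \<le> 1"
proof (rule row_count_le_1)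
  fix u u' v
  assume u: "u \<in> W \<inter> x" "u' \<in> W \<inter> x" and v: "v \<in> pverts G - W" and uv: "(u, v) \<in> parcs G"
  note cut = segment_cut[OF seg b]
  have "W \<inter> (x \<union> y) \<inter> x \<noteq> {}" using u by auto
  then have "y \<subseteq> W" using cut_left_dichotomy[OF cut] by auto
  have "(v, u') \<in> parcs G"
  proof (rule cut_left_const[OF cut])
    show "v \<notin> y" using v \<open>y \<subseteq> W\<close> by auto
    show "(v, u) \<in> parcs G" using uv sym_arcs by (auto elim: symE)
  qed (use u v in auto)
  then show "(u', v) \<in> parcs G" using sym_arcs by (auto elim: symE)
qed

text \<open>
  Here \<open>42 = 2 * 8 + 6 * 4 + 2\<close>: each of the at most 6 parts has at most 4 distinct rows, each of
  the at most 2 parts at a cut another \<open>4 * (2 * t + 2)\<close>, and each vertex set cut off from outside \<open>N\<close> one.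
\<close>

lemma segment_row_count_le:
  assumes seg: "segment s N W" and card: "card N \<le> 6"
    and free: "\<not> semi_induced_half_graph t G"
  shows "row_count G W (pverts G - W) \<le> 16 * t + 42"
proof -
  let ?B = "boundary s N" and ?V = "pverts G - W"
  have finN: "finite N" using segment_subset[OF seg] finite_parts finite_subset by metis
  have "W \<subseteq> (\<Union>p\<in>N. W \<inter> p) \<union> (\<Union>b\<in>?B. W \<inter> fst b)"
  proof
    fix w assume w: "w \<in> W"
    then obtain q where q: "q \<in> P s" "w \<in> q" using segment_verts[OF seg] ex_part by blast
    show "w \<in> (\<Union>p\<in>N. W \<inter> p) \<union> (\<Union>b\<in>?B. W \<inter> fst b)"
    proof (cases "q \<in> N")
      case False
      then have "q \<in> Domain ?B" using segment_out[OF seg q(1) False] w q(2) by auto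
      then obtain y where "(q, y) \<in> ?B" by auto
      then show ?thesis using w q(2) by force
    qed (use w q in auto)
  qed
  then have "row_count G W ?V \<le> row_count G ((\<Union>p\<in>N. W \<inter> p) \<union> (\<Union>b\<in>?B. W \<inter> fst b)) ?V"
  proof (rule row_count_mono[rotated])
    show "finite ((\<Union>p\<in>N. W \<inter> p) \<union> (\<Union>b\<in>?B. W \<inter> fst b))"
      by (rule finite_subset[OF _ finite_verts]) (use segment_verts[OF seg] in auto)
  qed simp
  also have "\<dots> \<le> row_count G (\<Union>p\<in>N. W \<inter> p) ?V + row_count G (\<Union>b\<in>?B. W \<inter> fst b) ?V"
    by (rule row_count_Un_le)
  also have "row_count G (\<Union>b\<in>?B. W \<inter> fst b) ?V \<le> (\<Sum>b\<in>?B. row_count G (W \<inter> fst b) ?V)"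
    by (rule row_count_UN_le[OF finite_boundary])
  also have "\<dots> \<le> (\<Sum>b\<in>?B. 1)"
    using segment_rows_outside[OF seg] by (intro sum_mono) auto
  also have "\<dots> \<le> 2" using segment_card[OF seg] by simp
  also have "row_count G (\<Union>p\<in>N. W \<inter> p) ?V \<le> (\<Sum>p\<in>N. row_count G (W \<inter> p) ?V)"
    by (rule row_count_UN_le[OF finN])
  also have "\<dots> \<le> (\<Sum>p\<in>N. (if p \<in> Range ?B then 8 * t + 8 else 0) + 4)"
    using segment_rows_of_part[OF seg _ free] by (intro sum_mono) (fastforce split: if_splits)
  also have "\<dots> = (8 * t + 8) * card (N \<inter> Range ?B) + 4 * card N"
    using finN by (simp add: sum.distrib sum.If_cases)
  also have "\<dots> \<le> (8 * t + 8) * 2 + 4 * 6"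
  proof (intro add_mono mult_left_mono card)
    have "card (Range ?B) \<le> card ?B"
      unfolding Range_snd by (rule card_image_le[OF finite_boundary])
    moreover have "card (N \<inter> Range ?B) \<le> card (Range ?B)"
      using finite_boundary by (intro card_mono) (auto simp: Range_snd)
    ultimately show "card (N \<inter> Range ?B) \<le> 2" using segment_card[OF seg] by linarith
  qed auto
  finally show ?thesis by simp
qed

section \<open>Describing a segment one step back in time\<close>

definition coarse :: "nat \<Rightarrow> 'a set \<Rightarrow> 'a set" where
  "coarse s p = (SOME q. q \<in> P (Suc s) \<and> p \<subseteq> q)"

lemma coarse: "p \<in> P s \<Longrightarrow> coarse s p \<in> P (Suc s)" "p \<in> P s \<Longrightarrow> p \<subseteq> coarse s p"
proof -
  assume "p \<in> P s"
  then have "\<exists>q. q \<in> P (Suc s) \<and> p \<subseteq> q" using ex_coarser_part by blast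
  then have "coarse s p \<in> P (Suc s) \<and> p \<subseteq> coarse s p" unfolding coarse_def by (rule someI_ex)
  then show "coarse s p \<in> P (Suc s)" "p \<subseteq> coarse s p" by auto
qed

lemma coarse_eq:
  assumes "p \<in> P s" "q \<in> P (Suc s)" "p \<subseteq> q"
  shows "coarse s p = q"
  using coarse[OF assms(1)] parts_eq[OF _ assms(2)] part_nonempty[OF assms(1)] assms(3) by blast

lemma subset_two_parts:
  assumes "p \<in> P s" "x \<in> P (Suc s)" "y \<in> P (Suc s)" "p \<subseteq> x \<union> y"
  shows "coarse s p = x \<or> coarse s p = y"
proof -
  obtain v where "v \<in> p" using part_nonempty[OF assms(1)] by auto
  then have "v \<in> coarse s p" "v \<in> x \<or> v \<in> y" using coarse(2)[OF assms(1)] assms(4) by auto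
  then show ?thesis using parts_eq coarse(1)[OF assms(1)] assms(2,3) by metis
qed

text \<open>\<open>T\<close> is the set of the parts below \<open>x\<close> and \<open>y\<close> that count to the side \<open>D\<close> of \<open>y\<close>.\<close>

definition refines :: "nat \<Rightarrow> 'a set \<Rightarrow> 'a set \<Rightarrow> 'a set \<Rightarrow> 'a set set \<Rightarrow> bool" where
  "refines s x y D T \<longleftrightarrow>
     T \<subseteq> {p \<in> P s. p \<subseteq> x \<union> y}
     \<and> (\<forall>p q. p \<in> T \<longrightarrow> p \<subseteq> x \<longrightarrow> red s p q \<longrightarrow> q \<in> T)
     \<and> (\<forall>p q. p \<subseteq> y \<longrightarrow> p \<notin> T \<longrightarrow> red s p q \<longrightarrow> q \<subseteq> x \<union> y \<and> q \<notin> T)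
     \<and> (\<forall>p q. p \<in> T \<longrightarrow> q \<notin> T \<longrightarrow> q \<subseteq> x \<longrightarrow> p \<subseteq> y \<longrightarrow> red s q p \<longrightarrow> cut s q p (D \<inter> (q \<union> p)))
     \<and> (\<forall>p. p \<in> T \<longrightarrow> (\<forall>q. q \<notin> T \<longrightarrow> q \<subseteq> x \<longrightarrow> \<not> red s q p) \<longrightarrow> p \<subseteq> D)
     \<and> (\<forall>p. p \<in> P s \<longrightarrow> p \<subseteq> x \<union> y \<longrightarrow> p \<notin> T \<longrightarrow> (\<forall>q. q \<in> T \<longrightarrow> q \<subseteq> y \<longrightarrow> \<not> red s p q) \<longrightarrow> p \<inter> D = {})"

lemma refinesI:
  assumes "\<And>p. p \<in> T \<Longrightarrow> p \<in> P s" "\<And>p. p \<in> T \<Longrightarrow> p \<subseteq> x \<union> y"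
    and "\<And>p q. p \<in> T \<Longrightarrow> p \<subseteq> x \<Longrightarrow> red s p q \<Longrightarrow> q \<in> T"
    and "\<And>p q. p \<in> P s \<Longrightarrow> p \<subseteq> y \<Longrightarrow> p \<notin> T \<Longrightarrow> red s p q \<Longrightarrow> q \<subseteq> x \<union> y \<and> q \<notin> T"
    and "\<And>p q. p \<in> T \<Longrightarrow> q \<notin> T \<Longrightarrow> q \<subseteq> x \<Longrightarrow> p \<subseteq> y \<Longrightarrow> red s q p \<Longrightarrow> cut s q p (D \<inter> (q \<union> p))"
    and "\<And>p. p \<in> T \<Longrightarrow> (\<And>q. q \<notin> T \<Longrightarrow> q \<subseteq> x \<Longrightarrow> \<not> red s q p) \<Longrightarrow> p \<subseteq> D"
    and "\<And>p. p \<in> P s \<Longrightarrow> p \<subseteq> x \<union> y \<Longrightarrow> p \<notin> T \<Longrightarrow>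
      (\<And>q. q \<in> T \<Longrightarrow> q \<subseteq> y \<Longrightarrow> \<not> red s p q) \<Longrightarrow> p \<inter> D = {}"
  shows "refines s x y D T"
  unfolding refines_def
proof (intro conjI allI impI)
  show "T \<subseteq> {p \<in> P s. p \<subseteq> x \<union> y}" using assms(1,2) by auto
  show "q \<subseteq> x \<union> y" "q \<notin> T" if "p \<subseteq> y" "p \<notin> T" "red s p q" for p q
    using assms(4)[of p q] that red_parts[of s p q] by simp_all
  show "q \<in> T" if "p \<in> T" "p \<subseteq> x" "red s p q" for p q
    using that by (rule assms(3))
  show "cut s q p (D \<inter> (q \<union> p))"
    if "p \<in> T" "q \<notin> T" "q \<subseteq> x" "p \<subseteq> y" "red s q p" for p q
    using that by (rule assms(5))
  show "p \<subseteq> D" if "p \<in> T" "\<forall>q. q \<notin> T \<longrightarrow> q \<subseteq> x \<longrightarrow> \<not> red s q p" for p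
    by (rule assms(6)[OF that(1)]) (simp add: that(2))
  show "p \<inter> D = {}" if "p \<in> P s" "p \<subseteq> x \<union> y" "p \<notin> T"
    "\<forall>q. q \<in> T \<longrightarrow> q \<subseteq> y \<longrightarrow> \<not> red s p q" for p
    by (rule assms(7)[OF that(1-3)]) (simp add: that(4))
qed

text \<open>Each rule prescribes \<open>T\<close>: the parts below \<open>y\<close>, with
  \<open>x'\<close> added under \<open>left_end\<close> and \<open>y'\<close> removed under
  \<open>right_end\<close>. By \<open>red_below_inner\<close> the only red edge between
  \<open>x\<close> and \<open>y\<close> one step back, if any, joins \<open>x'\<close> and
  \<open>y'\<close>. The end rules put both on the same side, where the end of degree 1 has no
  further red edge.\<close>

lemma cut_refines:
  assumes "cut (Suc s) x y D"
  shows "\<exists>T. refines s x y D T"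
proof -
  note inn = cut_inner[OF assms]
  have xy: "x \<in> P (Suc s)" "y \<in> P (Suc s)" "x \<inter> y = {}"
    using inner_parts[OF inn] inner_disjoint[OF inn] by auto
  have sub: "p \<subseteq> x \<or> p \<subseteq> y" if "p \<in> P s" "p \<subseteq> x \<union> y" for p
    using subset_two_parts[OF that(1) xy(1,2) that(2)] coarse(2)[OF that(1)] by auto
  have not_both: "\<not> (p \<subseteq> x \<and> p \<subseteq> y)" if "p \<in> P s" for p
    using part_nonempty[OF that] xy(3) by auto
  have rP: "p \<in> P s" "q \<in> P s" if "red s p q" for p q using red_parts[OF that] by auto
  from assms show ?thesis
  proof cases
    case fresh
    have no_red: "\<not> red s p q" if "p \<subseteq> x" "q \<subseteq> y" for p q
      using fresh that by blast
    have "refines s x y D {p \<in> P s. p \<subseteq> y}"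
    proof (rule refinesI)
      show "p \<inter> D = {}" if "p \<in> P s" "p \<subseteq> x \<union> y" "p \<notin> {p \<in> P s. p \<subseteq> y}" for p
        using sub[OF that(1,2)] that xy(3) fresh(1) by auto
      show "cut s q p (D \<inter> (q \<union> p))" if "q \<subseteq> x" "p \<subseteq> y" "red s q p" for p q
        using no_red[OF that(1,2)] that(3) by simp
      show "q \<in> {p \<in> P s. p \<subseteq> y}" if "p \<in> {p \<in> P s. p \<subseteq> y}" "p \<subseteq> x" for p q
        using that not_both by auto
    qed (use fresh(1) in auto)
    then show ?thesis by blast
  next
    case (left_end x' y')
    have x': "x' \<in> P s" "y' \<in> P s" using rP left_end by auto
    have uniq: "p = x'" if "p \<subseteq> x" "q \<subseteq> y" "red s p q" for p q
      using red_below_inner[OF inn that(1) _ that(2) _ that(3)] left_end by blast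
    have nb: "q = y'" if "red s x' q" for q using left_end that unfolding red_nbrs_def by auto
    let ?T = "insert x' {p \<in> P s. p \<subseteq> y}"
    have "refines s x y D ?T"
    proof (rule refinesI)
      show "p \<in> P s" "p \<subseteq> x \<union> y" if "p \<in> ?T" for p
        using that x' left_end(3) by auto
      show "q \<in> ?T" if "p \<in> ?T" "p \<subseteq> x" "red s p q" for p q
      proof -
        have "p = x'" using that(1,2) not_both by auto
        then show ?thesis using nb that(3) x' left_end(4) by auto
      qed
      show "cut s q p (D \<inter> (q \<union> p))" if "q \<notin> ?T" "q \<subseteq> x" "p \<subseteq> y" "red s q p" for p q
        using uniq[OF that(2-4)] that(1) by simp
      show "p \<subseteq> D" if "p \<in> ?T" for p using that left_end(1) by auto
      show "p \<inter> D = {}" if p: "p \<in> P s" "p \<subseteq> x \<union> y" "p \<notin> ?T" for p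
      proof -
        have "p \<subseteq> x" "p \<noteq> x'" using sub[OF p(1,2)] p by auto
        then show ?thesis using parts_disjoint[OF p(1) x'(1)] xy(3) left_end(1) by auto
      qed
    qed auto
    then show ?thesis by blast
  next
    case (right_end x' y')
    have x': "x' \<in> P s" "y' \<in> P s" using rP right_end by auto
    have uniq: "q = y'" if "p \<subseteq> x" "q \<subseteq> y" "red s p q" for p q
      using red_below_inner[OF inn that(1) _ that(2) _ that(3)] right_end by blast
    have nb: "q = x'" if "red s y' q" for q using right_end that unfolding red_nbrs_def by auto
    let ?T = "{p \<in> P s. p \<subseteq> y} - {y'}"
    have "refines s x y D ?T"
    proof (rule refinesI)
      show "q \<in> ?T" if "p \<in> ?T" "p \<subseteq> x" for p q
        using that not_both by auto
      show "q \<subseteq> x \<union> y \<and> q \<notin> ?T" if "p \<in> P s" "p \<subseteq> y" "p \<notin> ?T" "red s p q" for p q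
      proof -
        have "p = y'" using that(1-3) by auto
        then have "q = x'" using nb that(4) by simp
        then show ?thesis using right_end(3) x'(1) not_both by auto
      qed
      show "cut s q p (D \<inter> (q \<union> p))" if "p \<in> ?T" "q \<subseteq> x" "p \<subseteq> y" "red s q p" for p q
        using uniq[OF that(2-4)] that(1) by simp
      show "p \<subseteq> D" if "p \<in> ?T" for p
        using that parts_disjoint[OF _ x'(2)] right_end(1) by auto
      show "p \<inter> D = {}" if p: "p \<in> P s" "p \<subseteq> x \<union> y" "p \<notin> ?T" for p
        using sub[OF p(1,2)] p xy(3) right_end(1) by auto
    qed auto
    then show ?thesis by blast
  next
    case (continue x' y' D')
    note red' = inner_red[OF cut_inner[OF continue(5)]]
    have x': "x' \<in> P s" "y' \<in> P s" using rP[OF red'] by auto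
    have uniq: "p = x' \<and> q = y'" if "p \<subseteq> x" "q \<subseteq> y" "red s p q" for p q
      using red_below_inner[OF inn that(1) _ that(2) _ that(3) red'] continue by blast
    have D': "D' \<subseteq> x' \<union> y'" by (rule cut_subset[OF continue(5)])
    let ?T = "{p \<in> P s. p \<subseteq> y}"
    have "refines s x y D ?T"
    proof (rule refinesI)
      show "q \<in> ?T" if "p \<in> ?T" "p \<subseteq> x" for p q
        using that not_both by auto
      show "cut s q p (D \<inter> (q \<union> p))" if "q \<subseteq> x" "p \<subseteq> y" "red s q p" for p q
      proof -
        have "q = x'" "p = y'" using uniq[OF that] by auto
        moreover have "D \<inter> (x' \<union> y') = D'"
          using D' continue(1,3,4) xy(3) by auto
        ultimately show ?thesis using continue(5) by simp
      qed
      show "p \<subseteq> D" if "p \<in> ?T" "\<And>q. q \<notin> ?T \<Longrightarrow> q \<subseteq> x \<Longrightarrow> \<not> red s q p" for p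
      proof -
        have "p \<noteq> y'" using that(2)[of x'] red' continue(3) not_both x'(1) by auto
        then show ?thesis using that(1) parts_disjoint[OF _ x'(2)] continue(1) by auto
      qed
      show "p \<inter> D = {}" if p: "p \<in> P s" "p \<subseteq> x \<union> y" "p \<notin> ?T"
        "\<And>q. q \<in> ?T \<Longrightarrow> q \<subseteq> y \<Longrightarrow> \<not> red s p q" for p
      proof -
        have "p \<noteq> x'" using p(4)[of y'] red' continue(4) x'(2) by auto
        moreover have "p \<subseteq> x" using sub[OF p(1,2)] p by auto
        ultimately show ?thesis
          using parts_disjoint[OF p(1) x'(1)] xy(3) D' continue(1,4) by blast
      qed
    qed auto
    then show ?thesis by blast
  qed
qed

lemma
  assumes "refines s x y D T"
  shows refines_parts: "\<And>p. p \<in> T \<Longrightarrow> p \<in> P s"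
    and refines_subset: "\<And>p. p \<in> T \<Longrightarrow> p \<subseteq> x \<union> y"
    and refines_left: "\<And>p q. p \<in> T \<Longrightarrow> p \<subseteq> x \<Longrightarrow> red s p q \<Longrightarrow> q \<in> T"
    and refines_right1: "\<And>p q. p \<subseteq> y \<Longrightarrow> p \<notin> T \<Longrightarrow> red s p q \<Longrightarrow> q \<subseteq> x \<union> y"
    and refines_right2: "\<And>p q. p \<subseteq> y \<Longrightarrow> p \<notin> T \<Longrightarrow> red s p q \<Longrightarrow> q \<notin> T"
    and refines_cut: "\<And>p q. p \<in> T \<Longrightarrow> q \<notin> T \<Longrightarrow> q \<subseteq> x \<Longrightarrow> p \<subseteq> y \<Longrightarrow> red s q p \<Longrightarrow> cut s q p (D \<inter> (q \<union> p))"
    and refines_in: "\<And>p. p \<in> T \<Longrightarrow> (\<And>q. q \<notin> T \<Longrightarrow> q \<subseteq> x \<Longrightarrow> \<not> red s q p) \<Longrightarrow> p \<subseteq> D"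
    and refines_out: "\<And>p. p \<in> P s \<Longrightarrow> p \<subseteq> x \<union> y \<Longrightarrow> p \<notin> T \<Longrightarrow>
      (\<And>q. q \<in> T \<Longrightarrow> q \<subseteq> y \<Longrightarrow> \<not> red s p q) \<Longrightarrow> p \<inter> D = {}"
proof -
  note * = assms[unfolded refines_def]
  show "p \<in> P s" "p \<subseteq> x \<union> y" if "p \<in> T" for p using * that by (simp_all add: subset_iff)
  show "q \<in> T" if "p \<in> T" "p \<subseteq> x" "red s p q" for p q using * that by metis
  show "q \<subseteq> x \<union> y" "q \<notin> T" if "p \<subseteq> y" "p \<notin> T" "red s p q" for p q using * that by metis+
  show "cut s q p (D \<inter> (q \<union> p))"
    if "p \<in> T" "q \<notin> T" "q \<subseteq> x" "p \<subseteq> y" "red s q p" for p q using * that by metis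
  show "p \<subseteq> D" if "p \<in> T" "(\<And>q. q \<notin> T \<Longrightarrow> q \<subseteq> x \<Longrightarrow> \<not> red s q p)" for p using * that by metis
  show "p \<inter> D = {}" if "p \<in> P s" "p \<subseteq> x \<union> y" "p \<notin> T"
      "(\<And>q. q \<in> T \<Longrightarrow> q \<subseteq> y \<Longrightarrow> \<not> red s p q)" for p using * that by metis
qed

text \<open>The vertex set \<open>W\<close> is kept and only its description changes. The new parts
  lie below \<open>N\<close> or below one of the at most 2 outer ends of boundary pairs, and undoing
  a merge adds at most one more; this gives the 3.\<close>

lemma segment_refine:
  assumes seg: "segment (Suc s) N W"
  shows "\<exists>N'. segment s N' W \<and> card N' \<le> card N + 3"
proof -
  let ?B = "boundary (Suc s) N"
  have "\<forall>b\<in>?B. \<exists>T. refines s (fst b) (snd b) (W \<inter> (fst b \<union> snd b)) T"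
    using cut_refines segment_cut[OF seg] by auto
  then obtain T where T: "\<And>x y. (x, y) \<in> ?B \<Longrightarrow> refines s x y (W \<inter> (x \<union> y)) (T (x, y))"
    unfolding bchoice_iff by fastforce
  \<comment> \<open>Away from the boundary pairs membership is inherited from \<open>N\<close>. At
    the ends of a boundary pair \<open>T\<close> decides, which may admit parts below the outer end
    and reject parts below the inner one.\<close>
  define N' where "N' = {p \<in> P s. coarse s p \<in> N \<and> coarse s p \<notin> Range ?B} \<union> (\<Union>b\<in>?B. T b)"
  have NP: "N \<subseteq> P (Suc s)" by (rule segment_subset[OF seg])
  have N'P: "N' \<subseteq> P s"
    unfolding N'_def using refines_parts[OF T] by auto
  have TP: "coarse s p \<in> {x, y}" if "(x, y) \<in> ?B" "p \<in> T (x, y)" for x y p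
    using subset_two_parts[OF refines_parts[OF T[OF that(1)] that(2)] boundaryD(4,5)[OF that(1)]
        refines_subset[OF T[OF that(1)] that(2)]] by simp
  have mem_other: "p \<in> N' \<longleftrightarrow> coarse s p \<in> N"
    if "p \<in> P s" "coarse s p \<notin> Domain ?B" "coarse s p \<notin> Range ?B" for p
    unfolding N'_def using that TP by fastforce
  have mem_end: "p \<in> N' \<longleftrightarrow> p \<in> T (x, y)"
    if b: "(x, y) \<in> ?B" and p: "p \<in> P s" "coarse s p \<in> {x, y}" for p x y
  proof
    assume "p \<in> N'"
    moreover have "coarse s p \<notin> N \<or> coarse s p \<in> Range ?B" using p(2) b boundaryD(1)[OF b] by auto
    ultimately obtain x' y' where b': "(x', y') \<in> ?B" "p \<in> T (x', y')"
      unfolding N'_def by auto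
    then have "coarse s p \<in> {x', y'}" using TP by blast
    then have "x = x' \<or> y = y'"
      using p(2) boundaryD(1,2)[OF b] boundaryD(1,2)[OF b'(1)] by auto
    then have "x = x' \<and> y = y'"
      using segment_match_left[OF seg] segment_match_right[OF seg] b b'(1) by metis
    then show "p \<in> T (x, y)" using b'(2) by simp
  qed (use b N'_def in auto)
  \<comment> \<open>Parts on the far side of their own cut, that is, below an outer end and in
    \<open>T\<close> or below an inner end and not in \<open>T\<close>, have red edges only to parts
    on the same side of the cut. Hence a red edge leaving \<open>N'\<close> lies below one leaving
    \<open>N\<close>.\<close>
  have bd: "(coarse s a, coarse s b) \<in> ?B" if ab: "(a, b) \<in> boundary s N'" for a b
  proof -
    note abP = boundaryD(4,5)[OF ab] and rab = boundaryD(3)[OF ab]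
    have aN: "a \<notin> N'" and bN: "b \<in> N'" using boundaryD(1,2)[OF ab] by auto
    note ca = coarse[OF abP(1)] and cb = coarse[OF abP(2)]
    have up: "red (Suc s) (coarse s a) (coarse s b)" if "coarse s a \<noteq> coarse s b"
      using red_coarser[OF rab ca(2) cb(2) ca(1) cb(1) that] .
    have a_dom: "coarse s b \<in> {x, y}"
      if b2: "(x, y) \<in> ?B" "coarse s a = y" for x y
    proof -
      have "a \<notin> T (x, y)" using mem_end[OF b2(1) abP(1)] aN b2(2) by simp
      then have "b \<subseteq> x \<union> y" using refines_right1[OF T[OF b2(1)] _ _ rab] ca(2) b2(2) by simp
      then show ?thesis using subset_two_parts[OF abP(2) boundaryD(4,5)[OF b2(1)]] by simp
    qed
    show ?thesis
    proof (cases "coarse s b \<in> Domain ?B")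
      case True
      then obtain y where b1: "(coarse s b, y) \<in> ?B" by auto
      have "b \<in> T (coarse s b, y)" using mem_end[OF b1 abP(2)] bN by simp
      then have "a \<in> T (coarse s b, y)"
        using refines_left[OF T[OF b1] _ cb(2) red_sym[OF rab]] by simp
      then show ?thesis using aN b1 unfolding N'_def by auto
    next
      case notdom: False
      show ?thesis
      proof (cases "coarse s b \<in> Range ?B")
        case True
        then obtain x where b1: "(x, coarse s b) \<in> ?B" by auto
        have bT: "b \<in> T (x, coarse s b)" using mem_end[OF b1 abP(2)] bN by simp
        have ne: "coarse s a \<noteq> coarse s b"
        proof
          assume eq: "coarse s a = coarse s b"
          have "a \<notin> T (x, coarse s b)" using mem_end[OF b1 abP(1)] aN eq by simp
          then have "b \<notin> T (x, coarse s b)"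
            using refines_right2[OF T[OF b1] _ _ rab] ca(2) eq by simp
          then show False using bT by simp
        qed
        show ?thesis
        proof (cases "coarse s a \<in> N")
          case False
          then show ?thesis using boundaryI[OF up[OF ne]] boundaryD(2)[OF b1] by simp
        next
          case True
          then have "coarse s a \<in> Range ?B"
            using mem_other[OF abP(1)] aN boundaryD(1) by blast
          then obtain x2 where b2: "(x2, coarse s a) \<in> ?B" by auto
          have "coarse s b = x2" using a_dom[OF b2] ne by auto
          then show ?thesis using notdom b2 by auto
        qed
      next
        case notran: False
        then have bin: "coarse s b \<in> N" using mem_other[OF abP(2) notdom] bN by simp
        have ne: "coarse s a \<noteq> coarse s b"
          using mem_other[OF abP(1)] mem_other[OF abP(2)] notdom notran aN bN by auto
        show ?thesis
        proof (cases "coarse s a \<in> N")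
          case False
          then show ?thesis using boundaryI[OF up[OF ne]] bin by simp
        next
          case True
          then have "coarse s a \<in> Range ?B"
            using mem_other[OF abP(1)] aN boundaryD(1) by blast
          then obtain x2 where b2: "(x2, coarse s a) \<in> ?B" by auto
          have "coarse s b = x2" using a_dom[OF b2] ne by auto
          then show ?thesis using notdom b2 by auto
        qed
      qed
    qed
  qed
  have uniq: "a = a' \<and> b = b'"
    if "(a, b) \<in> boundary s N'" "(a', b') \<in> boundary s N'"
      "coarse s a = coarse s a'" "coarse s b = coarse s b'" for a b a' b'
  proof (rule red_below_inner[OF cut_inner[OF segment_cut[OF seg bd[OF that(1)]]]])
    show "a \<subseteq> coarse s a" "b \<subseteq> coarse s b" using coarse boundaryD(4,5)[OF that(1)] by auto
    show "a' \<subseteq> coarse s a" "b' \<subseteq> coarse s b"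
      using coarse boundaryD(4,5)[OF that(2)] that(3,4) by auto
  qed (use boundaryD(3) that in auto)
  have "segment s N' W"
  proof (rule segmentI)
    show "N' \<subseteq> P s" by (rule N'P)
    show "W \<subseteq> pverts G" by (rule segment_verts[OF seg])
    have "card (boundary s N') \<le> card ?B"
    proof (rule card_inj_on_le)
      show "inj_on (map_prod (coarse s) (coarse s)) (boundary s N')"
      proof (rule inj_onI)
        fix u v
        assume "u \<in> boundary s N'" "v \<in> boundary s N'"
          and "map_prod (coarse s) (coarse s) u = map_prod (coarse s) (coarse s) v"
        then show "u = v"
          using uniq[of "fst u" "snd u" "fst v" "snd v"] by (simp add: prod_eq_iff)
      qed
      show "map_prod (coarse s) (coarse s) ` boundary s N' \<subseteq> ?B" using bd by auto
    qed (rule finite_boundary)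
    then show "card (boundary s N') \<le> 2" using segment_card[OF seg] by simp
    show "y = y'" if "(x, y) \<in> boundary s N'" "(x, y') \<in> boundary s N'" for x y y'
      using uniq[OF that] segment_match_left[OF seg bd[OF that(1)] bd[OF that(2)]] by simp
    show "x = x'" if "(x, y) \<in> boundary s N'" "(x', y) \<in> boundary s N'" for x x' y
      using uniq[OF that] segment_match_right[OF seg bd[OF that(1)] bd[OF that(2)]] by simp
    show "cut s a b (W \<inter> (a \<union> b))" if ab: "(a, b) \<in> boundary s N'" for a b
    proof -
      let ?x = "coarse s a" and ?y = "coarse s b"
      note abP = boundaryD(4,5)[OF ab]
      have sub: "a \<subseteq> ?x" "b \<subseteq> ?y" using coarse abP by auto
      have "cut s a b (W \<inter> (?x \<union> ?y) \<inter> (a \<union> b))"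
      proof (rule refines_cut[OF T[OF bd[OF ab]] _ _ sub boundaryD(3)[OF ab]])
        show "b \<in> T (?x, ?y)" using mem_end[OF bd[OF ab] abP(2)] boundaryD(2)[OF ab] by simp
        show "a \<notin> T (?x, ?y)" using mem_end[OF bd[OF ab] abP(1)] boundaryD(1)[OF ab] by simp
      qed
      moreover have "W \<inter> (?x \<union> ?y) \<inter> (a \<union> b) = W \<inter> (a \<union> b)" using sub by auto
      ultimately show ?thesis by simp
    qed
    show "p \<subseteq> W" if p: "p \<in> N'" "p \<notin> Range (boundary s N')" for p
    proof -
      have pP: "p \<in> P s" using p N'P by auto
      show ?thesis
      proof (cases "coarse s p \<in> Domain ?B \<or> coarse s p \<in> Range ?B")
        case False
        then have "coarse s p \<in> N" using mem_other[OF pP] p(1) by simp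
        then have "coarse s p \<subseteq> W" using segment_in[OF seg] False by simp
        then show ?thesis using coarse(2)[OF pP] by simp
      next
        case True
        then obtain x y where b: "(x, y) \<in> ?B" "coarse s p \<in> {x, y}" by auto
        have "p \<subseteq> W \<inter> (x \<union> y)"
        proof (rule refines_in[OF T[OF b(1)]])
          show "p \<in> T (x, y)" using mem_end[OF b(1) pP b(2)] p(1) by simp
          show "\<not> red s q p" if q: "q \<notin> T (x, y)" "q \<subseteq> x" for q
          proof
            assume r: "red s q p"
            then have qP: "q \<in> P s" using red_parts by simp
            then have "coarse s q = x" using coarse_eq[OF qP boundaryD(4)[OF b(1)] q(2)] by simp
            then have "q \<notin> N'" using mem_end[OF b(1) qP] q(1) by simp
            then show False using boundaryI[OF r _ p(1)] p(2) by auto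
          qed
        qed
        then show ?thesis by auto
      qed
    qed
    show "p \<inter> W = {}" if p: "p \<in> P s" "p \<notin> N'" "p \<notin> Domain (boundary s N')" for p
    proof (cases "coarse s p \<in> Domain ?B \<or> coarse s p \<in> Range ?B")
      case False
      then have "coarse s p \<notin> N" using mem_other[OF p(1)] p(2) by simp
      then have "coarse s p \<inter> W = {}"
        using segment_out[OF seg coarse(1)[OF p(1)]] False by simp
      then show ?thesis using coarse(2)[OF p(1)] by auto
    next
      case True
      then obtain x y where b: "(x, y) \<in> ?B" "coarse s p \<in> {x, y}" by auto
      have sub: "p \<subseteq> x \<union> y" using coarse(2)[OF p(1)] b(2) by auto
      have "p \<inter> (W \<inter> (x \<union> y)) = {}"
      proof (rule refines_out[OF T[OF b(1)] p(1) sub])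
        show "p \<notin> T (x, y)" using mem_end[OF b(1) p(1) b(2)] p(2) by simp
        show "\<not> red s p q" if q: "q \<in> T (x, y)" "q \<subseteq> y" for q
        proof
          assume r: "red s p q"
          then have qP: "q \<in> P s" using red_parts by simp
          have "q \<in> N'" using q(1) b(1) unfolding N'_def by auto
          then show False using boundaryI[OF r p(2)] p(3) by auto
        qed
      qed
      then show ?thesis using sub by auto
    qed
  qed
  moreover have "card N' \<le> card N + 3"
  proof -
    have finN: "finite N" using NP finite_parts finite_subset by metis
    have "N' \<subseteq> {p \<in> P s. \<exists>q\<in>N \<union> Domain ?B. p \<subseteq> q}"
    proof
      fix p assume p: "p \<in> N'"
      then have pP: "p \<in> P s" using N'P by auto
      have "coarse s p \<in> N \<union> Domain ?B"
      proof (cases "coarse s p \<in> Domain ?B \<or> coarse s p \<in> Range ?B")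
        case True
        then show ?thesis using boundaryD(2) by blast
      next
        case False
        then show ?thesis using mem_other[OF pP] p by simp
      qed
      then show "p \<in> {p \<in> P s. \<exists>q\<in>N \<union> Domain ?B. p \<subseteq> q}" using pP coarse(2)[OF pP] by blast
    qed
    then have "card N' \<le> card {p \<in> P s. \<exists>q\<in>N \<union> Domain ?B. p \<subseteq> q}"
      using finite_parts by (intro card_mono) auto
    also have "\<dots> \<le> Suc (card (N \<union> Domain ?B))"
      using NP boundaryD(4) by (intro card_finer_parts) auto
    also have "card (N \<union> Domain ?B) \<le> card N + card (Domain ?B)" by (rule card_Un_le)
    also have "card (Domain ?B) \<le> card ?B"
      unfolding Domain_fst by (rule card_image_le[OF finite_boundary])
    also have "\<dots> \<le> 2" by (rule segment_card[OF seg])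
    finally show ?thesis by simp
  qed
  ultimately show ?thesis by blast
qed

section \<open>Splitting segments\<close>

text \<open>The edges in \<open>C\<close> become boundary pairs of both halves, with complementary
  cuts by \<open>cut_sym\<close>. Since \<open>C\<close> is a matching that avoids the old boundary,
  no part lies at two cuts, and \<open>W1\<close> can be chosen separately on every part.\<close>

lemma segment_split:
  assumes seg: "segment s N W" and N: "N1 \<union> N2 = N" "N1 \<inter> N2 = {}"
    and C: "C = {(a, b). a \<in> N2 \<and> b \<in> N1 \<and> red s a b}"
    and inn: "\<And>a b. (a, b) \<in> C \<Longrightarrow> inner s a b"
    and left: "\<And>a b b'. (a, b) \<in> C \<Longrightarrow> (a, b') \<in> C \<Longrightarrow> b = b'"
    and right: "\<And>a a' b. (a, b) \<in> C \<Longrightarrow> (a', b) \<in> C \<Longrightarrow> a = a'"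
    and free: "\<And>a b x. (a, b) \<in> C \<Longrightarrow> (x, a) \<notin> boundary s N \<and> (x, b) \<notin> boundary s N"
    and card: "card (boundary s N1) \<le> 2" "card (boundary s N2) \<le> 2"
  shows "\<exists>W1 W2. W1 \<union> W2 = W \<and> W1 \<inter> W2 = {} \<and> segment s N1 W1 \<and> segment s N2 W2"
proof -
  let ?B = "boundary s N"
  have NP: "N \<subseteq> P s" by (rule segment_subset[OF seg])
  have bd1: "(x, y) \<in> boundary s N1 \<longleftrightarrow> (x, y) \<in> ?B \<and> y \<in> N1 \<or> (x, y) \<in> C" for x y
    using N red_parts unfolding boundary_def C by auto
  have bd2: "(x, y) \<in> boundary s N2 \<longleftrightarrow> (x, y) \<in> ?B \<and> y \<in> N2 \<or> (y, x) \<in> C" for x y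
    using N red_parts red_sym unfolding boundary_def C by auto
  have CD: "a \<in> N2" "b \<in> N1" "a \<in> P s" "b \<in> P s" if "(a, b) \<in> C" for a b
    using that N NP unfolding C by auto
  define D where "D a b = (SOME D. cut s a b D)" for a b
  have D: "cut s a b (D a b)" if "(a, b) \<in> C" for a b
    unfolding D_def using ex_cut[OF inn[OF that]] by (rule someI_ex)
  \<comment> \<open>The vertices of \<open>p\<close> that go to \<open>W1\<close>, provided that
    they are in \<open>W\<close>: everything for a part of \<open>N1\<close> off \<open>C\<close>
    and for the outer end of an old boundary pair into \<open>N1\<close>; the side \<open>D\<close>
    of the new cut for the ends of an edge in \<open>C\<close>.\<close>
  define sel where "sel p = {w. p \<in> N1 \<and> p \<notin> Field C \<or> (\<exists>y\<in>N1. (p, y) \<in> ?B)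
    \<or> (\<exists>a. (a, p) \<in> C \<and> w \<in> D a p) \<or> (\<exists>b. (p, b) \<in> C \<and> w \<in> D p b)}" for p
  define W1 where "W1 = {w \<in> W. \<exists>p\<in>P s. w \<in> p \<and> w \<in> sel p}"
  have W1: "W1 \<inter> p = W \<inter> p \<inter> sel p" if "p \<in> P s" for p
    unfolding W1_def using parts_eq[OF that] that by auto
  have FC: "p \<in> Field C \<longleftrightarrow> (\<exists>a. (a, p) \<in> C) \<or> (\<exists>b. (p, b) \<in> C)" for p
    unfolding Field_def by auto
  have in1: "W1 \<inter> p = W \<inter> p" if "p \<in> N1" "p \<notin> Field C" for p
  proof -
    have "sel p = UNIV" unfolding sel_def using that by auto
    then show ?thesis using W1[of p] that N NP by auto
  qed
  have in2: "W1 \<inter> p = {}" if "p \<in> N2" "p \<notin> Field C" for p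
  proof -
    have "p \<notin> N1" "p \<in> N" using that N by auto
    then have "sel p = {}" unfolding sel_def using that FC boundaryD(1) by auto
    then show ?thesis using W1[of p] \<open>p \<in> N\<close> NP by auto
  qed
  have out1: "W1 \<inter> x = W \<inter> x" if "(x, y) \<in> ?B" "y \<in> N1" for x y
  proof -
    have "sel x = UNIV" unfolding sel_def using that by auto
    then show ?thesis using W1[OF boundaryD(4)[OF that(1)]] by auto
  qed
  have out2: "W1 \<inter> x = {}" if b: "(x, y) \<in> ?B" "y \<in> N2" for x y
  proof -
    have "x \<notin> N1" "x \<notin> N2" using boundaryD(1)[OF b(1)] N by auto
    moreover have "(x, y') \<notin> ?B" if "y' \<in> N1" for y'
      using segment_match_left[OF seg b(1)] b(2) that N(2) by auto
    ultimately have "sel x = {}" unfolding sel_def using CD by auto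
    then show ?thesis using W1[OF boundaryD(4)[OF b(1)]] by auto
  qed
  have endC: "W1 \<inter> (a \<union> b) = D a b" "W \<inter> (a \<union> b) = a \<union> b" if c: "(a, b) \<in> C" for a b
  proof -
    have nb: "a \<notin> Range ?B" "b \<notin> Range ?B" using free[OF c] by auto
    have "a \<subseteq> W" "b \<subseteq> W"
      using segment_in[OF seg _ nb(1)] segment_in[OF seg _ nb(2)] CD[OF c] N by auto
    then show W: "W \<inter> (a \<union> b) = a \<union> b" by auto
    have ab: "a \<in> N" "b \<in> N" using CD[OF c] N by auto
    have "a \<notin> N1" "b \<notin> N2" using CD[OF c] N by auto
    have nB: "(a, z) \<notin> ?B" "(b, z) \<notin> ?B" for z using boundaryD(1)[of _ z s N] ab by auto
    have "(z, a) \<notin> C" "(b, z) \<notin> C" for z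
      using CD(2)[of z a] CD(1)[of b z] \<open>a \<notin> N1\<close> \<open>b \<notin> N2\<close> by auto
    moreover have "(a, z) \<in> C \<longleftrightarrow> z = b" "(z, b) \<in> C \<longleftrightarrow> z = a" for z
      using left[OF c, of z] right[OF c, of z] c by auto
    moreover have "b \<in> Field C" using c FC by auto
    ultimately have "sel a = D a b" "sel b = D a b"
      unfolding sel_def using nB \<open>a \<notin> N1\<close> by simp_all
    then have "W1 \<inter> a = a \<inter> D a b" "W1 \<inter> b = b \<inter> D a b"
      using W1[OF CD(3)[OF c]] W1[OF CD(4)[OF c]] \<open>a \<subseteq> W\<close> \<open>b \<subseteq> W\<close> by auto
    then show "W1 \<inter> (a \<union> b) = D a b" using cut_subset[OF D[OF c]] by auto
  qed
  have W1W: "W1 \<subseteq> W" unfolding W1_def by auto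
  have "segment s N1 W1"
  proof (rule segmentI)
    show "N1 \<subseteq> P s" using N NP by auto
    show "W1 \<subseteq> pverts G" using W1W segment_verts[OF seg] by auto
    show "card (boundary s N1) \<le> 2" by (rule card(1))
    show "y = y'" if "(x, y) \<in> boundary s N1" "(x, y') \<in> boundary s N1" for x y y'
      using that segment_match_left[OF seg, of x y y'] left[of x y y'] CD(1)[of x] boundaryD(1)[of x _ s N] N(1)
      unfolding bd1 by (metis UnCI)
    show "x = x'" if "(x, y) \<in> boundary s N1" "(x', y) \<in> boundary s N1" for x x' y
      using that segment_match_right[OF seg, of x y x'] right[of x y x'] free[of x y] free[of x' y]
      unfolding bd1 by metis
    show "cut s x y (W1 \<inter> (x \<union> y))" if b: "(x, y) \<in> boundary s N1" for x y
    proof (cases "(x, y) \<in> C")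
      case True
      then show ?thesis using D endC(1) by simp
    next
      case False
      then have b': "(x, y) \<in> ?B" "y \<in> N1" using b bd1 by auto
      have "y \<notin> Field C" using free b'(1) FC by auto
      then have "W1 \<inter> (x \<union> y) = W \<inter> (x \<union> y)"
        using in1[OF b'(2)] out1[OF b'] by auto
      then show ?thesis using segment_cut[OF seg b'(1)] by simp
    qed
    show "p \<subseteq> W1" if p: "p \<in> N1" "p \<notin> Range (boundary s N1)" for p
    proof -
      have "p \<notin> N2" using p N by auto
      have "p \<notin> Field C" using p(2) CD(1)[of p] \<open>p \<notin> N2\<close> unfolding FC Range_iff bd1 by auto
      moreover have "p \<notin> Range ?B" using p unfolding Range_iff bd1 by auto
      then have "p \<subseteq> W" using segment_in[OF seg] p(1) N by auto
      ultimately show ?thesis using in1[OF p(1)] by auto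
    qed
    show "p \<inter> W1 = {}" if p: "p \<in> P s" "p \<notin> N1" "p \<notin> Domain (boundary s N1)" for p
    proof (cases "p \<in> N2")
      case True
      have "p \<notin> Field C" using p CD(2)[of _ p] unfolding FC Domain_iff bd1 by auto
      then show ?thesis using in2[OF True] by auto
    next
      case notin: False
      then have pN: "p \<notin> N" using p(2) N by auto
      show ?thesis
      proof (cases "p \<in> Domain ?B")
        case True
        then obtain y where y: "(p, y) \<in> ?B" by auto
        then have "y \<in> N2" using p(3) boundaryD(2)[OF y] N unfolding Domain_iff bd1 by auto
        then show ?thesis using out2[OF y] by auto
      next
        case False
        then show ?thesis using segment_out[OF seg p(1) pN] W1W by auto
      qed
    qed
  qed
  moreover have "segment s N2 (W - W1)"
  proof (rule segmentI)
    show "N2 \<subseteq> P s" using N NP by auto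
    show "W - W1 \<subseteq> pverts G" using segment_verts[OF seg] by auto
    show "card (boundary s N2) \<le> 2" by (rule card(2))
    show "y = y'" if "(x, y) \<in> boundary s N2" "(x, y') \<in> boundary s N2" for x y y'
      using that segment_match_left[OF seg, of x y y'] right[of y x y'] CD(2)[of _ x] boundaryD(1)[of x _ s N] N(1)
      unfolding bd2 by (metis UnCI)
    show "x = x'" if "(x, y) \<in> boundary s N2" "(x', y) \<in> boundary s N2" for x x' y
      using that segment_match_right[OF seg, of x y x'] left[of y x x'] free[of y x] free[of y x']
      unfolding bd2 by metis
    show "cut s x y ((W - W1) \<inter> (x \<union> y))" if b: "(x, y) \<in> boundary s N2" for x y
    proof (cases "(y, x) \<in> C")
      case True
      have "(W - W1) \<inter> (x \<union> y) = y \<union> x - D y x" using endC[OF True] by auto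
      then show ?thesis using cut_sym[OF D[OF True]] by simp
    next
      case False
      then have b': "(x, y) \<in> ?B" "y \<in> N2" using b bd2 by auto
      have "y \<notin> Field C" using free b'(1) FC by auto
      then have "(W - W1) \<inter> (x \<union> y) = W \<inter> (x \<union> y)"
        using in2[OF b'(2)] out2[OF b'] by auto
      then show ?thesis using segment_cut[OF seg b'(1)] by simp
    qed
    show "p \<subseteq> W - W1" if p: "p \<in> N2" "p \<notin> Range (boundary s N2)" for p
    proof -
      have "p \<notin> N1" using p N by auto
      have "p \<notin> Field C" using p(2) CD(2)[of _ p] \<open>p \<notin> N1\<close> unfolding FC Range_iff bd2 by auto
      moreover have "p \<notin> Range ?B" using p unfolding Range_iff bd2 by auto
      then have "p \<subseteq> W" using segment_in[OF seg] p(1) N by auto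
      ultimately show ?thesis using in2[OF p(1)] by auto
    qed
    show "p \<inter> (W - W1) = {}" if p: "p \<in> P s" "p \<notin> N2" "p \<notin> Domain (boundary s N2)" for p
    proof (cases "p \<in> N1")
      case True
      have "p \<notin> Field C" using p CD(1)[of p] unfolding FC Domain_iff bd2 by auto
      then show ?thesis using in1[OF True] by auto
    next
      case notin: False
      then have pN: "p \<notin> N" using p(2) N by auto
      show ?thesis
      proof (cases "p \<in> Domain ?B")
        case True
        then obtain y where y: "(p, y) \<in> ?B" by auto
        then have "y \<in> N1" using p(3) boundaryD(2)[OF y] N unfolding Domain_iff bd2 by auto
        then show ?thesis using out1[OF y] by auto
      next
        case False
        then show ?thesis using segment_out[OF seg p(1) pN] by auto
      qed
    qed
  qed
  ultimately show ?thesis using W1W by (intro exI[of _ W1] exI[of _ "W - W1"]) auto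
qed

lemma segment_split_closed:
  assumes seg: "segment s N W" and N1: "N1 \<subseteq> N"
    and closed: "\<And>a b. b \<in> N1 \<Longrightarrow> a \<in> N \<Longrightarrow> red s b a \<Longrightarrow> a \<in> N1"
  shows "\<exists>W1 W2. W1 \<union> W2 = W \<and> W1 \<inter> W2 = {} \<and> segment s N1 W1 \<and> segment s (N - N1) W2"
proof (rule segment_split[OF seg, of N1 "N - N1" "{}"])
  show "{} = {(a, b). a \<in> N - N1 \<and> b \<in> N1 \<and> red s a b}" using closed red_sym by auto
  have "boundary s N1 \<subseteq> boundary s N" "boundary s (N - N1) \<subseteq> boundary s N"
    using N1 closed red_sym unfolding boundary_def by auto
  then show "card (boundary s N1) \<le> 2" "card (boundary s (N - N1)) \<le> 2"
    using segment_card[OF seg] card_mono[OF finite_boundary] order_trans by blast+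
qed (use N1 in auto)

definition splits :: "nat \<Rightarrow> 'a set set \<Rightarrow> 'a set \<Rightarrow> bool" where
  "splits s N W \<longleftrightarrow> (\<exists>N1 W1 W2. N1 \<subset> N \<and> N1 \<noteq> {} \<and> W1 \<union> W2 = W \<and> W1 \<inter> W2 = {}
     \<and> segment s N1 W1 \<and> segment s (N - N1) W2)"

lemma splitsI:
  assumes "N1 \<subset> N" "N1 \<noteq> {}"
    and "\<exists>W1 W2. W1 \<union> W2 = W \<and> W1 \<inter> W2 = {} \<and> segment s N1 W1 \<and> segment s (N - N1) W2"
  shows "splits s N W"
  unfolding splits_def using assms by metis

lemma splits_closed:
  assumes "segment s N W" "N1 \<subset> N" "N1 \<noteq> {}"
    and "\<And>a b. b \<in> N1 \<Longrightarrow> a \<in> N \<Longrightarrow> red s b a \<Longrightarrow> a \<in> N1"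
  shows "splits s N W"
  using assms by (intro splitsI[of N1] segment_split_closed) auto

lemma psubset_if_card_less: "A \<subseteq> B \<Longrightarrow> card A < card B \<Longrightarrow> A \<subset> B"
  by auto

lemma red_nbrs_eq:
  assumes "red s p a" "red s p b" "a \<noteq> b"
  shows "red_nbrs s p = {a, b}"
proof -
  have sub: "{a, b} \<subseteq> red_nbrs s p" using assms unfolding red_nbrs_def by auto
  have "card (red_nbrs s p) \<le> card {a, b}" using card_red_nbrs_le[of s p] assms(3) by simp
  from card_seteq[OF finite_red_nbrs sub this] show ?thesis by simp
qed

text \<open>Splits off the first two or three parts of a red path starting at \<open>v\<close>.\<close>

lemma splits_path:
  assumes seg: "segment s N W" and card: "4 \<le> card N"
    and vu: "v \<in> N" "u \<in> N" "red s v u" "\<And>z. z \<in> N \<Longrightarrow> red s v z \<Longrightarrow> z = u"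
    and start: "boundary s N = {} \<or> v \<in> Range (boundary s N)"
  shows "splits s N W"
proof -
  let ?B = "boundary s N"
  have irr: "\<not> red s p p" for p using red_parts by blast
  have "v \<noteq> u" using vu(3) irr by auto
  have uv: "red s u v" using red_sym[OF vu(3)] .
  have lt2: "{v, u} \<subset> N"
    using vu(1,2) card by (intro psubset_if_card_less) (auto simp: card_insert_if)
  have lt3: "{v, u, a} \<subset> N" if "a \<in> N" for a
  proof (rule psubset_if_card_less)
    have "card {v, u, a} \<le> 3" by (simp add: card_insert_if)
    then show "card {v, u, a} < card N" using card by simp
  qed (use vu(1,2) that in auto)
  show ?thesis
  proof (cases "\<exists>a\<in>N. a \<noteq> v \<and> red s u a")
    case False
    then have "a \<in> {v, u}" if "b \<in> {v, u}" "a \<in> N" "red s b a" for a b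
      using that vu(4) by (metis insertE insertI1 insertI2 singletonD)
    then show ?thesis
      by (rule splits_closed[OF seg lt2, rotated]) auto
  next
    case True
    then obtain a where a: "a \<in> N" "a \<noteq> v" "red s u a" by auto
    have "a \<noteq> u" using a(3) irr by auto
    have nu: "red_nbrs s u = {v, a}" using red_nbrs_eq[OF uv a(3)] a(2) by auto
    then have nu': "z = v \<or> z = a" if "red s u z" for z using that unfolding red_nbrs_def by auto
    show ?thesis
    proof (cases "\<exists>z\<in>N. z \<noteq> u \<and> red s a z")
      case False
      then have "x \<in> {v, u, a}" if "b \<in> {v, u, a}" "x \<in> N" "red s b x" for x b
        using that vu(4) nu' by (metis insertE insertI1 insertI2 singletonD)
      then show ?thesis
        by (rule splits_closed[OF seg lt3[OF a(1)], rotated]) auto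
    next
      case True
      then obtain z where z: "z \<in> N" "z \<noteq> u" "red s a z" by auto
      have na: "red_nbrs s a = {u, z}" using red_nbrs_eq[OF red_sym[OF a(3)] z(3)] z(2) by auto
      then have na': "y = u \<or> y = z" if "red s a y" for y using that unfolding red_nbrs_def by auto
      \<comment> \<open>The edge \<open>vu\<close> itself may be unsuitable for a cut:
        \<open>v\<close> can have red degree 1 or be at a boundary pair already. The next edge has
        both ends of red degree 2 with all red neighbours in \<open>N\<close>, hence no boundary
        pair at its ends.\<close>
      have inn: "inner s a u"
        unfolding inner_def using red_sym[OF a(3)] na nu a(2) z(2) by auto
      have C: "{(a, u)} = {(p, q). p \<in> N - {v, u} \<and> q \<in> {v, u} \<and> red s p q}"
      proof (rule equalityI)
        show "{(a, u)} \<subseteq> {(p, q). p \<in> N - {v, u} \<and> q \<in> {v, u} \<and> red s p q}"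
          using a(1,2) \<open>a \<noteq> u\<close> red_sym[OF a(3)] by simp
        show "{(p, q). p \<in> N - {v, u} \<and> q \<in> {v, u} \<and> red s p q} \<subseteq> {(a, u)}"
        proof
          fix e assume mem: "e \<in> {(p, q). p \<in> N - {v, u} \<and> q \<in> {v, u} \<and> red s p q}"
          obtain p q where e: "e = (p, q)" by (cases e)
          have "p \<in> N" "p \<noteq> v" "p \<noteq> u" "q = v \<or> q = u" "red s q p"
            using mem red_sym[of s p q] unfolding e by simp_all
          then show "e \<in> {(a, u)}" unfolding e using vu(4)[of p] nu'[of p] by auto
        qed
      qed
      obtain x0 where x0: "\<And>x. (x, v) \<in> ?B \<Longrightarrow> x = x0" "?B = {} \<or> (x0, v) \<in> ?B"
        using start segment_match_right[OF seg] by (metis Range.cases empty_iff)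
      have b1: "boundary s {v, u} \<subseteq> {(x0, v), (a, u)}"
      proof
        fix e assume "e \<in> boundary s {v, u}"
        then obtain p q where e: "e = (p, q)" "p \<noteq> v" "p \<noteq> u" "q = v \<or> q = u" "red s p q"
          unfolding boundary_def by auto
        show "e \<in> {(x0, v), (a, u)}"
        proof (cases "q = u")
          case True
          then show ?thesis using e nu' red_sym by blast
        next
          case False
          then have "q = v" using e by auto
          then have "p \<notin> N" using e(3,5) vu(4) red_sym by blast
          then have "(p, v) \<in> ?B" using e(5) \<open>q = v\<close> vu(1) boundaryI by auto
          then show ?thesis using x0(1) e(1) \<open>q = v\<close> by auto
        qed
      qed
      have b2: "boundary s (N - {v, u}) \<subseteq> insert (u, a) (?B - {(x0, v)})"
      proof
        fix e assume "e \<in> boundary s (N - {v, u})"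
        then obtain p q where e: "e = (p, q)" "p \<notin> N \<or> p = v \<or> p = u" "q \<in> N" "q \<noteq> v" "q \<noteq> u" "red s p q"
          unfolding boundary_def by auto
        show "e \<in> insert (u, a) (?B - {(x0, v)})"
        proof (cases "p \<in> N")
          case False
          then show ?thesis using boundaryI[OF e(6) _ e(3)] e(1,4) by simp
        next
          case True
          have "p \<noteq> v" using vu(4)[OF e(3)] e(5,6) by metis
          then have "p = u" using e(2) True by simp
          then have "q = a" using nu'[of q] e(4,6) by simp
          then show ?thesis using e(1) \<open>p = u\<close> by simp
        qed
      qed
      have "\<exists>W1 W2. W1 \<union> W2 = W \<and> W1 \<inter> W2 = {} \<and> segment s {v, u} W1 \<and> segment s (N - {v, u}) W2"
      proof (rule segment_split[OF seg _ _ C])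
        show "{v, u} \<union> (N - {v, u}) = N" using vu(1,2) by auto
        have "card (boundary s {v, u}) \<le> card {(x0, v), (a, u)}" by (rule card_mono[OF _ b1]) simp
        then show "card (boundary s {v, u}) \<le> 2" using \<open>v \<noteq> u\<close> by simp
        have fin: "finite (?B - {(x0, v)})" using finite_boundary by simp
        have "card (boundary s (N - {v, u})) \<le> card (insert (u, a) (?B - {(x0, v)}))"
          by (rule card_mono[OF _ b2]) (use fin in simp)
        also have "\<dots> \<le> Suc (card (?B - {(x0, v)}))" by (rule card_insert_le_m1[THEN order_trans]) auto
        \<comment> \<open>A boundary pair at \<open>v\<close> goes to \<open>{v, u}\<close>, which
          makes room for the new pair \<open>(u, a)\<close>; this is the purpose of the assumption
          \<open>start\<close>.\<close>
        also have "card (?B - {(x0, v)}) \<le> 1"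
          using x0(2) segment_card[OF seg] finite_boundary[of s N] by auto
        finally show "card (boundary s (N - {v, u})) \<le> 2" by simp
        show "(x, p) \<notin> ?B \<and> (x, q) \<notin> ?B" if "(p, q) \<in> {(a, u)}" for p q x
        proof
          show "(x, p) \<notin> ?B"
          proof
            assume b: "(x, p) \<in> ?B"
            then have "x = u \<or> x = z" using na'[OF red_sym] boundaryD(3)[OF b] that by simp
            then show False using boundaryD(1)[OF b] vu(2) z(1) by auto
          qed
          show "(x, q) \<notin> ?B"
          proof
            assume b: "(x, q) \<in> ?B"
            then have "x = v \<or> x = a" using nu'[OF red_sym] boundaryD(3)[OF b] that by simp
            then show False using boundaryD(1)[OF b] vu(1) a(1) by auto
          qed
        qed
        show "inner s p q" if "(p, q) \<in> {(a, u)}" for p q using that inn by simp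
      qed simp_all
      with lt2 show ?thesis by (intro splitsI) simp_all
    qed
  qed
qed

text \<open>A red path in \<open>N\<close> is entered at an end: at a boundary part or, if the
  boundary is empty, at a part of red degree at most 1. If there is neither, \<open>N\<close>
  consists of whole red cycles; a triangle is split off as it is, and a longer cycle is cut at two
  edges.\<close>

lemma splits_if_card_ge_4:
  assumes seg: "segment s N W" and card: "4 \<le> card N"
  shows "splits s N W"
proof (cases "boundary s N = {}")
  case False
  then obtain x v where b: "(x, v) \<in> boundary s N" by auto
  obtain u where u: "red_nbrs s v = {x, u}" "u \<noteq> x"
    using inner_other_nbr[OF cut_inner[OF segment_cut[OF seg b]]] .
  then have vu: "red s v u" and nv: "\<And>z. red s v z \<Longrightarrow> z = x \<or> z = u" unfolding red_nbrs_def by auto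
  \<comment> \<open>Otherwise \<open>(u, v)\<close> would be a second boundary pair at
    \<open>v\<close>.\<close>
  have "u \<in> N"
    using boundaryI[OF red_sym[OF vu] _ boundaryD(2)[OF b]] segment_match_right[OF seg b] u(2) by auto
  then show ?thesis
    using splits_path[OF seg card boundaryD(2)[OF b] _ vu] nv boundaryD(1)[OF b] b by blast
next
  case B: True
  have nbN: "q \<in> N" if "p \<in> N" "red s p q" for p q
    using boundaryI[OF red_sym[OF that(2)] _ that(1)] B by auto
  have lt: "A \<subset> N" if "A \<subseteq> N" "card A \<le> 3" for A
    using that card by (intro psubset_if_card_less) auto
  show ?thesis
  proof (cases "\<exists>v\<in>N. card (red_nbrs s v) < 2")
    case True
    then obtain v where v: "v \<in> N" "card (red_nbrs s v) < 2" by auto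
    then consider "red_nbrs s v = {}" | u where "red_nbrs s v = {u}"
      using finite_red_nbrs[of s v] by (metis One_nat_def card_0_eq card_1_singletonE less_2_cases)
    then show ?thesis
    proof cases
      case 1
      show ?thesis
        by (rule splits_closed[OF seg lt, of "{v}"]) (use v(1) 1 red_nbrs_def in auto)
    next
      case (2 u)
      then have "red s v u" "\<And>z. red s v z \<Longrightarrow> z = u" unfolding red_nbrs_def by auto
      then show ?thesis using splits_path[OF seg card v(1)] nbN[OF v(1)] B by blast
    qed
  next
    case False
    then have two: "card (red_nbrs s p) = 2" if "p \<in> N" for p
      using that card_red_nbrs_le[of s p] by force
    have irr: "\<not> red s p p" for p using red_parts by blast
    obtain v where v: "v \<in> N" using card by fastforce
    obtain u v' where nv: "red_nbrs s v = {u, v'}" "u \<noteq> v'" using two[OF v] unfolding card_2_iff by auto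
    then have rv: "red s v u" "red s v v'" and rv': "\<And>z. red s v z \<Longrightarrow> z = u \<or> z = v'"
      unfolding red_nbrs_def by auto
    have u: "u \<in> N" "v' \<in> N" using nbN[OF v] rv by auto
    have ne: "v \<noteq> u" "v \<noteq> v'" using rv irr by auto
    have "v \<in> red_nbrs s u" using red_sym[OF rv(1)] unfolding red_nbrs_def by simp
    then obtain u' where nu: "red_nbrs s u = {v, u'}" "v \<noteq> u'"
      using two[OF u(1)] unfolding card_2_iff by (metis insertE insert_commute singletonD)
    then have ru: "red s u v" "red s u u'" and ru': "\<And>z. red s u z \<Longrightarrow> z = v \<or> z = u'"
      unfolding red_nbrs_def by auto
    have u': "u' \<in> N" "u' \<noteq> u" using nbN[OF u(1)] ru irr by auto
    show ?thesis
    proof (cases "u' = v'")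
      case True
      have "red_nbrs s v' = {v, u}"
        using red_nbrs_eq[OF red_sym[OF rv(2)] _ ne(1)] red_sym[OF ru(2)] True by simp
      then have rw: "\<And>z. red s v' z \<Longrightarrow> z = v \<or> z = u" unfolding red_nbrs_def by auto
      have "card {v, u, v'} \<le> 3" by (simp add: card_insert_if)
      then show ?thesis
      proof (intro splits_closed[OF seg lt, of "{v, u, v'}"])
        show "a \<in> {v, u, v'}" if "b \<in> {v, u, v'}" "red s b a" for a b
          using that rv' ru' rw True by (metis insertE insertI1 insertI2 singletonD)
      qed (use v u in auto)
    next
      case ne': False
      \<comment> \<open>On a cycle of length at least 4 the consecutive parts \<open>v\<close> and
        \<open>u\<close> are cut out. Both cuts become boundary pairs of either half, which the
        bound 2 permits because the old boundary is empty; they form a matching because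
        \<open>u'\<close> and \<open>v'\<close> differ.\<close>
      have C: "{(v', v), (u', u)} = {(p, q). p \<in> N - {v, u} \<and> q \<in> {v, u} \<and> red s p q}"
      proof (rule equalityI)
        show "{(v', v), (u', u)} \<subseteq> {(p, q). p \<in> N - {v, u} \<and> q \<in> {v, u} \<and> red s p q}"
          using u u' ne nu(2) nv(2) red_sym[OF rv(2)] red_sym[OF ru(2)] by auto
        show "{(p, q). p \<in> N - {v, u} \<and> q \<in> {v, u} \<and> red s p q} \<subseteq> {(v', v), (u', u)}"
        proof
          fix e assume mem: "e \<in> {(p, q). p \<in> N - {v, u} \<and> q \<in> {v, u} \<and> red s p q}"
          obtain p q where e: "e = (p, q)" by (cases e)
          have "p \<noteq> v" "p \<noteq> u" "q = v \<or> q = u" "red s q p"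
            using mem red_sym[of s p q] unfolding e by simp_all
          then show "e \<in> {(v', v), (u', u)}" unfolding e using rv'[of p] ru'[of p] by auto
        qed
      qed
      have b1: "boundary s {v, u} \<subseteq> {(v', v), (u', u)}"
        unfolding C using nbN v u(1) red_sym unfolding boundary_def by blast
      have b2: "boundary s (N - {v, u}) \<subseteq> {(v, v'), (u, u')}"
      proof
        fix e assume "e \<in> boundary s (N - {v, u})"
        then obtain p q where e: "e = (p, q)" "p \<notin> N \<or> p = v \<or> p = u" "q \<in> N" "q \<noteq> v" "q \<noteq> u" "red s p q"
          unfolding boundary_def by auto
        then have "p \<in> N" using nbN red_sym by blast
        then show "e \<in> {(v, v'), (u, u')}" using e rv' ru' by blast
      qed
      have "\<exists>W1 W2. W1 \<union> W2 = W \<and> W1 \<inter> W2 = {} \<and> segment s {v, u} W1 \<and> segment s (N - {v, u}) W2"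
      proof (rule segment_split[OF seg _ _ C])
        show "{v, u} \<union> (N - {v, u}) = N" using v u by auto
        show "card (boundary s {v, u}) \<le> 2"
          using card_mono[OF _ b1] by (simp add: card_insert_if split: if_splits)
        show "card (boundary s (N - {v, u})) \<le> 2"
          using card_mono[OF _ b2] by (simp add: card_insert_if split: if_splits)
        have "inner s v' v" "inner s u' u"
          unfolding inner_def using two v u u'(1) red_sym[OF rv(2)] red_sym[OF ru(2)] by simp_all
        then show "inner s p q" if "(p, q) \<in> {(v', v), (u', u)}" for p q
          using that by (elim insertE) simp_all
        show "q = q'" if "(p, q) \<in> {(v', v), (u', u)}" "(p, q') \<in> {(v', v), (u', u)}" for p q q'
          using that ne' by (elim insertE) simp_all
        show "p = p'" if "(p, q) \<in> {(v', v), (u', u)}" "(p', q) \<in> {(v', v), (u', u)}" for p p' q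
          using that ne(1) by (elim insertE) simp_all
      qed (simp_all add: B)
      moreover have "{v, u} \<subset> N"
      proof (rule lt)
        show "{v, u} \<subseteq> N" using v u(1) by simp
        show "card {v, u} \<le> 3" by (simp add: card_insert_if)
      qed
      ultimately show ?thesis by (intro splitsI) simp_all
    qed
  qed
qed

text \<open>The assumption \<open>small\<close> stands for the induction over time, which is thus
  kept apart from the induction over the number of parts. Sets described by at least 4 parts are
  split until 3 parts suffice.\<close>

lemma decomposable_up_to_6:
  assumes free: "\<not> semi_induced_half_graph t G" and k: "16 * t + 42 \<le> k"
    and small: "\<And>N W. segment s N W \<Longrightarrow> card N \<le> 3 \<Longrightarrow> W = {} \<or> decomposable G k W"
    and "segment s N W" "card N \<le> 6"
  shows "W = {} \<or> decomposable G k W"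
  using assms(4,5)
proof (induction "card N" arbitrary: N W rule: less_induct)
  case less
  show ?case
  proof (cases "card N \<le> 3")
    case True
    then show ?thesis using small less.prems by blast
  next
    case False
    then have "splits s N W" using splits_if_card_ge_4[OF less.prems(1)] by simp
    then obtain N1 W1 W2 where *: "N1 \<subset> N" "N1 \<noteq> {}" "W1 \<union> W2 = W" "W1 \<inter> W2 = {}"
      "segment s N1 W1" "segment s (N - N1) W2"
      unfolding splits_def by auto
    have fin: "finite N" using segment_subset[OF less.prems(1)] finite_parts finite_subset by metis
    have lt: "card N1 < card N" "card (N - N1) < card N"
    proof -
      show "card N1 < card N" by (rule psubset_card_mono[OF fin *(1)])
      have "N - N1 \<noteq> N" using *(1,2) by blast
      then have "N - N1 \<subset> N" by (simp add: psubset_eq)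
      then show "card (N - N1) < card N" by (rule psubset_card_mono[OF fin])
    qed
    have 1: "W1 = {} \<or> decomposable G k W1"
      using less.hyps[OF lt(1) *(5)] lt less.prems(2) by simp
    have 2: "W2 = {} \<or> decomposable G k W2"
      using less.hyps[OF lt(2) *(6)] lt less.prems(2) by simp
    have "row_count G W (pverts G - W) \<le> k"
      using segment_row_count_le[OF less.prems free] k by simp
    then show ?thesis
      using 1 2 decomposable.join[of G k W1 W2] * by auto
  qed
qed

text \<open>At time 0 the parts are single vertices, so \<open>W\<close> has at most 3 of them. A
  step back in time leaves \<open>W\<close> unchanged but may need 6 parts to describe it, and
  \<open>decomposable_up_to_6\<close> returns to 3.\<close>

lemma decomposable_segment:
  assumes free: "\<not> semi_induced_half_graph t G" and k: "16 * t + 42 \<le> k"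
  shows "segment s N W \<Longrightarrow> card N \<le> 3 \<Longrightarrow> W = {} \<or> decomposable G k W"
proof (induction s arbitrary: N W)
  case 0
  have B: "boundary 0 N = {}" using not_red_0 unfolding boundary_def by simp
  have N0: "N \<subseteq> P 0" and WV: "W \<subseteq> pverts G"
    using segment_subset[OF 0(1)] segment_verts[OF 0(1)] by auto
  have fin: "finite N" using N0 finite_parts finite_subset by metis
  have "W \<subseteq> \<Union>N"
  proof
    fix w assume w: "w \<in> W"
    then obtain p where p: "p \<in> P 0" "w \<in> p" using WV ex_part by blast
    then have "p \<in> N" using segment_out[OF 0(1) p(1)] B w by auto
    then show "w \<in> \<Union>N" using p by auto
  qed
  moreover have "finite (\<Union>N)" using N0 finite_part fin by blast
  ultimately have "card W \<le> card (\<Union>N)" by (rule card_mono[rotated])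
  also have "\<dots> \<le> sum card N" by (rule card_Union_le_sum_card)
  also have "\<dots> = sum (\<lambda>_. 1) N"
    using N0 unfolding singletons by (intro sum.cong) auto
  finally have "card W \<le> k" using 0(2) k by simp
  then show ?case
    using decomposable_if_small[OF WV] finite_subset[OF WV finite_verts] by blast
next
  case (Suc s)
  obtain N' where N': "segment s N' W" "card N' \<le> card N + 3"
    using segment_refine[OF Suc.prems(1)] by blast
  show ?case
  proof (rule decomposable_up_to_6[OF free k _ N'(1)])
    show "W = {} \<or> decomposable G k W" if "segment s N W" "card N \<le> 3" for N W
      using Suc.IH that by blast
  qed (use N'(2) Suc.prems(2) in simp)
qed

lemma decomposable_verts:
  assumes "\<not> semi_induced_half_graph t G" "16 * t + 42 \<le> k" "card (P n) \<le> 1" "pverts G \<noteq> {}"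
  shows "decomposable G k (pverts G)"
proof -
  have "boundary n (P n) = {}" using red_parts unfolding boundary_def by auto
  then have "segment n (P n) (pverts G)"
    using part_subset by (intro segmentI) auto
  then show ?thesis
    using decomposable_segment[OF assms(1,2)] assms(3,4) by (meson le_trans one_le_numeral)
qed

end

section \<open>Rank-decompositions from binary splittings\<close>

text \<open>Nodes of the tree are represented by the vertex sets below them, so that descent in the
  tree is proper inclusion; \<open>E\<close> leads from a child to its parent. As siblings are
  disjoint and nonempty, the sets determine the nodes.\<close>

inductive binary_family :: "'a set \<Rightarrow> 'a set set \<Rightarrow> ('a set \<times> 'a set) set \<Rightarrow> bool" where
  leaf: "binary_family {v} {{v}} {}"
| join: "binary_family A F E \<Longrightarrow> binary_family B F' E' \<Longrightarrow> A \<inter> B = {} \<Longrightarrow>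
    binary_family (A \<union> B) (insert (A \<union> B) (F \<union> F')) (E \<union> E' \<union> {(A, A \<union> B), (B, A \<union> B)})"

lemma decomposable_binary_family:
  "decomposable G k W \<Longrightarrow>
    \<exists>F E. binary_family W F E \<and> (\<forall>X\<in>F. row_count G X (pverts G - X) \<le> k)"
proof (induction rule: decomposable.induct)
  case (leaf v)
  then show ?case by (intro exI[of _ "{{v}}"] exI[of _ "{}"]) (simp add: binary_family.leaf)
next
  case (join A B)
  then obtain F E F' E' where *: "binary_family A F E" "\<forall>X\<in>F. row_count G X (pverts G - X) \<le> k"
    "binary_family B F' E'" "\<forall>X\<in>F'. row_count G X (pverts G - X) \<le> k"
    by auto
  have "\<forall>X\<in>insert (A \<union> B) (F \<union> F'). row_count G X (pverts G - X) \<le> k"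
    using * join.hyps by auto
  then show ?case using binary_family.join[OF *(1,3) join.hyps(3)] by blast
qed

lemma binary_family_basic:
  assumes "binary_family A F E"
  shows "finite F \<and> A \<in> F \<and> (\<forall>X\<in>F. X \<subseteq> A \<and> X \<noteq> {} \<and> finite X)
    \<and> (\<forall>c p. (c, p) \<in> E \<longrightarrow> c \<in> F \<and> p \<in> F \<and> c \<subset> p) \<and> (\<forall>v\<in>A. {v} \<in> F)"
  using assms
proof (induction rule: binary_family.induct)
  case (leaf v)
  then show ?case by auto
next
  case (join A F E B F' E')
  have ne: "A \<noteq> {}" "B \<noteq> {}" "finite A" "finite B" using join.IH by auto
  have "A \<subset> A \<union> B" "B \<subset> A \<union> B" using ne join.hyps(3) by auto
  note sub = this
  show ?case
  proof (intro conjI allI impI ballI)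
    show "finite (insert (A \<union> B) (F \<union> F'))" "A \<union> B \<in> insert (A \<union> B) (F \<union> F')"
      using join.IH by simp_all
    fix X assume "X \<in> insert (A \<union> B) (F \<union> F')"
    then consider "X = A \<union> B" | "X \<in> F" | "X \<in> F'" by auto
    then show "X \<subseteq> A \<union> B" "X \<noteq> {}" "finite X" by (cases; use join.IH ne in auto)+
  next
    fix c p assume "(c, p) \<in> E \<union> E' \<union> {(A, A \<union> B), (B, A \<union> B)}"
    then consider "(c, p) \<in> E" | "(c, p) \<in> E'" | "c = A" "p = A \<union> B" | "c = B" "p = A \<union> B"
      by auto
    then show "c \<in> insert (A \<union> B) (F \<union> F')" "p \<in> insert (A \<union> B) (F \<union> F')" "c \<subset> p"
      by (cases; use join.IH sub in simp)+
  next
    fix v assume "v \<in> A \<union> B"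
    then show "{v} \<in> insert (A \<union> B) (F \<union> F')" using join.IH by auto
  qed
qed

lemma
  assumes "binary_family A F E"
  shows binary_family_finite: "finite F"
    and binary_family_root: "A \<in> F"
    and binary_family_subset: "X \<in> F \<Longrightarrow> X \<subseteq> A"
    and binary_family_nonempty: "X \<in> F \<Longrightarrow> X \<noteq> {}"
    and binary_family_finite_member: "X \<in> F \<Longrightarrow> finite X"
    and binary_family_arc: "(c, p) \<in> E \<Longrightarrow> c \<in> F \<and> p \<in> F \<and> c \<subset> p"
    and binary_family_singleton: "v \<in> A \<Longrightarrow> {v} \<in> F"
  using binary_family_basic[OF assms] by simp_all

lemma binary_family_not_both:
  assumes "binary_family A F E" "binary_family B F' E'" "A \<inter> B = {}" "X \<in> F" "Y \<in> F'" "X \<subseteq> Y \<or> Y \<subseteq> X"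
  shows False
  using binary_family_subset[OF assms(1,4)] binary_family_subset[OF assms(2,5)]
    binary_family_nonempty[OF assms(1,4)] binary_family_nonempty[OF assms(2,5)] assms(3,6) by auto

lemma binary_family_join_root:
  assumes "binary_family A F E" "binary_family B F' E'" "A \<inter> B = {}"
  shows "A \<union> B \<notin> F" "A \<union> B \<notin> F'" "A \<notin> F'" "B \<notin> F"
proof -
  have ne: "A \<noteq> {}" "B \<noteq> {}"
    using binary_family_nonempty binary_family_root assms(1,2) by blast+
  show "A \<union> B \<notin> F" using binary_family_subset[OF assms(1)] ne assms(3) by blast
  show "A \<union> B \<notin> F'" using binary_family_subset[OF assms(2)] ne assms(3) by blast
  show "A \<notin> F'" using binary_family_subset[OF assms(2)] ne assms(3) by blast
  show "B \<notin> F" using binary_family_subset[OF assms(1)] ne assms(3) by blast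
qed

lemma binary_family_unique_parent:
  assumes "binary_family A F E"
  shows "(c, p) \<in> E \<Longrightarrow> (c, q) \<in> E \<Longrightarrow> p = q"
  using assms
proof (induction arbitrary: c p q rule: binary_family.induct)
  case (leaf v)
  then show ?case by simp
next
  case (join A F E B F' E')
  have rootA: "(A, r) \<notin> E" for r
    using binary_family_arc[OF join.hyps(1), of A r] binary_family_subset[OF join.hyps(1), of r] by auto
  have rootB: "(B, r) \<notin> E'" for r
    using binary_family_arc[OF join.hyps(2), of B r] binary_family_subset[OF join.hyps(2), of r] by auto
  have AB: "(A, r) \<notin> E'" "(B, r) \<notin> E" for r
    using binary_family_arc[OF join.hyps(2), of A r] binary_family_arc[OF join.hyps(1), of B r]
      binary_family_join_root[OF join.hyps] by auto
  have "A \<noteq> B"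
    using binary_family_join_root(3)[OF join.hyps] binary_family_root[OF join.hyps(2)] by auto
  have EE: "\<not> ((c, r) \<in> E \<and> (c, r') \<in> E')" for r r'
    using binary_family_not_both[OF join.hyps, of c c] binary_family_arc[OF join.hyps(1), of c r]
      binary_family_arc[OF join.hyps(2), of c r'] by auto
  have "(c, r) \<in> E \<or> (c, r) \<in> E' \<or> c = A \<and> r = A \<union> B \<or> c = B \<and> r = A \<union> B"
    if "(c, r) \<in> E \<union> E' \<union> {(A, A \<union> B), (B, A \<union> B)}" for r
    using that by auto
  from this[OF join.prems(1)] this[OF join.prems(2)] show ?case
    using join.IH(1)[of c p q] join.IH(2)[of c p q] rootA rootB AB EE \<open>A \<noteq> B\<close> by metis
qed

lemma binary_family_children:
  assumes "binary_family A F E"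
  shows "X \<in> F \<Longrightarrow> (\<exists>v. X = {v}) \<and> {c. (c, X) \<in> E} = {}
    \<or> (\<nexists>v. X = {v}) \<and> (\<exists>c d. c \<noteq> d \<and> {c. (c, X) \<in> E} = {c, d})"
  using assms
proof (induction arbitrary: X rule: binary_family.induct)
  case (leaf v)
  then show ?case by simp
next
  case (join A F E B F' E')
  note roots = binary_family_join_root[OF join.hyps]
  let ?E = "E \<union> E' \<union> {(A, A \<union> B), (B, A \<union> B)}"
  consider "X = A \<union> B" | "X \<in> F" | "X \<in> F'" using join.prems by auto
  then show ?case
  proof cases
    case 1
    have "(c, X) \<notin> E" "(c, X) \<notin> E'" for c
      using binary_family_arc[OF join.hyps(1), of c X] binary_family_arc[OF join.hyps(2), of c X]
        roots 1 by auto
    then have "{c. (c, X) \<in> ?E} = {A, B}" using 1 by auto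
    moreover have "A \<noteq> B" using roots(3) binary_family_root[OF join.hyps(2)] by auto
    moreover obtain a b where ab: "a \<in> A" "b \<in> B"
      using binary_family_nonempty[OF join.hyps(1) binary_family_root[OF join.hyps(1)]]
        binary_family_nonempty[OF join.hyps(2) binary_family_root[OF join.hyps(2)]] by auto
    have "a \<noteq> b" using ab join.hyps(3) by blast
    moreover have "a \<in> X" "b \<in> X" using ab 1 by simp_all
    ultimately have "\<nexists>v. X = {v}" by auto
    then show ?thesis
      using \<open>{c. (c, X) \<in> ?E} = {A, B}\<close> \<open>A \<noteq> B\<close> by (intro disjI2 conjI exI[of _ A] exI[of _ B])
  next
    case 2
    have "(c, X) \<notin> E'" for c
      using binary_family_not_both[OF join.hyps 2, of X] binary_family_arc[OF join.hyps(2), of c X] by auto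
    moreover have "X \<noteq> A \<union> B" using 2 roots by auto
    ultimately have "{c. (c, X) \<in> ?E} = {c. (c, X) \<in> E}" by auto
    then show ?thesis using join.IH(1)[OF 2] by simp
  next
    case 3
    have "(c, X) \<notin> E" for c
      using binary_family_not_both[OF join.hyps _ 3, of X] binary_family_arc[OF join.hyps(1), of c X] by auto
    moreover have "X \<noteq> A \<union> B" using 3 roots by auto
    ultimately have "{c. (c, X) \<in> ?E} = {c. (c, X) \<in> E'}" by auto
    then show ?thesis using join.IH(2)[OF 3] by simp
  qed
qed

text \<open>Needed for the sides of a tree edge: going up from a node strictly inside
  \<open>c\<close> stays inside \<open>c\<close>, so the only way out of the subtree of
  \<open>c\<close> is the edge from \<open>c\<close> to its parent.\<close>

lemma binary_family_laminar:
  assumes "binary_family A F E"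
  shows "(u, w) \<in> E \<Longrightarrow> c \<in> F \<Longrightarrow> u \<subset> c \<Longrightarrow> w \<subseteq> c"
  using assms
proof (induction arbitrary: u w c rule: binary_family.induct)
  case (leaf v)
  then show ?case by simp
next
  case (join A F E B F' E')
  note subA = binary_family_subset[OF join.hyps(1)] and subB = binary_family_subset[OF join.hyps(2)]
  note nb = binary_family_not_both[OF join.hyps]
  note rootA = binary_family_root[OF join.hyps(1)] and rootB = binary_family_root[OF join.hyps(2)]
  consider "c = A \<union> B" | "c \<in> F" | "c \<in> F'" using join.prems(2) by auto
  then show ?case
  proof cases
    case 1
    then show ?thesis
      using join.prems(1) binary_family_arc[OF join.hyps(1), of u w] binary_family_arc[OF join.hyps(2), of u w]
        subA[of w] subB[of w] by auto
  next
    case 2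
    have "(u, w) \<notin> E'" using nb[OF 2, of u] binary_family_arc[OF join.hyps(2), of u w] join.prems(3) by auto
    moreover have "u \<noteq> A" using subA[OF 2] join.prems(3) by auto
    moreover have "u \<noteq> B" using nb[OF 2 rootB] join.prems(3) by auto
    ultimately have "(u, w) \<in> E" using join.prems(1) by auto
    then show ?thesis using join.IH(1)[OF _ 2 join.prems(3)] by simp
  next
    case 3
    have "(u, w) \<notin> E" using nb[OF _ 3, of u] binary_family_arc[OF join.hyps(1), of u w] join.prems(3) by auto
    moreover have "u \<noteq> B" using subB[OF 3] join.prems(3) by auto
    moreover have "u \<noteq> A" using nb[OF rootA 3] join.prems(3) by auto
    ultimately have "(u, w) \<in> E'" using join.prems(1) by auto
    then show ?thesis using join.IH(2)[OF _ 3 join.prems(3)] by simp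
  qed
qed

lemma binary_family_reaches_root:
  assumes "binary_family A F E"
  shows "X \<in> F \<Longrightarrow> (X, A) \<in> E\<^sup>*"
  using assms
proof (induction arbitrary: X rule: binary_family.induct)
  case (leaf v)
  then show ?case by simp
next
  case (join A F E B F' E')
  let ?E = "E \<union> E' \<union> {(A, A \<union> B), (B, A \<union> B)}"
  have mono: "E\<^sup>* \<subseteq> ?E\<^sup>*" "E'\<^sup>* \<subseteq> ?E\<^sup>*" by (intro rtrancl_mono; auto)+
  consider "X = A \<union> B" | "X \<in> F" | "X \<in> F'" using join.prems by auto
  then show ?case
  proof cases
    case 2
    then have "(X, A) \<in> ?E\<^sup>*" using join.IH(1) mono by auto
    then show ?thesis by (rule rtrancl_into_rtrancl) simp
  next
    case 3
    then have "(X, B) \<in> ?E\<^sup>*" using join.IH(2) mono by auto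
    then show ?thesis by (rule rtrancl_into_rtrancl) simp
  qed simp
qed

section \<open>Acyclicity of trees given by a parent relation\<close>

text \<open>Puts the cycles of the library into index form: the vertices are read off as the heads
  of the arcs, which make up the vertex list of the walk without its first entry and are therefore
  distinct.\<close>

lemma cycle_arcs:
  assumes "pre_digraph.cycle (with_proj T) p"
  shows "set p \<subseteq> parcs T" "distinct (map snd p)"
    and "\<And>i. Suc i < length p \<Longrightarrow> snd (p ! i) = fst (p ! Suc i)"
    and "p \<noteq> []" "snd (last p) = fst (hd p)"
proof -
  interpret pair_pre_digraph T .
  obtain u where u: "awalk u p u" "distinct (tl (awalk_verts u p))" and ne: "p \<noteq> []"
    using assms unfolding cycle_def by auto
  have cas: "pcas u p u" and sub: "set p \<subseteq> parcs T" using u(1) unfolding awalk_def by auto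
  show "set p \<subseteq> parcs T" by (rule sub)
  show "p \<noteq> []" by (rule ne)
  have "awalk_verts u p = fst (hd p) # map snd p"
    using awalk_verts_conv'[of u p u] cas ne by simp
  then show "distinct (map snd p)" using u(2) by simp
  have "(\<forall>i. Suc i < length q \<longrightarrow> snd (q ! i) = fst (q ! Suc i))
      \<and> (q \<noteq> [] \<longrightarrow> fst (hd q) = a \<and> snd (last q) = b)" if "pcas a q b" for a b and q :: "('a \<times> 'a) list"
    using that
  proof (induction q arbitrary: a)
    case (Cons e q)
    then have IH: "\<forall>i. Suc i < length q \<longrightarrow> snd (q ! i) = fst (q ! Suc i)"
      "q \<noteq> [] \<longrightarrow> fst (hd q) = snd e \<and> snd (last q) = b" "fst e = a" "q = [] \<longrightarrow> snd e = b"
      by auto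
    have "snd ((e # q) ! i) = fst ((e # q) ! Suc i)" if "Suc i < length (e # q)" for i
      using that IH(1,2) by (cases i) (auto simp: hd_conv_nth)
    then show ?case using IH by auto
  qed simp
  from this[OF cas] show "\<And>i. Suc i < length p \<Longrightarrow> snd (p ! i) = fst (p ! Suc i)"
    "snd (last p) = fst (hd p)" using ne by auto
qed

text \<open>A vertex of minimal size on an undirected cycle would have two parents.\<close>

lemma no_undirected_cycle:
  fixes T :: "'b pair_pre_digraph"
  assumes arcs: "\<And>x y. (x, y) \<in> parcs T \<Longrightarrow> R x y \<or> R y x"
    and rank: "\<And>x y. R x y \<Longrightarrow> rank x < (rank y :: nat)"
    and parent: "\<And>x y z. R x y \<Longrightarrow> R x z \<Longrightarrow> y = z"
    and cyc: "pre_digraph.cycle (with_proj T) p"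
  shows "length p < 3"
proof (rule ccontr)
  assume "\<not> length p < 3"
  then have m: "3 \<le> length p" by simp
  let ?w = "\<lambda>i. snd (p ! i)"
  note c = cycle_arcs[OF cyc]
  have inj: "i = j" if "i < length p" "j < length p" "?w i = ?w j" for i j
    using nth_eq_iff_index_eq[OF c(2), of i j] that by simp
  have adj: "R (?w i) (?w (Suc i)) \<or> R (?w (Suc i)) (?w i)" if "Suc i < length p" for i
  proof -
    have "p ! Suc i \<in> parcs T" using c(1) that nth_mem by blast
    then show ?thesis using arcs[of "fst (p ! Suc i)" "?w (Suc i)"] c(3)[OF that] by simp
  qed
  have adj0: "R (?w (length p - 1)) (?w 0) \<or> R (?w 0) (?w (length p - 1))"
  proof -
    have "0 < length p" using m by linarith
    then have "p ! 0 \<in> parcs T" using c(1) nth_mem by blast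
    then show ?thesis
      using arcs[of "fst (p ! 0)" "?w 0"] c(4,5) by (simp add: hd_conv_nth last_conv_nth)
  qed
  obtain a where a: "a < length p" "\<And>i. i < length p \<Longrightarrow> rank (?w a) \<le> rank (?w i)"
    using ex_min_if_finite[of "(\<lambda>i. rank (?w i)) ` {..<length p}"] m
    by (metis (no_types, lifting) arg_min_if_finite(1) arg_min_least empty_iff finite_lessThan lessThan_iff
        less_le_trans zero_less_numeral)
  have up: "R (?w a) (?w i)" if "i < length p" "R (?w a) (?w i) \<or> R (?w i) (?w a)" for i
    using that rank[of "?w i" "?w a"] a(2)[of i] by auto
  have False if "i < length p" "j < length p" "i \<noteq> j"
    "R (?w a) (?w i) \<or> R (?w i) (?w a)" "R (?w a) (?w j) \<or> R (?w j) (?w a)" for i j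
    using parent[OF up[OF that(1,4)] up[OF that(2,5)]] inj[OF that(1,2)] that(3) by simp
  note contra = this
  obtain n where n: "length p = Suc (Suc (Suc n))"
    using m by (metis Suc_le_D numeral_3_eq_3 Suc_le_mono)
  \<comment> \<open>The two neighbours of the minimal vertex on the cycle are needed; the first two
    cases wrap around the end of the list. Length at least 3 makes the neighbours different.\<close>
  consider "a = 0" | "a = Suc (Suc n)" | "a \<noteq> 0" "Suc a < length p" using a(1) n by linarith
  then show False
  proof cases
    case 1
    then show False using contra[of "Suc 0" "Suc (Suc n)"] adj[of 0] adj0 unfolding n by auto
  next
    case 2
    then show False using contra[of "Suc n" 0] adj[of "Suc n"] adj0 unfolding n by auto
  next
    case 3
    then obtain b where "a = Suc b" using not0_implies_Suc by blast
    then show False using 3 contra[of b "Suc a"] adj[of b] adj[of a] by auto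
  qed
qed

text \<open>The nodes are the sets of the family, numbered by \<open>h\<close> since decomposition
  trees live on natural numbers. The root has degree 2, or 0 for a single vertex, which maximum
  degree 3 allows. For the edge above \<open>c\<close> it suffices that the sides are included in
  \<open>c\<close> and \<open>?V - c\<close>, as \<open>row_count\<close> is monotone.\<close>

lemma rank_width_le_if_decomposable:
  fixes G :: "'a pair_pre_digraph"
  assumes fin: "finite (pverts G)" and sym: "sym (parcs G)" and dec: "decomposable G k (pverts G)"
  shows "rank_width G \<le> k"
proof -
  let ?V = "pverts G"
  obtain F E where bf: "binary_family ?V F E"
    and rows: "\<And>X. X \<in> F \<Longrightarrow> row_count G X (?V - X) \<le> k"
    using decomposable_binary_family[OF dec] by blast
  note finF = binary_family_finite[OF bf] and root = binary_family_root[OF bf]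
    and arc = binary_family_arc[OF bf] and parent = binary_family_unique_parent[OF bf]
    and sub = binary_family_subset[OF bf]
  obtain h :: "'a set \<Rightarrow> nat" where inj: "inj_on h F"
    using finite_imp_inj_to_nat_seg[OF finF] by blast
  have h_eq: "X = Y" if "h X = h Y" "X \<in> F" "Y \<in> F" for X Y
    using inj_onD[OF inj that(1)] that by simp
  define R where "R x y \<longleftrightarrow> (\<exists>c p. (c, p) \<in> E \<and> x = h c \<and> y = h p)" for x y
  define T where "T = \<lparr>pverts = h ` F, parcs = {(x, y). R x y \<or> R y x}\<rparr>"
  define L where "L v = h {v}" for v
  have T: "pverts T = h ` F" "\<And>x y. (x, y) \<in> parcs T \<longleftrightarrow> R x y \<or> R y x"
    unfolding T_def by simp_all
  have Rh: "R (h c) (h p) \<longleftrightarrow> (c, p) \<in> E" if "c \<in> F" "p \<in> F" for c p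
    unfolding R_def using that h_eq arc by metis
  have RF: "x \<in> h ` F" "y \<in> h ` F" if "R x y" for x y
    using that arc unfolding R_def by auto
  have Rne: "x \<noteq> y" if xy: "R x y" for x y
  proof
    assume "x = y"
    obtain c p where cp: "(c, p) \<in> E" "x = h c" "y = h p" using xy unfolding R_def by auto
    then have "c = p" using h_eq arc[OF cp(1)] \<open>x = y\<close> by simp
    then show False using arc[OF cp(1)] by simp
  qed
  have Tsub: "parcs T \<subseteq> pverts T \<times> pverts T"
    unfolding T_def using RF by auto
  have graph: "pair_graph T"
  proof
    show "finite (pverts T)" using finF T(1) by simp
    then show "finite (parcs T)" using Tsub finite_subset by blast
    show "symmetric (with_proj T)" unfolding symmetric_def T_def by (auto intro: symI)
  qed (use Tsub T(2) Rne in force)+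
  interpret T: pair_graph T by (rule graph)
  have "connected (with_proj T)"
    unfolding connected_def
  proof (rule strongly_connectedI)
    show "verts (with_proj (mk_symmetric (with_proj T))) \<noteq> {}" using root T(1) by auto
    have up: "h X \<rightarrow>\<^sup>*\<^bsub>with_proj T\<^esub> h ?V" if "X \<in> F" for X
    proof -
      have "(X, ?V) \<in> E\<^sup>*" by (rule binary_family_reaches_root[OF bf that])
      then show ?thesis
      proof (induction rule: converse_rtrancl_induct)
        case base
        show ?case using root T(1) by (intro T.reachable_refl) simp
      next
        case (step X Y)
        have "(h X, h Y) \<in> parcs T" using T(2) step(1) unfolding R_def by blast
        then show ?case using T.adj_reachable_trans step.IH by simp
      qed
    qed
    fix u v
    assume "u \<in> verts (with_proj (mk_symmetric (with_proj T)))"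
      "v \<in> verts (with_proj (mk_symmetric (with_proj T)))"
    then have "u \<in> h ` F" "v \<in> h ` F" using T(1) by simp_all
    then have "u \<rightarrow>\<^sup>*\<^bsub>with_proj T\<^esub> h ?V" "v \<rightarrow>\<^sup>*\<^bsub>with_proj T\<^esub> h ?V" using up by auto
    then have "u \<rightarrow>\<^sup>*\<^bsub>with_proj T\<^esub> v"
      using T.reachable_trans T.symmetric_reachable' by blast
    then show "u \<rightarrow>\<^sup>*\<^bsub>with_proj (mk_symmetric (with_proj T))\<^esub> v"
      by (rule T.reachable_mk_symmetricI)
  qed
  moreover have "\<not> (\<exists>p. pre_digraph.cycle (with_proj T) p \<and> 3 \<le> length p)"
  proof
    assume "\<exists>p. pre_digraph.cycle (with_proj T) p \<and> 3 \<le> length p"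
    then obtain p where p: "pre_digraph.cycle (with_proj T) p" "3 \<le> length p" by blast
    have "length p < 3"
    proof (rule no_undirected_cycle[OF _ _ _ p(1), of R "\<lambda>x. card (the_inv_into F h x)"])
      show "R x y \<or> R y x" if "(x, y) \<in> parcs T" for x y using that T(2) by simp
      show "card (the_inv_into F h x) < card (the_inv_into F h y)" if xy: "R x y" for x y
      proof -
        obtain c p where cp: "(c, p) \<in> E" "x = h c" "y = h p" using xy unfolding R_def by auto
        then have "card c < card p"
          using arc[OF cp(1)] binary_family_finite_member[OF bf] by (intro psubset_card_mono) auto
        then show ?thesis
          using arc[OF cp(1)] the_inv_into_f_f[OF inj] cp(2,3) by simp
      qed
      show "y = z" if xy: "R x y" and xz: "R x z" for x y z
      proof -
        obtain c p where cp: "(c, p) \<in> E" "x = h c" "y = h p" using xy unfolding R_def by auto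
        obtain d q where dq: "(d, q) \<in> E" "x = h d" "z = h q" using xz unfolding R_def by auto
        have "c = d" using h_eq arc[OF cp(1)] arc[OF dq(1)] cp(2) dq(2) by simp
        then show ?thesis using parent[of c p q] cp dq by simp
      qed
    qed
    then show False using p(2) by simp
  qed
  ultimately have tree: "undirected_tree T"
    unfolding undirected_tree_def using graph by simp
  have degree: "out_degree (with_proj T) (h X) = card ({c. (c, X) \<in> E} \<union> {p. (X, p) \<in> E})"
    if X: "X \<in> F" for X
  proof -
    let ?N = "{c. (c, X) \<in> E} \<union> {p. (X, p) \<in> E}"
    have NF: "?N \<subseteq> F" using arc by auto
    have "out_arcs (with_proj T) (h X) = (\<lambda>Y. (h X, h Y)) ` ?N"
    proof (rule equalityI)
      show "out_arcs (with_proj T) (h X) \<subseteq> (\<lambda>Y. (h X, h Y)) ` ?N"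
      proof
        fix e assume "e \<in> out_arcs (with_proj T) (h X)"
        then have e: "e \<in> parcs T" "fst e = h X" by (simp_all add: out_arcs_def)
        then obtain y where y: "e = (h X, y)" by (cases e) simp
        have "R (h X) y \<or> R y (h X)" using e(1) T(2) y by simp
        then obtain Y where "y = h Y" "(X, Y) \<in> E \<or> (Y, X) \<in> E"
          unfolding R_def using h_eq X arc by metis
        then show "e \<in> (\<lambda>Y. (h X, h Y)) ` ?N" using y by auto
      qed
      show "(\<lambda>Y. (h X, h Y)) ` ?N \<subseteq> out_arcs (with_proj T) (h X)"
      proof
        fix e assume "e \<in> (\<lambda>Y. (h X, h Y)) ` ?N"
        then obtain Y where Y: "e = (h X, h Y)" "(Y, X) \<in> E \<or> (X, Y) \<in> E" by auto
        then have "R (h Y) (h X) \<or> R (h X) (h Y)" using Rh arc by blast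
        then show "e \<in> out_arcs (with_proj T) (h X)"
          using T(2) Y(1) by (simp add: out_arcs_def disj_commute)
      qed
    qed
    moreover have "inj_on (\<lambda>Y. (h X, h Y)) ?N"
      using NF h_eq by (intro inj_onI) auto
    ultimately show ?thesis by (simp add: out_degree_def card_image)
  qed
  have parents: "card {p. (X, p) \<in> E} \<le> 1" "finite {p. (X, p) \<in> E}" for X
  proof -
    have "\<exists>q. {p. (X, p) \<in> E} \<subseteq> {q}"
      using parent[of X] by (cases "\<exists>q. (X, q) \<in> E") auto
    then obtain q where q: "{p. (X, p) \<in> E} \<subseteq> {q}" by blast
    show "card {p. (X, p) \<in> E} \<le> 1" using card_mono[OF _ q] by simp
    show "finite {p. (X, p) \<in> E}" using finite_subset[OF q] by simp
  qed
  have deg: "out_degree (with_proj T) (h X) \<le> 3 \<and> (out_degree (with_proj T) (h X) \<le> 1 \<longleftrightarrow> (\<exists>v. X = {v}))"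
    if X: "X \<in> F" for X
    using binary_family_children[OF bf X]
  proof
    assume "(\<exists>v. X = {v}) \<and> {c. (c, X) \<in> E} = {}"
    then show ?thesis using degree[OF X] parents(1)[of X] by simp
  next
    assume "(\<nexists>v. X = {v}) \<and> (\<exists>c d. c \<noteq> d \<and> {c. (c, X) \<in> E} = {c, d})"
    then have "\<nexists>v. X = {v}" and "\<exists>c d. c \<noteq> d \<and> {c. (c, X) \<in> E} = {c, d}" by simp_all
    then obtain c d where cd: "\<nexists>v. X = {v}" "c \<noteq> d" "{c. (c, X) \<in> E} = {c, d}"
      by (elim exE conjE)
    have "card ({c, d} \<union> {p. (X, p) \<in> E}) \<le> card {c, d} + card {p. (X, p) \<in> E}"
      by (rule card_Un_le)
    moreover have "card {c, d} \<le> card ({c, d} \<union> {p. (X, p) \<in> E})"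
      using parents(2) by (intro card_mono) auto
    moreover have "card {c, d} = 2" using cd(2) by simp
    ultimately have "2 \<le> out_degree (with_proj T) (h X)" "out_degree (with_proj T) (h X) \<le> 3"
      using parents(1)[of X] unfolding degree[OF X] cd(3) by linarith+
    then show ?thesis using cd(1) by simp
  qed
  have leaves: "leaves T = L ` ?V"
  proof (rule equalityI)
    show "leaves T \<subseteq> L ` ?V"
    proof
      fix x assume "x \<in> leaves T"
      then obtain X where X: "X \<in> F" "x = h X" "out_degree (with_proj T) (h X) \<le> 1"
        unfolding leaves_def T(1) by auto
      then obtain v where "X = {v}" using deg by blast
      then show "x \<in> L ` ?V" using X sub[OF X(1)] L_def by auto
    qed
    show "L ` ?V \<subseteq> leaves T"
      unfolding leaves_def T(1) L_def using binary_family_singleton[OF bf] deg by auto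
  qed
  have "inj_on L ?V"
    unfolding L_def using h_eq binary_family_singleton[OF bf] by (intro inj_onI) blast
  then have rd: "rank_decomposition G T L"
    unfolding rank_decomposition_def bij_betw_def using tree leaves deg T(1) by auto
  have hL: "X = {v}" if "h X = L v" "X \<in> F" "v \<in> ?V" for X v
    using h_eq[OF that(1)[unfolded L_def] that(2)] binary_family_singleton[OF bf that(3)] by simp
  \<comment> \<open>A walk from \<open>c\<close> that avoids the deleted edge can go up only from
    nodes properly inside \<open>c\<close>, and by \<open>binary_family_laminar\<close> their
    parents are still inside \<open>c\<close>.\<close>
  have lower: "edge_side G T L (h c) (h p) \<subseteq> c" if cp: "(c, p) \<in> E" for c p
  proof
    fix v assume "v \<in> edge_side G T L (h c) (h p)"
    then have v: "v \<in> ?V"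
      "(h c, L v) \<in> rtrancl_on (h ` F) (parcs T - {(h c, h p), (h p, h c)})"
      unfolding edge_side_def reachable_def delete_edge_def by (simp_all add: T(1))
    have "\<exists>X\<in>F. L v = h X \<and> X \<subseteq> c"
      using v(2)
    proof (induction rule: rtrancl_on_induct)
      case base
      show ?case using arc[OF cp] by auto
    next
      case (step x y)
      then obtain X where X: "X \<in> F" "x = h X" "X \<subseteq> c" by auto
      have "R x y \<or> R y x" using step(2) T(2) by simp
      then show ?case
      proof
        assume "R x y"
        then obtain X' Y where XY: "(X', Y) \<in> E" "x = h X'" "y = h Y" unfolding R_def by auto
        have X': "X' = X" using h_eq[of X' X] XY X arc[OF XY(1)] by simp
        have "X \<noteq> c"
        proof
          assume "X = c"
          then have "Y = p" using parent[of c Y p] XY(1) X' cp by simp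
          then show False using step(2) XY X' \<open>X = c\<close> by simp
        qed
        then have "Y \<subseteq> c"
          using binary_family_laminar[OF bf XY(1), of c] arc[OF cp] X' X(3) by auto
        then show ?thesis using XY arc[OF XY(1)] by auto
      next
        assume "R y x"
        then obtain Y X' where XY: "(Y, X') \<in> E" "x = h X'" "y = h Y" unfolding R_def by auto
        have "X' = X" using h_eq[of X' X] XY X arc[OF XY(1)] by simp
        then have "Y \<subseteq> c" using arc[OF XY(1)] X(3) by auto
        then show ?thesis using XY(3) arc[OF XY(1)] by auto
      qed
    qed
    then obtain X where "X \<in> F" "h X = L v" "X \<subseteq> c" by auto
    then show "v \<in> c" using hL[of X v] v(1) by auto
  qed
  \<comment> \<open>A walk from \<open>p\<close> could get below \<open>c\<close> only by stepping
    down to \<open>c\<close> itself, along the deleted edge.\<close>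
  have upper: "edge_side G T L (h p) (h c) \<subseteq> ?V - c" if cp: "(c, p) \<in> E" for c p
  proof
    fix v assume "v \<in> edge_side G T L (h p) (h c)"
    then have v: "v \<in> ?V"
      "(h p, L v) \<in> rtrancl_on (h ` F) (parcs T - {(h p, h c), (h c, h p)})"
      unfolding edge_side_def reachable_def delete_edge_def by (simp_all add: T(1))
    have "\<exists>X\<in>F. L v = h X \<and> \<not> X \<subseteq> c"
      using v(2)
    proof (induction rule: rtrancl_on_induct)
      case base
      show ?case using arc[OF cp] by auto
    next
      case (step x y)
      then obtain X where X: "X \<in> F" "x = h X" "\<not> X \<subseteq> c" by auto
      have "R x y \<or> R y x" using step(2) T(2) by simp
      then show ?case
      proof
        assume "R x y"
        then obtain X' Y where XY: "(X', Y) \<in> E" "x = h X'" "y = h Y" unfolding R_def by auto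
        have "X' = X" using h_eq[of X' X] XY X arc[OF XY(1)] by simp
        then have "\<not> Y \<subseteq> c" using arc[OF XY(1)] X(3) by auto
        then show ?thesis using XY arc[OF XY(1)] by auto
      next
        assume "R y x"
        then obtain Y X' where XY: "(Y, X') \<in> E" "x = h X'" "y = h Y" unfolding R_def by auto
        have X': "X' = X" using h_eq[of X' X] XY X arc[OF XY(1)] by simp
        have "Y \<noteq> c"
        proof
          assume "Y = c"
          then have "X = p" using parent[of c X p] XY(1) X' cp by simp
          then show False using step(2) XY X' \<open>Y = c\<close> by simp
        qed
        then have "\<not> Y \<subseteq> c"
          using binary_family_laminar[OF bf XY(1), of c] arc[OF cp] X' X(3) by auto
        then show ?thesis using XY arc[OF XY(1)] by auto
      qed
    qed
    then obtain X where "X \<in> F" "h X = L v" "\<not> X \<subseteq> c" by metis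
    then show "v \<in> ?V - c" using hL[of X v] v(1) by auto
  qed
  have cut: "cut_rank G (edge_side G T L x y) (edge_side G T L y x) \<le> k"
    if xy: "(x, y) \<in> parcs T" for x y
  proof -
    have *: "row_count G (edge_side G T L (h c) (h p)) (edge_side G T L (h p) (h c)) \<le> k"
      and fin': "finite (edge_side G T L (h c) (h p))" if cp: "(c, p) \<in> E" for c p
    proof -
      have "finite c" using binary_family_finite_member[OF bf] arc[OF cp] by simp
      then have "row_count G (edge_side G T L (h c) (h p)) (edge_side G T L (h p) (h c))
          \<le> row_count G c (?V - c)"
        by (rule row_count_mono[OF _ lower[OF cp] upper[OF cp]])
      then show "row_count G (edge_side G T L (h c) (h p)) (edge_side G T L (h p) (h c)) \<le> k"
        using rows[of c] arc[OF cp] by simp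
      show "finite (edge_side G T L (h c) (h p))"
        using finite_subset[OF lower[OF cp] \<open>finite c\<close>] .
    qed
    have "R x y \<or> R y x" using xy T(2) by simp
    then show ?thesis
    proof
      assume "R x y"
      then obtain c p where "(c, p) \<in> E" "x = h c" "y = h p" unfolding R_def by auto
      then show ?thesis using cut_rank_le_row_count[OF fin'] * order_trans by blast
    next
      assume "R y x"
      then obtain c p where "(c, p) \<in> E" "y = h c" "x = h p" unfolding R_def by auto
      \<comment> \<open>Here the rows of the matrix belong to the upper side, while the bound counts
        rows of the lower one; hence the transposed estimate.\<close>
      then show ?thesis using cut_rank_le_transposed_row_count[OF fin' sym] * order_trans by blast
    qed
  qed
  have "decomposition_width G T L \<le> k"
    unfolding decomposition_width_def
    using T.pair_finite_arcs cut by (subst Max_le_iff) auto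
  moreover have "?V \<noteq> {}" using binary_family_nonempty[OF bf root] .
  then have "rank_width G \<le> decomposition_width G T L"
    unfolding rank_width_def using rd by (auto intro!: Least_le)
  ultimately show ?thesis by simp
qed

section \<open>Graphs of twin-width at most 2\<close>

text \<open>A merge lowers the number of sets, even if \<open>X \<union> Y\<close> is already
  present, so merging at will comes to an end. A partition sequence therefore exists, and the
  \<open>LEAST\<close> in \<open>twin_width\<close> is attained.\<close>

lemma finite_set_family_merges:
  assumes "finite P"
  shows "\<exists>Ps. Ps \<noteq> [] \<and> hd Ps = P \<and> (\<forall>i. Suc i < length Ps \<longrightarrow> merges_to (Ps ! i) (Ps ! Suc i))
    \<and> card (last Ps) \<le> 1"
  using assms
proof (induction "card P" arbitrary: P rule: less_induct)
  case less
  show ?case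
  proof (cases "card P \<le> 1")
    case True
    then show ?thesis by (intro exI[of _ "[P]"]) simp
  next
    case False
    then obtain X Y where XY: "X \<in> P" "Y \<in> P" "X \<noteq> Y"
      using less.prems by (metis One_nat_def card_le_Suc0_iff_eq)
    let ?Q = "insert (X \<union> Y) (P - {X, Y})"
    have "card (P - {X, Y}) = card P - 2"
      using XY less.prems by (subst card_Diff_subset) auto
    then have "card ?Q \<le> Suc (card P - 2)"
      using card_insert_le_m1[of "Suc (card P - 2)" "P - {X, Y}"] by simp
    then have lt: "card ?Q < card P" using False by linarith
    obtain Ps where Ps: "Ps \<noteq> []" "hd Ps = ?Q"
      "\<forall>i. Suc i < length Ps \<longrightarrow> merges_to (Ps ! i) (Ps ! Suc i)" "card (last Ps) \<le> 1"
      using less.hyps[OF lt] less.prems by auto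
    have "merges_to ((P # Ps) ! i) ((P # Ps) ! Suc i)" if "Suc i < length (P # Ps)" for i
    proof (cases i)
      case 0
      have "merges_to P ?Q" unfolding merges_to_def using XY by blast
      then show ?thesis using 0 Ps(1,2) by (simp add: hd_conv_nth)
    next
      case (Suc j)
      then show ?thesis using that Ps(3) by simp
    qed
    then show ?thesis using Ps by (intro exI[of _ "P # Ps"]) auto
  qed
qed

lemma twin_width_sequence:
  assumes "finite (pverts G)"
  obtains Ps where "partition_sequence G Ps" "sequence_width G Ps = twin_width G"
proof -
  obtain Ps where "partition_sequence G Ps"
    using finite_set_family_merges[of "(\<lambda>v. {v}) ` pverts G"] assms
    unfolding partition_sequence_def by auto
  then have "\<exists>k Ps. partition_sequence G Ps \<and> sequence_width G Ps = k" by blast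
  then have "\<exists>Ps. partition_sequence G Ps \<and> sequence_width G Ps = twin_width G"
    unfolding twin_width_def by (rule LeastI_ex)
  then show thesis using that by blast
qed

lemma rank_width_twin_width_2:
  assumes G: "pair_graph G" and tww: "twin_width G \<le> 2" and free: "\<not> semi_induced_half_graph t G"
    and k: "16 * t + 42 \<le> k"
  shows "rank_width G \<le> k"
proof (cases "pverts G = {}")
  case True
  then show ?thesis by (simp add: rank_width_def)
next
  case False
  interpret G: pair_graph G by (rule G)
  have sym: "sym (parcs G)"
    using G.pair_sym_arcs by (simp add: symmetric_def)
  obtain Ps where Ps: "partition_sequence G Ps" "sequence_width G Ps = twin_width G"
    using twin_width_sequence[OF G.pair_finite_verts] .
  define P where "P i = Ps ! min i (length Ps - 1)" for i
  have ne: "Ps \<noteq> []" and hd: "hd Ps = (\<lambda>v. {v}) ` pverts G"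
    and merge: "\<And>i. Suc i < length Ps \<Longrightarrow> merges_to (Ps ! i) (Ps ! Suc i)"
    and last: "card (last Ps) \<le> 1"
    using Ps(1) unfolding partition_sequence_def by auto
  have P0: "P 0 = (\<lambda>v. {v}) ` pverts G" using ne hd by (simp add: P_def hd_conv_nth)
  have step: "P (Suc i) = P i \<or> merges_to (P i) (P (Suc i))" for i
  proof (cases "Suc i < length Ps")
    case True
    then show ?thesis using merge[of i] by (simp add: P_def min_def)
  next
    case False
    then have "min i (length Ps - 1) = length Ps - 1" "min (Suc i) (length Ps - 1) = length Ps - 1"
      by linarith+
    then show ?thesis by (simp add: P_def)
  qed
  have fin: "finite (P i)" for i
  proof (induction i)
    case 0
    then show ?case using P0 G.pair_finite_verts by simp
  next
    case (Suc i)
    then show ?case using step[of i] unfolding merges_to_def by auto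
  qed
  have "red_degree G (P i) X \<le> 2" if "X \<in> P i" for i X
  proof -
    have "min i (length Ps - 1) < length Ps" using ne by (simp add: min_less_iff_disj)
    then have "P i \<in> set Ps" unfolding P_def by (rule nth_mem)
    then have "max_red_degree G (P i) \<le> sequence_width G Ps"
      unfolding sequence_width_def by simp
    moreover have "red_degree G (P i) X \<le> max_red_degree G (P i)"
      unfolding max_red_degree_def using that fin[of i] by simp
    ultimately show ?thesis using Ps(2) tww by simp
  qed
  then interpret width_two_sequence G P
    using G.pair_finite_verts sym P0 step by unfold_locales
  have "P (length Ps - 1) = last Ps" using ne by (simp add: P_def last_conv_nth)
  then have "decomposable G k (pverts G)"
    using decomposable_verts[OF free k _ False] last by metis
  then show ?thesis by (rule rank_width_le_if_decomposable[OF G.pair_finite_verts sym])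
qed

section \<open>Monadic stability excludes large semi-induced half-graphs\<close>

text \<open>A semi-induced half-graph leaves the adjacencies within each side open. Two colours mark
  the sides, and \<open>\<phi>\<close> retains only edges from colour 0 to colour 1, so that exactly
  the half-graph remains.\<close>

lemma fo_transduces_half_graphs:
  fixes \<C> :: "'a pair_pre_digraph set"
  assumes ind: "\<And>t. \<exists>G\<in>\<C>. semi_induced_half_graph t G"
  shows "fo_transduces \<C> (range half_graph)"
proof -
  \<comment> \<open>The disjunction of the two colours, by de Morgan.\<close>
  define \<nu> where "\<nu> = FoNeg (FoConj (FoNeg (FoCol 0 0)) (FoNeg (FoCol 1 0)))"
  define \<phi> where "\<phi> = FoConj (FoAdj 0 1) (FoConj (FoCol 0 0) (FoCol 1 1))"
  have "\<exists>G\<in>\<C>. \<exists>C. digraph_iso (with_proj (fo_interpret \<nu> \<phi> G C)) (with_proj (half_graph t))" for t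
  proof -
    obtain G where G: "G \<in> \<C>" "semi_induced_half_graph t G" using ind by blast
    let ?H = "half_graph t"
    from G(2)[unfolded semi_induced_half_graph_def] obtain \<iota> where \<iota>:
      "inj_on \<iota> (pverts ?H) \<and> \<iota> ` pverts ?H \<subseteq> pverts G
        \<and> (\<forall>i\<in>{1..t}. \<forall>j\<in>{1..t}. (\<iota> (Inl i), \<iota> (Inr j)) \<in> parcs G \<longleftrightarrow> i \<le> j)"
      by (rule exE)
    then have inj: "inj_on \<iota> (pverts ?H)" and sub: "\<iota> ` pverts ?H \<subseteq> pverts G"
      and adj: "\<And>i j. i \<in> {1..t} \<Longrightarrow> j \<in> {1..t} \<Longrightarrow> (\<iota> (Inl i), \<iota> (Inr j)) \<in> parcs G \<longleftrightarrow> i \<le> j"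
      by simp_all
    have pvH: "pverts ?H = Inl ` {1..t} \<union> Inr ` {1..t}"
      and paH: "\<And>x y. (x, y) \<in> parcs ?H \<longleftrightarrow> (\<exists>i\<in>{1..t}. \<exists>j\<in>{1..t}. i \<le> j \<and>
        (x = Inl i \<and> y = Inr j \<or> x = Inr j \<and> y = Inl i))"
      by (auto simp: half_graph_def Let_def)
    define C :: "nat \<Rightarrow> 'a set" where "C c = (if c = 0 then \<iota> ` Inl ` {1..t} else \<iota> ` Inr ` {1..t})" for c
    let ?I = "fo_interpret \<nu> \<phi> G C"
    have pvI: "pverts ?I = \<iota> ` pverts ?H"
      using sub unfolding fo_interpret_def Let_def \<nu>_def pvH by (auto simp: C_def)
    have disj: "\<iota> (Inl i) \<noteq> \<iota> (Inr j)" if "i \<in> {1..t}" "j \<in> {1..t}" for i j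
      using inj_onD[OF inj, of "Inl i" "Inr j"] that unfolding pvH by auto
    have paI: "(u, v) \<in> parcs ?I \<longleftrightarrow> (\<exists>i\<in>{1..t}. \<exists>j\<in>{1..t}. i \<le> j \<and>
        (u = \<iota> (Inl i) \<and> v = \<iota> (Inr j) \<or> u = \<iota> (Inr j) \<and> v = \<iota> (Inl i)))" for u v
    proof -
      have *: "u \<in> pverts ?I \<and> v \<in> pverts ?I \<and> u \<noteq> v \<and> fo_sat G C ((\<lambda>_. u)(1 := v)) \<phi> \<longleftrightarrow>
        (\<exists>i\<in>{1..t}. \<exists>j\<in>{1..t}. i \<le> j \<and> u = \<iota> (Inl i) \<and> v = \<iota> (Inr j))" for u v
      proof -
        have sat: "fo_sat G C ((\<lambda>_. u)(1 := v)) \<phi> \<longleftrightarrow>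
          (u, v) \<in> parcs G \<and> u \<in> \<iota> ` Inl ` {1..t} \<and> v \<in> \<iota> ` Inr ` {1..t}"
          by (simp add: \<phi>_def C_def)
        show ?thesis
        proof
          assume "u \<in> pverts ?I \<and> v \<in> pverts ?I \<and> u \<noteq> v \<and> fo_sat G C ((\<lambda>_. u)(1 := v)) \<phi>"
          then have "(u, v) \<in> parcs G" "u \<in> \<iota> ` Inl ` {1..t}" "v \<in> \<iota> ` Inr ` {1..t}"
            unfolding sat by simp_all
          then obtain i j where ij: "i \<in> {1..t}" "j \<in> {1..t}" "u = \<iota> (Inl i)" "v = \<iota> (Inr j)"
            by (elim imageE) simp
          then have "i \<le> j" using adj[of i j] \<open>(u, v) \<in> parcs G\<close> by simp
          then show "\<exists>i\<in>{1..t}. \<exists>j\<in>{1..t}. i \<le> j \<and> u = \<iota> (Inl i) \<and> v = \<iota> (Inr j)"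
            using ij by (intro bexI[of _ i] bexI[of _ j]) simp_all
        next
          assume "\<exists>i\<in>{1..t}. \<exists>j\<in>{1..t}. i \<le> j \<and> u = \<iota> (Inl i) \<and> v = \<iota> (Inr j)"
          then obtain i j where ij: "i \<in> {1..t}" "j \<in> {1..t}" "i \<le> j" "u = \<iota> (Inl i)" "v = \<iota> (Inr j)"
            by (elim bexE conjE)
          then have "(u, v) \<in> parcs G" "u \<noteq> v" using adj[OF ij(1,2)] disj[OF ij(1,2)] by simp_all
          then show "u \<in> pverts ?I \<and> v \<in> pverts ?I \<and> u \<noteq> v \<and> fo_sat G C ((\<lambda>_. u)(1 := v)) \<phi>"
            unfolding sat pvI pvH using ij by simp
        qed
      qed
      have "(u, v) \<in> parcs ?I \<longleftrightarrow>
        (u \<in> pverts ?I \<and> v \<in> pverts ?I \<and> u \<noteq> v \<and> fo_sat G C ((\<lambda>_. u)(1 := v)) \<phi>)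
        \<or> (v \<in> pverts ?I \<and> u \<in> pverts ?I \<and> v \<noteq> u \<and> fo_sat G C ((\<lambda>_. v)(1 := u)) \<phi>)"
        unfolding fo_interpret_def Let_def by auto
      then show ?thesis unfolding * by blast
    qed
    define g where "g = the_inv_into (pverts ?H) \<iota>"
    have g: "g (\<iota> x) = x" if "x \<in> pverts ?H" for x
      unfolding g_def using the_inv_into_f_f[OF inj that] .
    define f where "f = \<lparr>iso_verts = g, iso_arcs = map_prod g g, iso_head = snd, iso_tail = fst\<rparr>"
    have gl: "g (\<iota> (Inl i)) = Inl i" "g (\<iota> (Inr i)) = Inr i" if "i \<in> {1..t}" for i
      using g that unfolding pvH by auto
    have arcsI: "parcs ?I \<subseteq> pverts ?I \<times> pverts ?I"
      unfolding pvI pvH using paI by auto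
    have inj_g: "inj_on g (pverts ?I)"
      unfolding pvI using g by (intro inj_onI) auto
    have "digraph_iso (with_proj ?I) (with_proj ?H)"
      unfolding digraph_iso_def
    proof (intro exI conjI)
      show "pre_digraph.digraph_isomorphism (with_proj ?I) f"
        unfolding pre_digraph.digraph_isomorphism_def
      proof (intro conjI)
        show "wf_digraph (with_proj ?I)"
          by unfold_locales (use arcsI in auto)
        show "inj_on (iso_verts f) (verts (with_proj ?I))" using inj_g by (simp add: f_def)
        have "inj_on (map_prod g g) (pverts ?I \<times> pverts ?I)"
          by (rule map_prod_inj_on[OF inj_g inj_g])
        then show "inj_on (iso_arcs f) (arcs (with_proj ?I))"
          using inj_on_subset[OF _ arcsI] by (simp add: f_def)
      qed (auto simp: f_def)
      show "with_proj ?H = app_iso f (with_proj ?I)"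
      proof (rule pre_digraph.equality)
        have "g ` pverts ?I = pverts ?H"
          unfolding pvI image_image using g by auto
        then show "verts (with_proj ?H) = verts (app_iso f (with_proj ?I))" by (simp add: f_def)
        have "map_prod g g ` parcs ?I = parcs ?H"
        proof (intro equalityI subsetI)
          fix e assume "e \<in> map_prod g g ` parcs ?I"
          then obtain u v where e: "(u, v) \<in> parcs ?I" "e = (g u, g v)" by auto
          from e(1) obtain i j where "i \<in> {1..t}" "j \<in> {1..t}" "i \<le> j"
            "u = \<iota> (Inl i) \<and> v = \<iota> (Inr j) \<or> u = \<iota> (Inr j) \<and> v = \<iota> (Inl i)"
            unfolding paI by blast
          then show "e \<in> parcs ?H" unfolding e(2) paH using gl by metis
        next
          fix e assume e: "e \<in> parcs ?H"
          obtain x y where xy: "e = (x, y)" by (cases e)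
          from e obtain i j where ij: "i \<in> {1..t}" "j \<in> {1..t}" "i \<le> j"
            "x = Inl i \<and> y = Inr j \<or> x = Inr j \<and> y = Inl i"
            unfolding xy paH by blast
          then have "(\<iota> x, \<iota> y) \<in> parcs ?I" unfolding paI by blast
          moreover have "e = map_prod g g (\<iota> x, \<iota> y)" using ij gl unfolding xy by auto
          ultimately show "e \<in> map_prod g g ` parcs ?I" by blast
        qed
        then show "arcs (with_proj ?H) = arcs (app_iso f (with_proj ?I))" by (simp add: f_def)
      qed (simp_all add: f_def)
    qed
    then show ?thesis using G(1) by blast
  qed
  moreover have "fo_fv \<nu> \<subseteq> {0}" "fo_fv \<phi> \<subseteq> {0, 1}" by (simp_all add: \<nu>_def \<phi>_def)
  ultimately show ?thesis unfolding fo_transduces_def by blast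
qed

theorem theorem5p7:
  shows "(\<forall>(t::nat) (G :: 'a pair_pre_digraph).
            t > 0 \<and> pair_graph G \<and> twin_width G \<le> 2 \<and> \<not> semi_induced_half_graph t G
              \<longrightarrow> rank_width G \<le> 22 * t + 170)
       \<and> (\<forall>\<C> :: 'a pair_pre_digraph set.
            (\<forall>G\<in>\<C>. pair_graph G \<and> twin_width G \<le> 2) \<and> monadically_stable \<C>
              \<longrightarrow> (\<exists>k. \<forall>G\<in>\<C>. rank_width G \<le> k))"
proof (intro conjI allI impI)
  fix t :: nat and G :: "'a pair_pre_digraph"
  assume *: "t > 0 \<and> pair_graph G \<and> twin_width G \<le> 2 \<and> \<not> semi_induced_half_graph t G"
  then show "rank_width G \<le> 22 * t + 170"
    by (intro rank_width_twin_width_2[of G t]) auto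
next
  fix \<C> :: "'a pair_pre_digraph set"
  assume *: "(\<forall>G\<in>\<C>. pair_graph G \<and> twin_width G \<le> 2) \<and> monadically_stable \<C>"
  \<comment> \<open>Otherwise every half-graph would be semi-induced in some member, and the class
    would transduce them all.\<close>
  have "\<exists>t. \<forall>G\<in>\<C>. \<not> semi_induced_half_graph t G"
    using * fo_transduces_half_graphs[of \<C>] unfolding monadically_stable_def by blast
  then obtain t where "\<forall>G\<in>\<C>. \<not> semi_induced_half_graph t G" by blast
  then have "\<forall>G\<in>\<C>. rank_width G \<le> 16 * t + 42"
    using * rank_width_twin_width_2 by blast
  then show "\<exists>k. \<forall>G\<in>\<C>. rank_width G \<le> k" by blast
qed

end
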